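(* Let $g, r, d$ be integers with $g\ge 0$ and $r\ge 0$, and let $\Gamma$ be a chain of $g$ loops with generic edge lengths. If $\rho=g-(r+1)(g-d+r)$ is nonnegative, then the dimension of $W^r_d(\Gamma)$ is $\min\{\rho,g\}$.
   Context: Chain of loops: for $g\ge 0$ and positive reals $\ell_1,\dots,\ell_g,m_1,\dots,m_g$, the chain of $g$ loops $\Gamma$ is the compact connected metric graph with points $v_0,\dots,v_g$ in which, for each $1\le i\le g$, exactly two edges join $v_{i-1}$ to $v_i$: a top edge of length $\ell_i$ and a bottom edge of length $m_i$ (together forming the $i$th loop); there are no other edges (for $g=0$, $\Gamma$ is the single point $v_0$). The edge lengths are generic if none of the ratios $\ell_i/m_i$ is equal to the ratio of two positive integers whose sum is less than or equal to $2g-2$. Divisors on a metric graph $\Gamma$: $\operatorname{Div}(\Gamma)$ is the free abelian group on the points of $\Gamma$; the degree of a divisor is the sum of its coefficients; a divisor is effective if all its coefficients are nonnegative. For a continuous function $\psi$ on $\Gamma$ that is linear with integer slope on each edge of some finite subdivision of $\Gamma$, $\operatorname{div}(\psi)=\sum_v \operatorname{ord}_v(\psi)\,v$, where $\operatorname{ord}_v(\psi)$ is the sum of the incoming slopes of $\psi$ at $v$ along the edges containing $v$. Two divisors are equivalent, $D\sim D'$, if $D-D'=\operatorname{div}(\psi)$ for some such $\psi$. Rank: $r(D)=-1$ if $D$ is not equivalent to an effective divisor; otherwise $r(D)$ is the largest nonnegative integer $r$ such that $D-E$ is equivalent to an effective divisor for every effective divisor $E$ of degree $r$ on $\Gamma$.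 The rank depends only on the equivalence class. $\operatorname{Pic}_d(\Gamma)$ is the set of equivalence classes of divisors of degree $d$ on $\Gamma$. It is a real torus of dimension $g$ (a translate of the Jacobian torus $\operatorname{Pic}_0(\Gamma)$); its topology is the quotient topology from the surjection $\Gamma^g\to\operatorname{Pic}_d(\Gamma)$, $(w_1,\dots,w_g)\mapsto [w_1+\cdots+w_g+(d-g)v_0]$. $W^r_d(\Gamma)\subset \operatorname{Pic}_d(\Gamma)$ is the subset of divisor classes of degree $d$ and rank at least $r$; its dimension is its dimension as a subset of this real torus (topological dimension). *)

theory Defs
  imports "HOL-Analysis.Analysis" "HOL-Library.Poly_Mapping"
begin

section \<open>Topological preliminaries\<close>

definition quotient_topology :: "'a topology \<Rightarrow> 'b set \<Rightarrow> ('a \<Rightarrow> 'b) \<Rightarrow> 'b topology" where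
  "quotient_topology X Y f =
     topology (\<lambda>U. U \<subseteq> Y \<and> openin X {x \<in> topspace X. f x \<in> U})"

lemma openin_quotient_topology:
  "openin (quotient_topology X Y f) U \<longleftrightarrow> U \<subseteq> Y \<and> openin X {x \<in> topspace X. f x \<in> U}"
proof -
  have "istopology (\<lambda>U. U \<subseteq> Y \<and> openin X {x \<in> topspace X. f x \<in> U})"
    unfolding istopology_def
  proof (intro conjI allI impI)
    fix S T
    assume S: "S \<subseteq> Y \<and> openin X {x \<in> topspace X. f x \<in> S}"
      and T: "T \<subseteq> Y \<and> openin X {x \<in> topspace X. f x \<in> T}"
    show "S \<inter> T \<subseteq> Y" using S by blast
    have "{x \<in> topspace X. f x \<in> S \<inter> T} = {x \<in> topspace X. f x \<in> S} \<inter> {x \<in> topspace X. f x \<in> T}"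
      by blast
    then show "openin X {x \<in> topspace X. f x \<in> S \<inter> T}" using S T by auto
  next
    fix \<K>
    assume K: "\<forall>K\<in>\<K>. K \<subseteq> Y \<and> openin X {x \<in> topspace X. f x \<in> K}"
    show "\<Union>\<K> \<subseteq> Y" using K by blast
    have "{x \<in> topspace X. f x \<in> \<Union>\<K>} = (\<Union>K\<in>\<K>. {x \<in> topspace X. f x \<in> K})" by blast
    then show "openin X {x \<in> topspace X. f x \<in> \<Union>\<K>}" using K by auto
  qed
  then show ?thesis
    unfolding quotient_topology_def by (simp add: topology_inverse')
qed

lemma topspace_quotient_topology:
  assumes "f \<in> topspace X \<rightarrow> Y"
  shows "topspace (quotient_topology X Y f) = Y"
proof
  show "topspace (quotient_topology X Y f) \<subseteq> Y"
    unfolding topspace_def openin_quotient_topology by blast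
  have "{x \<in> topspace X. f x \<in> Y} = topspace X" using assms by auto
  then show "Y \<subseteq> topspace (quotient_topology X Y f)"
    by (intro openin_subset) (simp add: openin_quotient_topology)
qed

lemma quotient_map_quotient_topology:
  assumes "f ` topspace X = Y"
  shows "quotient_map X (quotient_topology X Y f) f"
proof -
  have "topspace (quotient_topology X Y f) = Y"
    using assms by (intro topspace_quotient_topology) auto
  then show ?thesis
    using assms by (simp add: quotient_map_def openin_quotient_topology)
qed

text \<open>Dimension is the library's small inductive dimension, which agrees with the covering
  dimension on separable metrizable spaces, in particular on subspaces of a real torus.
  Since \<^term>\<open>X dim_le n\<close> is monotone in \<^term>\<open>n\<close>, the value is unique if it exists.\<close>

definition has_dimension :: "'a topology \<Rightarrow> int \<Rightarrow> bool" where
  "has_dimension X n \<longleftrightarrow> X dim_le n \<and> \<not> X dim_le (n - 1)"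

section \<open>Metric graphs\<close>

text \<open>A metric graph is given by a finite graph with edge lengths. The orientation of the edges
  only serves to parametrize each edge \<open>e\<close> by the interval from \<open>0\<close> (at its tail) to \<open>len e\<close>
  (at its head).\<close>

record ('v, 'e) metric_graph =
  verts :: "'v set"
  edges :: "'e set"
  tail :: "'e \<Rightarrow> 'v"
  head :: "'e \<Rightarrow> 'v"
  len :: "'e \<Rightarrow> real"

datatype ('v, 'e) point = Vertex 'v | Interior 'e real

definition points :: "('v, 'e) metric_graph \<Rightarrow> ('v, 'e) point set" where
  "points G = Vertex ` verts G \<union> {Interior e t | e t. e \<in> edges G \<and> 0 < t \<and> t < len G e}"

definition edge_point :: "('v, 'e) metric_graph \<Rightarrow> 'e \<Rightarrow> real \<Rightarrow> ('v, 'e) point" where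
  "edge_point G e t =
     (if t = 0 then Vertex (tail G e) else if t = len G e then Vertex (head G e) else Interior e t)"

text \<open>The topology glued from the closed edges. For a finite graph it is the topology of the
  path metric (and discrete on isolated vertices).\<close>

definition graph_topology :: "('v, 'e) metric_graph \<Rightarrow> ('v, 'e) point topology" where
  "graph_topology G =
     topology (\<lambda>U. U \<subseteq> points G \<and>
       (\<forall>e\<in>edges G. openin (top_of_set {0..len G e}) {t \<in> {0..len G e}. edge_point G e t \<in> U}))"

lemma openin_graph_topology:
  "openin (graph_topology G) U \<longleftrightarrow> U \<subseteq> points G \<and>
     (\<forall>e\<in>edges G. openin (top_of_set {0..len G e}) {t \<in> {0..len G e}. edge_point G e t \<in> U})"
proof -
  let ?T = "\<lambda>e. top_of_set {0..len G e}"
  have eq: "(U \<subseteq> points G \<and>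
      (\<forall>e\<in>edges G. openin (?T e) {t \<in> {0..len G e}. edge_point G e t \<in> U})) \<longleftrightarrow>
      U \<subseteq> points G \<and> (\<forall>e\<in>edges G. openin (quotient_topology (?T e) UNIV (edge_point G e)) U)" for U
    by (simp add: openin_quotient_topology)
  have "istopology (\<lambda>U. U \<subseteq> points G \<and>
      (\<forall>e\<in>edges G. openin (?T e) {t \<in> {0..len G e}. edge_point G e t \<in> U}))"
    unfolding eq istopology_def by (auto intro: openin_Int openin_Union)
  then show ?thesis
    unfolding graph_topology_def by (simp add: topology_inverse')
qed

section \<open>Divisors\<close>

definition Div :: "('v, 'e) metric_graph \<Rightarrow> (('v, 'e) point \<Rightarrow>\<^sub>0 int) set" where
  "Div G = {D. Poly_Mapping.keys D \<subseteq> points G}"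

definition deg :: "('p \<Rightarrow>\<^sub>0 int) \<Rightarrow> int" where
  "deg D = (\<Sum>p\<in>Poly_Mapping.keys D. Poly_Mapping.lookup D p)"

definition effective :: "('p \<Rightarrow>\<^sub>0 int) \<Rightarrow> bool" where
  "effective D \<longleftrightarrow> (\<forall>p. 0 \<le> Poly_Mapping.lookup D p)"

text \<open>The finite set \<open>S\<close> holds the points at which the edges are subdivided.\<close>

definition piecewise_linear :: "('v, 'e) metric_graph \<Rightarrow> (('v, 'e) point \<Rightarrow> real) \<Rightarrow> bool" where
  "piecewise_linear G \<psi> \<longleftrightarrow>
     continuous_map (graph_topology G) euclideanreal \<psi> \<and>
     (\<exists>S \<subseteq> points G. finite S \<and>
        (\<forall>e\<in>edges G. \<forall>a b. 0 \<le> a \<and> a < b \<and> b \<le> len G e \<and> edge_point G e ` {a<..<b} \<inter> S = {} \<longrightarrow>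
           (\<exists>k::int. \<forall>t\<in>{a..b}.
              \<psi> (edge_point G e t) = \<psi> (edge_point G e a) + of_int k * (t - a))))"

text \<open>A point \<open>p\<close> at parameter \<open>t\<close> of an edge is approached along that edge from below (if \<open>0 < t\<close>)
  and from above (if \<open>t < len e\<close>); the incoming slopes are the left derivative and the negative
  of the right derivative. A vertex may occur at several parameters.\<close>

definition ord_at :: "('v, 'e) metric_graph \<Rightarrow> (('v, 'e) point \<Rightarrow> real) \<Rightarrow> ('v, 'e) point \<Rightarrow> real" where
  "ord_at G \<psi> p =
     (\<Sum>e\<in>edges G. \<Sum>t\<in>{t \<in> {0..len G e}. edge_point G e t = p}.
        (if 0 < t then vector_derivative (\<lambda>s. \<psi> (edge_point G e s)) (at_left t) else 0) +
        (if t < len G e then - vector_derivative (\<lambda>s. \<psi> (edge_point G e s)) (at_right t) else 0))"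

text \<open>\<open>is_div G \<psi> D\<close> says \<open>div \<psi> = D\<close>; the orders of a piecewise linear function are integers,
  nonzero at only finitely many points.\<close>

definition is_div ::
  "('v, 'e) metric_graph \<Rightarrow> (('v, 'e) point \<Rightarrow> real) \<Rightarrow> (('v, 'e) point \<Rightarrow>\<^sub>0 int) \<Rightarrow> bool" where
  "is_div G \<psi> D \<longleftrightarrow>
     D \<in> Div G \<and> (\<forall>p\<in>points G. real_of_int (Poly_Mapping.lookup D p) = ord_at G \<psi> p)"

definition lin_equiv ::
  "('v, 'e) metric_graph \<Rightarrow> ((('v, 'e) point \<Rightarrow>\<^sub>0 int) \<times> (('v, 'e) point \<Rightarrow>\<^sub>0 int)) set" where
  "lin_equiv G = {(D, D'). D \<in> Div G \<and> D' \<in> Div G \<and>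
     (\<exists>\<psi>. piecewise_linear G \<psi> \<and> is_div G \<psi> (D - D'))}"

definition equiv_effective :: "('v, 'e) metric_graph \<Rightarrow> (('v, 'e) point \<Rightarrow>\<^sub>0 int) \<Rightarrow> bool" where
  "equiv_effective G D \<longleftrightarrow> (\<exists>F. (D, F) \<in> lin_equiv G \<and> effective F)"

definition rank :: "('v, 'e) metric_graph \<Rightarrow> (('v, 'e) point \<Rightarrow>\<^sub>0 int) \<Rightarrow> int" where
  "rank G D =
     (if equiv_effective G D
      then int (GREATEST r::nat. \<forall>E\<in>Div G. effective E \<and> deg E = int r \<longrightarrow> equiv_effective G (D - E))
      else -1)"

section \<open>The Picard torus and the Brill-Noether locus\<close>

definition Pic :: "('v, 'e) metric_graph \<Rightarrow> int \<Rightarrow> (('v, 'e) point \<Rightarrow>\<^sub>0 int) set set" where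
  "Pic G d = {D \<in> Div G. deg D = d} // lin_equiv G"

text \<open>Here \<open>g\<close> is meant to be the first Betti number of \<open>G\<close> and \<open>v0\<close> a base point.\<close>

definition Pic_topology ::
  "('v, 'e) metric_graph \<Rightarrow> nat \<Rightarrow> ('v, 'e) point \<Rightarrow> int \<Rightarrow> (('v, 'e) point \<Rightarrow>\<^sub>0 int) set topology" where
  "Pic_topology G g v0 d =
     quotient_topology (product_topology (\<lambda>_. graph_topology G) {1..g}) (Pic G d)
       (\<lambda>w. lin_equiv G `` {(\<Sum>i\<in>{1..g}. frag_of (w i)) + frag_cmul (d - int g) (frag_of v0)})"

definition W :: "('v, 'e) metric_graph \<Rightarrow> int \<Rightarrow> int \<Rightarrow> (('v, 'e) point \<Rightarrow>\<^sub>0 int) set set" where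
  "W G r d = {lin_equiv G `` {D} | D. D \<in> Div G \<and> deg D = d \<and> r \<le> rank G D}"

section \<open>Chains of loops\<close>

datatype chain_edge = Top nat | Bottom nat

primrec loop_index :: "chain_edge \<Rightarrow> nat" where
  "loop_index (Top i) = i"
| "loop_index (Bottom i) = i"

definition chain_of_loops ::
  "nat \<Rightarrow> (nat \<Rightarrow> real) \<Rightarrow> (nat \<Rightarrow> real) \<Rightarrow> (nat, chain_edge) metric_graph" where
  "chain_of_loops g \<l> \<m> =
     \<lparr>verts = {0..g},
      edges = Top ` {1..g} \<union> Bottom ` {1..g},
      tail = (\<lambda>e. loop_index e - 1),
      head = loop_index,
      len = (\<lambda>e. case e of Top i \<Rightarrow> \<l> i | Bottom i \<Rightarrow> \<m> i)\<rparr>"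

definition generic_lengths :: "nat \<Rightarrow> (nat \<Rightarrow> real) \<Rightarrow> (nat \<Rightarrow> real) \<Rightarrow> bool" where
  "generic_lengths g \<l> \<m> \<longleftrightarrow>
     (\<forall>i\<in>{1..g}. \<not> (\<exists>a b :: int. 0 < a \<and> 0 < b \<and> a + b \<le> 2 * int g - 2 \<and>
        \<l> i / \<m> i = of_int a / of_int b))"

end

theory Submission
  imports Defs
begin

text \<open>Contracting all loops but one identifies \<open>Pic\<^sub>d\<close> with a product of \<open>g\<close> circles. Let all chips of a
  divisor travel to the right: a loop stops one chip, unless its coordinate matches the current number
  of chips, in which case all of them pass. The class is effective iff the number of chips is
  nonnegative at the right end.
  For the rank, an adversary removes \<open>r\<close> chips on the way. By genericity a loop lets all chips pass for at
  most one number of removals made so far, and the adversary fails only if for each number of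
  removals \<open>0, \<dots>, r\<close> this happens at least \<open>g - d + r\<close> times. So at least \<open>(r + 1) (g - d + r)\<close>
  coordinates of a class in \<open>W\<^sup>r\<^sub>d\<close> lie in a finite set. Conversely, prescribing that many coordinates
  along a rectangular tableau suffices and leaves the others free.

  A subset of the torus with all but \<open>k\<close> coordinates in a finite set has inductive dimension at most
  \<open>k\<close>, since the boundaries of small boxes fix one more coordinate. The \<open>k\<close>-cube does not have
  smaller dimension: otherwise it would be covered by \<open>k\<close> families of small separated
  sets, contradicting Kuhn's combinatorial lemma.\<close>

section \<open>Covering dimension of the cube\<close>

text \<open>The constant \<open>2 * g - 2\<close> comes from the degree. If any coordinate is
  constrained at all, then \<open>g - d + r\<close> is at least 1 and
  \<open>(r + 1) * (g - d + r)\<close> is at most \<open>g\<close>, so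
  \<open>d \<le> g + r - 1 \<le> 2 * g - 2\<close>; this is the range of chip numbers that
  genericity has to control. The two directions face different adversaries. To constrain the
  coordinates of a class, it is enough to remove chips at vertices, where the best strategy obeys a
  recursion. To show that a tableau guarantees the rank, every effective divisor of degree
  \<open>r\<close> must be beaten, including those with chips inside loops; an invariant that
  compares the chips left with the tableau path handles this. The locus is never described exactly:
  the upper bound on its dimension uses a superset, the lower bound an embedded cube. If
  \<open>g - d + r\<close> is negative, truncating the number of columns at 0 turns both arguments
  into statements about the whole torus, hence the minimum with \<open>g\<close>.\<close>

definition separated_families ::
  "nat \<Rightarrow> 'a::metric_space set \<Rightarrow> real \<Rightarrow> real \<Rightarrow> (nat \<Rightarrow> 'a set set) \<Rightarrow> bool" where
  "separated_families n K \<epsilon> \<delta> F \<longleftrightarrow>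
     K \<subseteq> (\<Union>j<n. \<Union>(F j)) \<and>
     (\<forall>j A x y. j < n \<longrightarrow> A \<in> F j \<longrightarrow> x \<in> A \<longrightarrow> y \<in> A \<longrightarrow> dist x y < \<epsilon>) \<and>
     (\<forall>j A B x y. j < n \<longrightarrow> A \<in> F j \<longrightarrow> B \<in> F j \<longrightarrow> x \<in> A \<longrightarrow> y \<in> B \<longrightarrow>
        dist x y < \<delta> \<longrightarrow> A = B)"

text \<open>A metric form of ``covering dimension less than \<open>n\<close>''. Unlike open covers of bounded order, separated
  families are easily merged, which makes the property stable under finite unions.\<close>

definition fine_cover :: "nat \<Rightarrow> 'a::metric_space set \<Rightarrow> bool" where
  "fine_cover n K \<longleftrightarrow> (\<forall>\<epsilon>>0. \<exists>\<delta>>0. \<exists>F. separated_families n K \<epsilon> \<delta> F)"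

lemma fine_coverE:
  assumes "fine_cover n K" "0 < \<epsilon>"
  obtains \<delta> F where "0 < \<delta>" "K \<subseteq> (\<Union>j<n. \<Union>(F j))"
    "\<And>j A x y. j < n \<Longrightarrow> A \<in> F j \<Longrightarrow> x \<in> A \<Longrightarrow> y \<in> A \<Longrightarrow> dist x y < \<epsilon>"
    "\<And>j A B x y. j < n \<Longrightarrow> A \<in> F j \<Longrightarrow> B \<in> F j \<Longrightarrow> x \<in> A \<Longrightarrow> y \<in> B \<Longrightarrow> dist x y < \<delta> \<Longrightarrow> A = B"
proof -
  obtain \<delta> F where "0 < \<delta>" "separated_families n K \<epsilon> \<delta> F"
    using assms unfolding fine_cover_def by blast
  then show thesis unfolding separated_families_def by (elim conjE, intro that[of \<delta> F]) simp_all
qed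

lemma fine_cover_empty: "fine_cover n {}"
  by (auto simp: fine_cover_def separated_families_def intro!: exI[of _ 1] exI[of _ "\<lambda>_. {}"])

text \<open>\<open>L\<close> is covered at a scale far below the separation of the families of
  \<open>K\<close>. A small member close to a member of the same colour is absorbed into it, the
  other small members stay on their own, so no further colour arises.\<close>

lemma fine_cover_Un:
  fixes K L :: "'a::metric_space set"
  assumes K: "fine_cover n K" and L: "fine_cover n L"
  shows "fine_cover n (K \<union> L)"
unfolding fine_cover_def
proof (intro allI impI)
  fix \<epsilon> :: real assume \<epsilon>: "0 < \<epsilon>"
  obtain \<delta>1 F where F: "0 < \<delta>1" "K \<subseteq> (\<Union>j<n. \<Union>(F j))"
    "\<And>j A x y. j < n \<Longrightarrow> A \<in> F j \<Longrightarrow> x \<in> A \<Longrightarrow> y \<in> A \<Longrightarrow> dist x y < \<epsilon>/2"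
    "\<And>j A B x y. j < n \<Longrightarrow> A \<in> F j \<Longrightarrow> B \<in> F j \<Longrightarrow> x \<in> A \<Longrightarrow> y \<in> B \<Longrightarrow> dist x y < \<delta>1 \<Longrightarrow> A = B"
    by (rule fine_coverE[OF K half_gt_zero[OF \<epsilon>]]) (rule that)
  \<comment> \<open>A point of an absorbed union is within \<open>2 * \<eta>\<close> of the original
    member. Diameters grow from \<open>\<epsilon>/2\<close> by at most \<open>4 * \<eta>\<close>,
    hence the 8; unions closer than \<open>\<eta>\<close> come from members closer than
    \<open>5 * \<eta>\<close>, hence the 5.\<close>
  define \<eta> where "\<eta> = min (\<epsilon>/8) (\<delta>1/5)"
  have \<eta>: "0 < \<eta>" "8 * \<eta> \<le> \<epsilon>" "5 * \<eta> \<le> \<delta>1" using \<epsilon> F(1) by (auto simp: \<eta>_def)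
  obtain \<delta>2 G where G: "0 < \<delta>2" "L \<subseteq> (\<Union>j<n. \<Union>(G j))"
    "\<And>j A x y. j < n \<Longrightarrow> A \<in> G j \<Longrightarrow> x \<in> A \<Longrightarrow> y \<in> A \<Longrightarrow> dist x y < \<eta>"
    "\<And>j A B x y. j < n \<Longrightarrow> A \<in> G j \<Longrightarrow> B \<in> G j \<Longrightarrow> x \<in> A \<Longrightarrow> y \<in> B \<Longrightarrow> dist x y < \<delta>2 \<Longrightarrow> A = B"
    by (rule fine_coverE[OF L \<eta>(1)]) (rule that)
  define near where "near A B \<longleftrightarrow> (\<exists>a\<in>A. \<exists>b\<in>B. dist a b < \<eta>)" for A B :: "'a set"
  define fat where "fat j A = A \<union> \<Union>{B \<in> G j. near A B}" for j A
  define H where "H j = fat j ` F j \<union> {B \<in> G j. \<forall>A\<in>F j. \<not> near A B}" for j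
  have fat: "\<exists>a\<in>A. dist x a < 2 * \<eta>" if j: "j < n" and x: "x \<in> fat j A" for j x A
  proof (cases "x \<in> A")
    case True then show ?thesis using \<eta> by (intro bexI[of _ x]) auto
  next
    case False
    then obtain B where B: "B \<in> G j" "near A B" "x \<in> B" using x by (auto simp: fat_def)
    then obtain a b where "a \<in> A" "b \<in> B" "dist a b < \<eta>" by (auto simp: near_def)
    moreover have "dist x b < \<eta>" using G(3) B that \<open>b \<in> B\<close> by blast
    ultimately show ?thesis
      by (intro bexI[of _ a]) (use dist_triangle[of x a b] in \<open>auto simp: dist_commute\<close>)
  qed
  \<comment> \<open>The situation described cannot occur: \<open>B'\<close> is not near
    \<open>A\<close>, so \<open>x\<close> lies in an absorbed set, which the separation of
    \<open>G j\<close> would identify with the unabsorbed \<open>B'\<close>.\<close>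
  have fat2: "B = B'" if *: "j < n" "A \<in> F j" "B' \<in> G j" "\<forall>A\<in>F j. \<not> near A B'" "x \<in> fat j A" "y \<in> B'"
     "dist x y < min \<delta>2 \<eta>" "B = fat j A" for j A B B' x y
  proof -
    have "x \<notin> A" using * by (auto simp: near_def)
    then obtain B1 where B: "B1 \<in> G j" "near A B1" "x \<in> B1" using * by (auto simp: fat_def)
    have "B1 = B'" using G(4)[OF \<open>j<n\<close> B(1) that(3) B(3)] that by auto
    then show ?thesis using B that by blast
  qed
  show "\<exists>\<delta>>0. \<exists>F. separated_families n (K \<union> L) \<epsilon> \<delta> F"
    unfolding separated_families_def
  proof (intro exI[of _ "min \<delta>2 \<eta>"] exI[of _ H] conjI allI impI)
    show "0 < min \<delta>2 \<eta>" using G \<eta> by auto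
    show "K \<union> L \<subseteq> (\<Union>j<n. \<Union>(H j))"
    proof
      fix x assume x: "x \<in> K \<union> L"
      show "x \<in> (\<Union>j<n. \<Union>(H j))"
      proof (cases "x \<in> K")
        case True
        then obtain j A where "j < n" "A \<in> F j" "x \<in> A" using F(2) by blast
        then show ?thesis by (auto simp: H_def fat_def)
      next
        case False
        then obtain j B where jB: "j < n" "B \<in> G j" "x \<in> B" using G(2) x by blast
        then show ?thesis
          by (cases "\<exists>A\<in>F j. near A B") (auto simp: H_def fat_def)
      qed
    qed
  next
    fix j A x y assume *: "j < n" "A \<in> H j" "x \<in> A" "y \<in> A"
    show "dist x y < \<epsilon>"
    proof (cases "A \<in> G j")
      case True then show ?thesis using G(3)[OF *(1) True *(3,4)] \<eta> by auto
    next
      case False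
      then obtain A' where A': "A' \<in> F j" "A = fat j A'" using * by (auto simp: H_def)
      then obtain a b where "a \<in> A'" "dist x a < 2*\<eta>" "b \<in> A'" "dist y b < 2*\<eta>"
        using fat * by metis
      moreover have "dist a b < \<epsilon>/2" using F(3) * A' calculation by blast
      ultimately show ?thesis using \<eta> by metric
    qed
  next
    fix j A B x y assume *: "j < n" "A \<in> H j" "B \<in> H j" "x \<in> A" "y \<in> B" "dist x y < min \<delta>2 \<eta>"
    consider (ff) A' B' where "A' \<in> F j" "A = fat j A'" "B' \<in> F j" "B = fat j B'"
      | (fg) A' where "A' \<in> F j" "A = fat j A'" "B \<in> G j" "\<forall>A\<in>F j. \<not> near A B"
      | (gf) B' where "B' \<in> F j" "B = fat j B'" "A \<in> G j" "\<forall>A'\<in>F j. \<not> near A' A"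
      | (gg) "A \<in> G j" "B \<in> G j"
      using * by (auto simp: H_def)
    then show "A = B"
    proof cases
      case ff
      then obtain a b where "a \<in> A'" "dist x a < 2*\<eta>" "b \<in> B'" "dist y b < 2*\<eta>"
        using fat * by metis
      moreover have "dist a b < \<delta>1" using \<eta> *(6) calculation by metric
      ultimately have "A' = B'" using F(4) * ff by blast
      then show ?thesis using ff by simp
    next
      case fg
      then show ?thesis using fat2[of j A' B x y A] * by auto
    next
      case gf
      then show ?thesis using fat2[of j B' A y x B] * by (auto simp: dist_commute)
    next
      case gg
      then show ?thesis using G(4)[of j A B x y] * by auto
    qed
  qed
qed

lemma fine_cover_UN:
  assumes "finite I" "\<And>i. i \<in> I \<Longrightarrow> fine_cover n (K i)"
  shows "fine_cover n (\<Union>i\<in>I. K i)"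
  using assms by (induction I rule: finite_induct) (simp_all add: fine_cover_empty fine_cover_Un)

text \<open>An eventual bound, rather than one positive distance, lets finitely many pairs of
  compact sets share a threshold.\<close>

lemma eventually_at_right_separated:
  fixes S T :: "'a::metric_space set"
  assumes "compact S" "compact T" "S \<inter> T = {}"
  shows "\<forall>\<^sub>F d in at_right 0. \<forall>x\<in>S. \<forall>y\<in>T. d \<le> dist x y"
proof -
  obtain d where "0 < d" "\<forall>x\<in>S. \<forall>y\<in>T. d \<le> dist x y"
  proof -
    show thesis
    proof (cases "S = {} \<or> T = {}")
      case True
      then show thesis using that[of 1] by auto
    next
      case False
      have "continuous_on (S \<times> T) (\<lambda>(x,y). dist x y)"
        by (auto simp: case_prod_unfold intro!: continuous_intros)
      moreover have "compact (S \<times> T)" "S \<times> T \<noteq> {}" using assms False by (auto intro: compact_Times)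
      ultimately obtain z where z: "z \<in> S \<times> T" "\<And>w. w \<in> S \<times> T \<Longrightarrow> (case z of (x,y) \<Rightarrow> dist x y) \<le> (case w of (x,y) \<Rightarrow> dist x y)"
        using continuous_attains_inf by metis
      show thesis
      proof (rule that[of "case z of (x,y) \<Rightarrow> dist x y"])
        show "0 < (case z of (x, y) \<Rightarrow> dist x y)" using z(1) assms by auto
        show "\<forall>x\<in>S. \<forall>y\<in>T. (case z of (x, y) \<Rightarrow> dist x y) \<le> dist x y"
          using z(2)[of "(_, _)"] by simp
      qed
    qed
  qed
  then show ?thesis
    unfolding eventually_at_right_field by (intro exI[of _ d]) force
qed

text \<open>Outside small neighbourhoods of the separated families that cover the boundaries, the
  cells of the cover have disjoint compact traces, which serve as one further family.\<close>

lemma fine_cover_Suc: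
  fixes K :: "'a::metric_space set"
  assumes K: "compact K"
    and nbhd: "\<And>V x. openin (top_of_set K) V \<Longrightarrow> x \<in> V \<Longrightarrow>
      \<exists>U. x \<in> U \<and> U \<subseteq> V \<and> openin (top_of_set K) U \<and> fine_cover n (top_of_set K frontier_of U)"
  shows "fine_cover (Suc n) K"
unfolding fine_cover_def
proof (intro allI impI)
  fix \<epsilon> :: real assume \<epsilon>: "0 < \<epsilon>"
  have "\<forall>x\<in>K. \<exists>U. x \<in> U \<and> U \<subseteq> K \<inter> ball x (\<epsilon>/3) \<and> openin (top_of_set K) U \<and>
      fine_cover n (top_of_set K frontier_of U)"
    using \<epsilon> by (intro ballI nbhd) (auto simp: openin_open_Int)
  then obtain U where U: "\<And>x. x \<in> K \<Longrightarrow> x \<in> U x \<and> U x \<subseteq> K \<inter> ball x (\<epsilon>/3) \<and>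
      openin (top_of_set K) (U x) \<and> fine_cover n (top_of_set K frontier_of U x)" by metis
  then have "\<forall>x\<in>K. \<exists>O'. open O' \<and> U x = K \<inter> O'" by (meson openin_open)
  then obtain O' where O': "\<And>x. x \<in> K \<Longrightarrow> open (O' x) \<and> U x = K \<inter> O' x" by metis
  obtain C where C: "C \<subseteq> K" "finite C" "K \<subseteq> (\<Union>x\<in>C. O' x)"
  proof (rule compactE_image[OF K, of K O'])
    show "open (O' x)" if "x \<in> K" for x using O'[OF that] by blast
    show "K \<subseteq> (\<Union>x\<in>K. O' x)" using O' U by blast
  qed (rule that)
  \<comment> \<open>Ranks the cells of the subcover, so that a point in several cells is assigned to
    the first of them.\<close>
  obtain idx :: "'a \<Rightarrow> nat" where idx: "inj_on idx C"
    using finite_imp_inj_to_nat_seg[OF C(2)] by blast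
  define B where "B x = top_of_set K frontier_of U x" for x
  have Beq: "B x = closure (U x) - U x" if "x \<in> K" for x
  proof -
    have UK: "U x \<subseteq> K" using U[OF that] by blast
    then have "closure (U x) \<subseteq> K" using closure_minimal[of "U x" K] K compact_imp_closed by auto
    then have "top_of_set K closure_of U x = closure (U x)"
      using UK by (auto simp: closure_of_subtopology Int_absorb1)
    moreover have "top_of_set K interior_of U x = U x" using U[OF that] by (simp add: interior_of_openin)
    ultimately show ?thesis by (simp add: B_def frontier_of_def)
  qed
  have covB: "fine_cover n (\<Union>x\<in>C. B x)" using C U by (intro fine_cover_UN) (auto simp: B_def)
  have "0 < \<epsilon>/3" using \<epsilon> by simp
  obtain \<delta> F where F: "0 < \<delta>" "(\<Union>x\<in>C. B x) \<subseteq> (\<Union>j<n. \<Union>(F j))"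
    "\<And>j A x y. j < n \<Longrightarrow> A \<in> F j \<Longrightarrow> x \<in> A \<Longrightarrow> y \<in> A \<Longrightarrow> dist x y < \<epsilon>/3"
    "\<And>j A B x y. j < n \<Longrightarrow> A \<in> F j \<Longrightarrow> B \<in> F j \<Longrightarrow> x \<in> A \<Longrightarrow> y \<in> B \<Longrightarrow> dist x y < \<delta> \<Longrightarrow> A = B"
    by (rule fine_coverE[OF covB \<open>0 < \<epsilon>/3\<close>]) (rule that)
  \<comment> \<open>Fattening adds at most \<open>2 * \<eta>\<close> to a diameter below
    \<open>\<epsilon>/3\<close>, and fattened members closer than \<open>\<eta>\<close> stem from
    members closer than \<open>3 * \<eta>\<close>.\<close>
  define \<eta> where "\<eta> = min (\<epsilon>/3) (\<delta>/3)"
  have \<eta>: "0 < \<eta>" "3 * \<eta> \<le> \<epsilon>" "3 * \<eta> \<le> \<delta>" using \<epsilon> F(1) by (auto simp: \<eta>_def)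
  define fat where "fat A = (\<Union>a\<in>A. ball a \<eta>)" for A :: "'a set"
  define R where "R = K - (\<Union>j<n. \<Union>A\<in>F j. fat A)"
  have R: "compact R" unfolding R_def fat_def by (intro compact_diff K open_UN ballI) auto
  have RB: "R \<inter> B x = {}" if "x \<in> C" for x
  proof -
    have "a \<in> fat A" if "a \<in> A" for a A using that \<eta>(1) by (auto simp: fat_def intro!: bexI[of _ a])
    then have "(\<Union>j<n. \<Union>(F j)) \<inter> R = {}" unfolding R_def by blast
    moreover have "B x \<subseteq> (\<Union>j<n. \<Union>(F j))" using F(2) that by blast
    ultimately show ?thesis by blast
  qed
  \<comment> \<open>The closure gives compactness. No boundary point of \<open>U x\<close> survives
    in \<open>R\<close>, so the closure adds nothing outside \<open>U x\<close>; the open cells of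
    smaller index are cut away for disjointness.\<close>
  define S where "S x = R \<inter> closure (U x) - (\<Union>y\<in>{y\<in>C. idx y < idx x}. O' y)" for x
  have S: "compact (S x)" if "x \<in> C" for x
    unfolding S_def using C O' by (intro compact_diff compact_Int_closed R) auto
  have SU: "S x \<subseteq> U x" if "x \<in> C" for x
    using RB[OF that] Beq[of x] that C by (auto simp: S_def)
  have Sdisj: "S x \<inter> S y = {}" if "x \<in> C" "y \<in> C" "x \<noteq> y" for x y
  proof -
    have *: "S x \<inter> S y = {}" if "x \<in> C" "y \<in> C" "idx x < idx y" for x y
    proof -
      have "S x \<subseteq> O' x" using SU[of x] O'[of x] that(1) C by blast
      moreover have "S y \<inter> O' x = {}" using that by (auto simp: S_def)
      ultimately show ?thesis by blast
    qed
    have "idx x \<noteq> idx y" using idx that by (auto simp: inj_on_def)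
    then show ?thesis using *[of x y] *[of y x] that by (auto simp: neq_iff)
  qed
  have "\<forall>\<^sub>F d in at_right 0. \<forall>x\<in>C. \<forall>y\<in>C. x \<noteq> y \<longrightarrow> (\<forall>p\<in>S x. \<forall>q\<in>S y. d \<le> dist p q)"
    using C(2) S Sdisj
    by (intro eventually_ball_finite ballI) (auto simp: eventually_conj_iff intro!: eventually_at_right_separated)
  then obtain b where "b > 0" and b: "\<And>d. 0 < d \<Longrightarrow> d < b \<Longrightarrow> \<forall>x\<in>C. \<forall>y\<in>C. x \<noteq> y \<longrightarrow> (\<forall>p\<in>S x. \<forall>q\<in>S y. d \<le> dist p q)"
    unfolding eventually_at_right_field by auto
  define d where "d = b/2"
  have d: "0 < d" "\<And>x y p q. x \<in> C \<Longrightarrow> y \<in> C \<Longrightarrow> x \<noteq> y \<Longrightarrow> p \<in> S x \<Longrightarrow> q \<in> S y \<Longrightarrow> d \<le> dist p q"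
    using \<open>b > 0\<close> b[of d] by (auto simp: d_def)
  define H where "H j = (if j < n then fat ` F j else S ` C)" for j
  show "\<exists>\<delta>>0. \<exists>F. separated_families (Suc n) K \<epsilon> \<delta> F"
    unfolding separated_families_def
  proof (intro exI[of _ "min d \<eta>"] exI[of _ H] conjI allI impI)
    show "0 < min d \<eta>" using d \<eta> by auto
    show "K \<subseteq> (\<Union>j<Suc n. \<Union>(H j))"
    proof
      fix x assume x: "x \<in> K"
      show "x \<in> (\<Union>j<Suc n. \<Union>(H j))"
      proof (cases "x \<in> R")
        case False
        then obtain j A where "j < n" "A \<in> F j" "x \<in> fat A" using x by (auto simp: R_def)
        then show ?thesis by (intro UN_I[of j]) (auto simp: H_def)
      next
        case True
        have "\<exists>y. y \<in> C \<and> x \<in> O' y" using C x by blast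
        then obtain y where y: "y \<in> C" "x \<in> O' y" "\<And>z. z \<in> C \<and> x \<in> O' z \<Longrightarrow> idx y \<le> idx z"
          using ex_has_least_nat[of "\<lambda>y. y \<in> C \<and> x \<in> O' y" _ idx] by blast
        have "x \<in> closure (U y)" using y O'[of y] C x closure_subset by blast
        then have "x \<in> S y" using True y(3) by (force simp: S_def)
        then show ?thesis using y(1) by (intro UN_I[of n]) (auto simp: H_def)
      qed
    qed
  next
    fix j A x y assume *: "j < Suc n" "A \<in> H j" "x \<in> A" "y \<in> A"
    show "dist x y < \<epsilon>"
    proof (cases "j < n")
      case True
      then obtain A' where A': "A' \<in> F j" "A = fat A'" using * by (auto simp: H_def)
      then obtain a b where "a \<in> A'" "dist a x < \<eta>" "b \<in> A'" "dist b y < \<eta>"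
        using * by (auto simp: fat_def)
      moreover from this have "dist a b < \<epsilon>/3" using F(3) A' True by blast
      ultimately show ?thesis
        using \<eta> dist_triangle3[of x y a] dist_triangle[of a y b] by linarith
    next
      case False
      then obtain c where c: "c \<in> C" "A = S c" using * by (auto simp: H_def)
      then have "A \<subseteq> ball c (\<epsilon>/3)" using SU[of c] U[of c] C by blast
      then have "dist c x < \<epsilon>/3" "dist c y < \<epsilon>/3" using * by auto
      then show ?thesis using \<epsilon> dist_triangle3[of x y c] by linarith
    qed
  next
    fix j A B x y assume *: "j < Suc n" "A \<in> H j" "B \<in> H j" "x \<in> A" "y \<in> B" "dist x y < min d \<eta>"
    show "A = B"
    proof (cases "j < n")
      case True
      then obtain A' B' where A': "A' \<in> F j" "A = fat A'" "B' \<in> F j" "B = fat B'" using * by (auto simp: H_def)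
      then obtain a b where "a \<in> A'" "dist a x < \<eta>" "b \<in> B'" "dist b y < \<eta>"
        using * by (auto simp: fat_def)
      moreover from this have "dist a b < \<delta>"
        using \<eta> *(6) dist_triangle[of a b x] dist_triangle2[of x b y] by (simp add: dist_commute)
      ultimately show ?thesis using F(4) A' True by blast
    next
      case False
      then obtain a b where "a \<in> C" "A = S a" "b \<in> C" "B = S b" using * by (auto simp: H_def)
      then show ?thesis using d(2)[of a b x y] * by force
    qed
  qed
qed

text \<open>Dimension below \<open>n\<close> corresponds to \<open>n\<close> families, so the empty
  space of dimension -1 starts the induction. Frontiers are closed in a compact set, hence compact,
  and the induction hypothesis applies to them.\<close>

lemma fine_cover_if_dim_le:
  fixes K :: "'a::metric_space set"
  assumes "compact K" "top_of_set K dim_le int n - 1"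
  shows "fine_cover n K"
  using assms
proof (induction n arbitrary: K)
  case 0
  then have "K = {}" by (simp flip: null_topspace_iff_trivial)
  then show ?case by (simp add: fine_cover_empty)
next
  case (Suc n)
  show ?case
  proof (rule fine_cover_Suc[OF Suc.prems(1)])
    fix V x assume V: "openin (top_of_set K) V" "x \<in> V"
    from Suc.prems(2) have "\<exists>U. x \<in> U \<and> U \<subseteq> V \<and> openin (top_of_set K) U \<and>
       subtopology (top_of_set K) (top_of_set K frontier_of U) dim_le int n - 1"
      using V by cases auto
    then obtain U where U: "x \<in> U" "U \<subseteq> V" "openin (top_of_set K) U"
       "subtopology (top_of_set K) (top_of_set K frontier_of U) dim_le int n - 1" by blast
    have cl: "closedin (top_of_set K) (top_of_set K frontier_of U)" by (rule closedin_frontier_of)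
    then have "top_of_set K frontier_of U \<subseteq> K" "compact (top_of_set K frontier_of U)"
      using Suc.prems(1) closedin_compact closedin_imp_subset by blast+
    then have "fine_cover n (top_of_set K frontier_of U)"
      using U(4) by (intro Suc.IH) (auto simp: subtopology_subtopology Int_absorb1)
    then show "\<exists>U. x \<in> U \<and> U \<subseteq> V \<and> openin (top_of_set K) U \<and> fine_cover n (top_of_set K frontier_of U)"
      using U by blast
  qed
qed

section \<open>The unit cube and Kuhn's lemma\<close>

definition cube :: "nat \<Rightarrow> (nat \<Rightarrow> real) set" where
  "cube n = {x. \<forall>i. if i < n then 0 \<le> x i \<and> x i \<le> 1 else x i = 0}"

lemma compact_cube: "compact (cube n)"
proof -
  have eq: "cube n = (\<Pi>\<^sub>E i\<in>UNIV. if i < n then {0..1} else {0})"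
    by (auto simp: cube_def PiE_UNIV_domain Pi_iff split: if_splits)
  have "compactin (product_topology (\<lambda>_. euclidean) UNIV) (cube n)"
    unfolding eq compactin_PiE by auto
  then show ?thesis by (simp add: euclidean_product_topology)
qed

text \<open>The metric on functions is a weighted series: its tail beyond \<open>N\<close> is below
  \<open>\<delta>/2\<close>, and the first terms contribute at most twice their maximum, hence the
  \<open>\<delta>/4\<close>.\<close>

lemma dist_fun_small:
  assumes "0 < \<delta>"
  shows "\<exists>d>0. \<forall>x y :: nat \<Rightarrow> 'a::metric_space. (\<forall>i. dist (x i) (y i) \<le> d) \<longrightarrow> dist x y < \<delta>"
proof -
  obtain N where N: "(1/2)^N < \<delta>/2" using assms real_arch_pow_inv[of "\<delta>/2" "1/2"] by auto
  show ?thesis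
  proof (intro exI[of _ "\<delta>/4"] conjI allI impI)
    show "0 < \<delta>/4" using assms by simp
    fix x y :: "nat \<Rightarrow> 'a" assume d: "\<forall>i. dist (x i) (y i) \<le> \<delta>/4"
    have "Max {dist (x (from_nat n)) (y (from_nat n)) |n. n \<le> N} \<le> \<delta>/4"
      using d by (subst Max_le_iff) auto
    then show "dist x y < \<delta>" using dist_fun_le_dist_first_terms[of x y N] N by linarith
  qed
qed

text \<open>A lattice point gets label \<open>0\<close> in direction \<open>i\<close> iff it is near a member of the \<open>i\<close>th family that
  comes close to the face \<open>x\<^sub>i = 0\<close>. The member containing the base point of a Kuhn cell
  determines the label of the whole cell, which contradicts the lemma.\<close>

lemma not_fine_cover_cube: "\<not> fine_cover n (cube n)"
proof
  assume cov: "fine_cover n (cube n)"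
  have "\<forall>\<^sub>F e in at_right 0. \<forall>i\<in>{..<n}. \<forall>x\<in>cube n. \<forall>y\<in>cube n. dist x y < e \<longrightarrow> \<bar>x i - y i\<bar> < 1/2"
  proof (rule eventually_ball_finite)
    show "\<forall>i\<in>{..<n}. \<forall>\<^sub>F e in at_right 0. \<forall>x\<in>cube n. \<forall>y\<in>cube n. dist x y < e \<longrightarrow> \<bar>x i - y i\<bar> < 1/2"
    proof
      fix i
      have "uniformly_continuous_on (cube n) (\<lambda>x. x i)"
        by (intro compact_uniformly_continuous compact_cube continuous_on_product_coordinates[THEN continuous_on_subset]) auto
      then obtain e where e: "e > 0" "\<forall>x\<in>cube n. \<forall>y\<in>cube n. dist y x < e \<longrightarrow> dist (y i) (x i) < 1/2"
        unfolding uniformly_continuous_on_def by (metis half_gt_zero zero_less_one)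
      show "\<forall>\<^sub>F e in at_right 0. \<forall>x\<in>cube n. \<forall>y\<in>cube n. dist x y < e \<longrightarrow> \<bar>x i - y i\<bar> < 1/2"
        unfolding eventually_at_right_field using e by (intro exI[of _ e]) (force simp: dist_real_def)
    qed
  qed auto
  then obtain b where "b > 0" and b: "\<And>e. 0 < e \<Longrightarrow> e < b \<Longrightarrow> \<forall>i\<in>{..<n}. \<forall>x\<in>cube n. \<forall>y\<in>cube n. dist x y < e \<longrightarrow> \<bar>x i - y i\<bar> < 1/2"
    unfolding eventually_at_right_field by auto
  define \<epsilon> where "\<epsilon> = b/2"
  have \<epsilon>: "0 < \<epsilon>" "\<And>i x y. i < n \<Longrightarrow> x \<in> cube n \<Longrightarrow> y \<in> cube n \<Longrightarrow> dist x y < \<epsilon> \<Longrightarrow> \<bar>x i - y i\<bar> < 1/2"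
    using \<open>b > 0\<close> b[of \<epsilon>] by (auto simp: \<epsilon>_def)
  obtain \<delta> F where F: "0 < \<delta>" "cube n \<subseteq> (\<Union>j<n. \<Union>(F j))"
    "\<And>j A x y. j < n \<Longrightarrow> A \<in> F j \<Longrightarrow> x \<in> A \<Longrightarrow> y \<in> A \<Longrightarrow> dist x y < \<epsilon>"
    "\<And>j A B x y. j < n \<Longrightarrow> A \<in> F j \<Longrightarrow> B \<in> F j \<Longrightarrow> x \<in> A \<Longrightarrow> y \<in> B \<Longrightarrow> dist x y < \<delta> \<Longrightarrow> A = B"
    by (rule fine_coverE[OF cov \<epsilon>(1)]) (rule that)
  obtain d where d: "d > 0" "\<And>x y :: nat \<Rightarrow> real. (\<forall>i. dist (x i) (y i) \<le> d) \<Longrightarrow> dist x y < \<delta>/2"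
    using dist_fun_small[of "\<delta>/2"] F(1) by (metis half_gt_zero)
  obtain p :: nat where p: "1 / d < p" "4 < p"
    using reals_Archimedean2[of "max (1/d) 4"] by auto
  have p': "1 / p < d" "1 / p < 1/4" "0 < p" using p d by (auto simp: field_simps)
  define pt where "pt x = (\<lambda>i. if i < n then real (x i) / real p else 0)" for x :: "nat \<Rightarrow> nat"
  have pt: "pt x \<in> cube n" if "\<forall>i<n. x i \<le> p" for x
    using that p' by (auto simp: pt_def cube_def)
  \<comment> \<open>The margins for 1/4 add up: in direction \<open>i\<close> a member is narrower
    than 1/2 and a lattice step shorter than 1/4, so a cell whose base point lies in a low member
    stays off the face where coordinate \<open>i\<close> is 1.\<close>
  define low where "low i A \<longleftrightarrow> (\<exists>a\<in>A \<inter> cube n. a i \<le> 1/4)" for i :: nat and A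
  \<comment> \<open>The clauses for 0 and \<open>p\<close> force the labels that Kuhn's lemma
    prescribes on opposite faces.\<close>
  define label :: "(nat \<Rightarrow> nat) \<Rightarrow> nat \<Rightarrow> nat" where
    "label x i = (if x i = 0 \<or> x i \<noteq> p \<and> (\<exists>A\<in>F i. low i A \<and> (\<exists>a\<in>A. dist (pt x) a < \<delta>/2)) then 0 else 1)" for x i
  obtain q where q: "\<forall>i<n. q i < p"
    "\<forall>i<n. \<exists>r s. (\<forall>j<n. q j \<le> r j \<and> r j \<le> q j + 1) \<and> (\<forall>j<n. q j \<le> s j \<and> s j \<le> q j + 1) \<and> label r i \<noteq> label s i"
    by (rule kuhn_lemma[of p n label]) (use p' in \<open>auto simp: label_def\<close>)
  have qc: "pt q \<in> cube n" using q(1) by (intro pt) auto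
  \<comment> \<open>The colour \<open>i\<close> of a member containing the base point selects the
    direction in which the labels turn out constant.\<close>
  then obtain i A where A: "i < n" "A \<in> F i" "pt q \<in> A" using F(2) by blast
  have near: "dist (pt q) (pt r) < \<delta>/2" "\<bar>pt q i - pt r i\<bar> < 1/4" if "\<forall>j<n. q j \<le> r j \<and> r j \<le> q j + 1" for r
  proof -
    have *: "dist (pt q j) (pt r j) \<le> 1/p" for j
    proof (cases "j < n")
      case True
      then have "r j = q j \<or> r j = q j + 1" using that by force
      then show ?thesis using p' True by (auto simp: pt_def dist_real_def field_simps)
    qed (auto simp: pt_def)
    show "dist (pt q) (pt r) < \<delta>/2" using * p'(1) by (intro d(2) allI) (meson less_imp_le order_trans)
    show "\<bar>pt q i - pt r i\<bar> < 1/4" using *[of i] p'(2) unfolding dist_real_def by linarith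
  qed
  have lab: "label r i = (if low i A then 0 else 1)" if r: "\<forall>j<n. q j \<le> r j \<and> r j \<le> q j + 1" for r
  proof (cases "low i A")
    case True
    then obtain a where a: "a \<in> A" "a \<in> cube n" "a i \<le> 1/4" by (auto simp: low_def)
    then have "\<bar>pt q i - a i\<bar> < 1/2" using \<epsilon>(2)[OF A(1) qc] F(3) A by blast
    then have "pt r i < 1" using a near(2)[OF r] by linarith
    then have "r i \<noteq> p" using p' A by (auto simp: pt_def)
    moreover have "dist (pt r) (pt q) < \<delta>/2" using near(1)[OF r] by (simp add: dist_commute)
    ultimately show ?thesis using True A by (auto simp: label_def)
  next
    case False
    then have "pt q i > 1/4" using A qc by (force simp: low_def)
    then have "pt r i > 0" using near(2)[OF r] by linarith
    then have "r i \<noteq> 0" using A(1) by (cases "r i = 0") (simp_all add: pt_def)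
    moreover have False if "B \<in> F i" "low i B" "a \<in> B" "dist (pt r) a < \<delta>/2" for B a
    proof -
      have "dist (pt q) a < \<delta>" using near(1)[OF r] that(4) by metric
      then have "A = B" using F(4)[OF A(1,2) that(1) A(3) that(3)] by simp
      then show False using that False by simp
    qed
    ultimately show ?thesis using False by (auto simp: label_def)
  qed
  then show False using q(2) A(1) by metis
qed

corollary not_dim_le_cube: "\<not> top_of_set (cube n) dim_le int n - 1"
  using fine_cover_if_dim_le compact_cube not_fine_cover_cube by blast

section \<open>Inductive dimension of subsets of a torus\<close>

text \<open>After rotating \<open>a\<close> to 1, the law of cosines determines the real part from
  the distance, and the imaginary part is then fixed up to sign.\<close>

lemma finite_circle_Int_circle:
  fixes a :: complex
  assumes "norm a = 1"
  shows "finite {w. norm w = 1 \<and> dist w a = r}"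
proof -
  define c where "c = 1 - r^2 / 2"
  define s where "s = sqrt (1 - c^2)"
  have "w \<in> {a * Complex c s, a * Complex c (-s)}" if w: "norm w = 1" "dist w a = r" for w
  proof -
    define u where "u = w * cnj a"
    have aa: "a * cnj a = 1" using assms by (simp add: complex_norm_square [symmetric])
    have "w = a * u" unfolding u_def using aa by (metis mult.left_commute mult.right_neutral mult.commute)
    have "norm u = 1" using w assms by (simp add: u_def norm_mult)
    then have 1: "(Re u)^2 + (Im u)^2 = 1" by (simp add: cmod_def)
    have "u - 1 = (w - a) * cnj a" using aa by (simp add: u_def algebra_simps)
    then have "norm (u - 1) = r" using w assms by (simp add: norm_mult dist_norm)
    then have "(norm (u - 1))^2 = r^2" by simp
    then have "(Re u - 1)^2 + (Im u)^2 = r^2" by (simp add: cmod_power2)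
    with 1 have "Re u = c" unfolding c_def by (simp add: power2_eq_square algebra_simps)
    with 1 have "(Im u)^2 = 1 - c^2" by simp
    then have "Im u = s \<or> Im u = -s" unfolding s_def by (metis real_sqrt_abs abs_if minus_minus)
    then have "u = Complex c s \<or> u = Complex c (-s)" using \<open>Re u = c\<close> by (metis complex.collapse)
    then show ?thesis using \<open>w = a * u\<close> by auto
  qed
  then have "{w. norm w = 1 \<and> dist w a = r} \<subseteq> {a * Complex c s, a * Complex c (-s)}" by blast
  then show ?thesis by (rule finite_subset) simp
qed

text \<open>A basic open set restricts each coordinate separately; as only the coordinates in the
  finite \<open>I\<close> move, the least of their radii serves.\<close>

lemma open_fun_uniform_nbhd:
  fixes V :: "(nat \<Rightarrow> 'a::metric_space) set"
  assumes "open V" "a \<in> V" "finite I"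
  shows "\<exists>e>0. \<forall>y. (\<forall>i\<in>I. dist (y i) (a i) < e) \<longrightarrow> (\<forall>i. i \<notin> I \<longrightarrow> y i = a i) \<longrightarrow> y \<in> V"
proof -
  have "openin (product_topology (\<lambda>_. euclidean) UNIV) V" using assms by (simp add: euclidean_product_topology)
  from product_topology_open_contains_basis[OF this assms(2)] obtain X where
    X: "a \<in> (\<Pi>\<^sub>E i\<in>UNIV. X i)" "\<And>i. open (X i)" "(\<Pi>\<^sub>E i\<in>UNIV. X i) \<subseteq> V" by auto
  have "\<forall>i. \<exists>e>0. \<forall>y. dist y (a i) < e \<longrightarrow> y \<in> X i" using X by (auto simp: open_dist PiE_iff)
  then obtain e where e: "\<And>i. e i > 0" "\<And>i y. dist y (a i) < e i \<Longrightarrow> y \<in> X i" by metis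
  show ?thesis
  proof (intro exI[of _ "Min (insert 1 (e ` I))"] conjI allI impI)
    show "0 < Min (insert 1 (e ` I))" using assms e by (subst Min_gr_iff) auto
    fix y assume y: "\<forall>i\<in>I. dist (y i) (a i) < Min (insert 1 (e ` I))" "\<forall>i. i \<notin> I \<longrightarrow> y i = a i"
    have "y i \<in> X i" for i
      using y assms e(2)[of "y i" i] X(1) by (cases "i \<in> I") (auto simp: PiE_iff)
    then show "y \<in> V" using X(3) by (auto simp: PiE_iff)
  qed
qed

text \<open>Equivalently, fewer than \<open>k\<close> coordinates lie outside \<open>F\<close>. The
  strict inequality makes the set empty for \<open>k = 0\<close>, the base case of dimension
  -1.\<close>

definition torus_points :: "nat set \<Rightarrow> complex set \<Rightarrow> nat \<Rightarrow> (nat \<Rightarrow> complex) set" where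
  "torus_points I F k = {x. (\<forall>i. if i \<in> I then norm (x i) = 1 else x i = 0) \<and>
     card I < k + card {i \<in> I. x i \<in> F}}"

text \<open>If the radius of a box avoids its distances to \<^term>\<open>F\<close>, then a point on the
  boundary of the box has one more coordinate in an enlarged finite set.\<close>

lemma torus_points_dim_le:
  assumes "finite I" "finite F"
  shows "top_of_set (torus_points I F k) dim_le int k - 1"
  using assms(2)
proof (induction k arbitrary: F)
  case 0
  have "card {i \<in> I. x i \<in> F} \<le> card I" for x :: "nat \<Rightarrow> complex"
    using assms(1) by (intro card_mono) auto
  then have "torus_points I F 0 = {}" by (simp add: torus_points_def linorder_not_less)
  then show ?case by simp
next
  case (Suc k)
  let ?Z = "torus_points I F (Suc k)"
  show ?case
  proof (rule dimension_le.intros)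
    fix V a assume V: "openin (top_of_set ?Z) V" "a \<in> V"
    then obtain O' where O': "open O'" "V = ?Z \<inter> O'" by (auto simp: openin_open)
    then have a: "a \<in> ?Z" "a \<in> O'" using V by auto
    obtain e where e: "e > 0" "\<And>y. (\<forall>i\<in>I. dist (y i) (a i) < e) \<Longrightarrow> (\<forall>i. i \<notin> I \<longrightarrow> y i = a i) \<Longrightarrow> y \<in> O'"
      using open_fun_uniform_nbhd[OF O'(1) a(2) assms(1)] by auto
    have "infinite {0<..<e}" using e by (simp add: infinite_Ioo)
    moreover have "finite ((\<lambda>(w,i). dist w (a i)) ` (F \<times> I))" using Suc.prems assms by auto
    ultimately have "\<exists>r. r \<in> {0<..<e} - (\<lambda>(w,i). dist w (a i)) ` (F \<times> I)"
      by (metis Diff_infinite_finite finite.emptyI ex_in_conv)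
    then obtain r where r: "0 < r" "r < e" "\<And>w i. w \<in> F \<Longrightarrow> i \<in> I \<Longrightarrow> dist w (a i) \<noteq> r" by force
    define B where "B = {y. \<forall>i\<in>I. dist (y i) (a i) < r}"
    have "B = (\<Inter>i\<in>I. {y. dist (y i) (a i) < r})" by (auto simp: B_def)
    then have B: "open B"
      using assms by (auto intro!: open_INT open_Collect_less continuous_intros)
    define C where "C = {y. \<forall>i\<in>I. dist (y i) (a i) \<le> r}"
    have "C = (\<Inter>i\<in>I. {y. dist (y i) (a i) \<le> r})" by (auto simp: C_def)
    then have C: "closed C"
      by (auto intro!: closed_INT closed_Collect_le continuous_intros)
    define F' where "F' = F \<union> (\<Union>i\<in>I. {w. norm w = 1 \<and> dist w (a i) = r})"
    have F': "finite F'"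
      unfolding F'_def using assms Suc.prems a
      by (auto simp: torus_points_def intro!: finite_circle_Int_circle)
    have opn: "openin (top_of_set ?Z) (?Z \<inter> B)" using B by (simp add: openin_open_Int)
    have "top_of_set ?Z closure_of (?Z \<inter> B) \<subseteq> ?Z \<inter> C"
      using C by (intro closure_of_minimal) (auto simp: closedin_closed_Int B_def C_def)
    then have "top_of_set ?Z frontier_of (?Z \<inter> B) \<subseteq> ?Z \<inter> C - B"
      using opn by (auto simp: frontier_of_def interior_of_openin)
    also have "\<dots> \<subseteq> torus_points I F' k"
    proof
      fix y assume y: "y \<in> ?Z \<inter> C - B"
      then obtain i where i: "i \<in> I" "dist (y i) (a i) = r" by (force simp: B_def C_def)
      have *: "\<And>i. if i \<in> I then norm (y i) = 1 else y i = 0" using y by (auto simp: torus_points_def)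
      have "y i \<notin> F" using r i by auto
      moreover have "y i \<in> F'" using * i by (auto simp: F'_def)
      ultimately have "{i \<in> I. y i \<in> F} \<subset> {i \<in> I. y i \<in> F'}" using i by (auto simp: F'_def)
      then have "card {i \<in> I. y i \<in> F} < card {i \<in> I. y i \<in> F'}"
        using assms(1) by (intro psubset_card_mono) auto
      then show "y \<in> torus_points I F' k" using * y by (auto simp: torus_points_def)
    qed
    finally have fr: "top_of_set ?Z frontier_of (?Z \<inter> B) \<subseteq> torus_points I F' k" .
    have "top_of_set (top_of_set ?Z frontier_of (?Z \<inter> B)) dim_le int k - 1"
      by (rule dimension_le_subtopologies[OF Suc.IH[OF F'] fr])
    moreover have "top_of_set ?Z frontier_of (?Z \<inter> B) \<subseteq> ?Z"
      by (meson closedin_frontier_of closedin_imp_subset)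
    ultimately have "subtopology (top_of_set ?Z) (top_of_set ?Z frontier_of (?Z \<inter> B)) dim_le int k - 1"
      by (simp add: subtopology_subtopology Int_absorb1)
    moreover have "a \<in> ?Z \<inter> B" using a r by (auto simp: B_def)
    moreover have "?Z \<inter> B \<subseteq> V"
    proof
      fix y assume "y \<in> ?Z \<inter> B"
      then show "y \<in> V" using O' a r e(2)[of y] by (auto simp: B_def torus_points_def) (metis less_trans)
    qed
    ultimately show "\<exists>U. a \<in> U \<and> U \<subseteq> V \<and> openin (top_of_set ?Z) U \<and>
        subtopology (top_of_set ?Z) (top_of_set ?Z frontier_of U) dim_le int (Suc k) - 1 - 1"
      using opn by auto
  qed auto
qed

section \<open>Lattice paths\<close>

text \<open>\<open>adversary \<sigma> d i k\<close> is the least number of chips that remain after \<open>i\<close> loops when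
  \<open>d\<close> chips travel to the right, loop \<open>i\<close> acts by \<open>\<sigma> i\<close>, and an adversary has removed \<open>k\<close> chips.\<close>

fun adversary :: "(nat \<Rightarrow> int \<Rightarrow> int) \<Rightarrow> int \<Rightarrow> nat \<Rightarrow> nat \<Rightarrow> int" where
  "adversary \<sigma> d 0 k = d - int k"
| "adversary \<sigma> d (Suc i) 0 = \<sigma> (Suc i) (adversary \<sigma> d i 0)"
| "adversary \<sigma> d (Suc i) (Suc k) =
     min (\<sigma> (Suc i) (adversary \<sigma> d i (Suc k))) (adversary \<sigma> d (Suc i) k - 1)"

lemma adversary_Suc_right: "adversary \<sigma> d i (Suc k) \<le> adversary \<sigma> d i k - 1"
  by (cases i) auto

lemma adversary_strict_antimono:
  assumes "k < l" shows "adversary \<sigma> d i l \<le> adversary \<sigma> d i k - (int l - int k)"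
  using assms
proof (induction l)
  case (Suc l)
  then show ?case using adversary_Suc_right[of \<sigma> d i l] by (cases "k = l") auto
qed simp

lemma adversary_Suc_left_le: "adversary \<sigma> d (Suc i) k \<le> \<sigma> (Suc i) (adversary \<sigma> d i k)"
  by (cases k) auto

lemma adversary_Suc_left_ge:
  assumes "\<And>t. t - 1 \<le> \<sigma> (Suc i) t"
  shows "adversary \<sigma> d i k - 1 \<le> adversary \<sigma> d (Suc i) k"
proof (induction k)
  case (Suc k)
  have "adversary \<sigma> d i (Suc k) - 1 \<le> adversary \<sigma> d (Suc i) k - 1"
    using Suc adversary_Suc_right[of \<sigma> d i k] by linarith
  then show ?case using assms by simp
qed (use assms in simp)

text \<open>For each \<open>k \<le> r\<close> the path with \<open>k\<close> removals starts at
  \<open>d - k\<close>, loses at most one chip per loop and ends with at least \<open>r - k\<close>,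
  so it stays constant at \<open>n\<close> loops or more. At one loop the paths for different
  \<open>k\<close> have different values between 0 and \<open>d\<close>, so \<open>uniq\<close>
  makes these sets of loops disjoint.\<close>

lemma card_lingering_ge:
  fixes g r n :: nat and d :: int
  assumes \<sigma>: "\<And>i t. \<sigma> i t = t \<or> \<sigma> i t = t - 1"
    and uniq: "\<And>i s t. i \<in> {1..g} \<Longrightarrow> \<sigma> i s = s \<Longrightarrow> \<sigma> i t = t \<Longrightarrow> 0 \<le> s \<Longrightarrow> s < t \<Longrightarrow> t \<le> d \<Longrightarrow> False"
    and pos: "0 \<le> adversary \<sigma> d g r"
    and n: "int n \<le> int g - d + int r"
  shows "(r + 1) * n \<le> card {i \<in> {1..g}. \<exists>t. 0 \<le> t \<and> t \<le> d \<and> \<sigma> i t = t}"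
proof -
  let ?p = "adversary \<sigma> d"
  have step: "?p (Suc i) k = ?p i k \<or> ?p (Suc i) k = ?p i k - 1" for i k
  proof -
    have "?p (Suc i) k \<le> ?p i k" using adversary_Suc_left_le[of \<sigma> d i k] \<sigma>[of "Suc i" "?p i k"] by linarith
    moreover have "?p i k - 1 \<le> ?p (Suc i) k"
      by (rule adversary_Suc_left_ge) (metis \<sigma> diff_le_eq le_add_same_cancel1 order_refl zero_le_one)
    ultimately show ?thesis by linarith
  qed
  have mono: "?p j k \<le> ?p i k" if "i \<le> j" for i j k
    using that
  proof (induction j)
    case (Suc j)
    then show ?case using step[of j k] by (cases "i = Suc j") auto
  qed simp
  define L where "L k = {i. i < g \<and> ?p (Suc i) k = ?p i k}" for k
  have L: "int (card {i. i < j \<and> ?p (Suc i) k = ?p i k}) = ?p j k - d + int k + int j" for j k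
  proof (induction j)
    case (Suc j)
    have "{i. i < Suc j \<and> ?p (Suc i) k = ?p i k} =
        {i. i < j \<and> ?p (Suc i) k = ?p i k} \<union> (if ?p (Suc j) k = ?p j k then {j} else {})"
      by (auto simp: less_Suc_eq)
    moreover have "finite {i. i < j \<and> ?p (Suc i) k = ?p i k}" by simp
    ultimately have "card {i. i < Suc j \<and> ?p (Suc i) k = ?p i k} =
        card {i. i < j \<and> ?p (Suc i) k = ?p i k} + (if ?p (Suc j) k = ?p j k then 1 else 0)"
      by (auto simp del: adversary.simps)
    then show ?case using Suc step[of j k] by (auto simp del: adversary.simps)
  qed simp
  have cardL: "n \<le> card (L k)" if "k \<le> r" for k
  proof -
    have "0 \<le> ?p g k - (int r - int k)"
      using adversary_strict_antimono[of k r \<sigma> d g] pos that by (cases "k = r") auto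
    then have "int n \<le> int (card (L k))" unfolding L_def L using n by linarith
    then show ?thesis by simp
  qed
  have range: "0 \<le> ?p i k \<and> ?p i k \<le> d" if "i \<le> g" "k \<le> r" for i k
  proof -
    have "?p i r \<le> ?p i k" using adversary_strict_antimono[of k r \<sigma> d i] that by (cases "k = r") auto
    then show ?thesis using mono[of i g r] mono[of 0 i k] pos that by simp
  qed
  \<comment> \<open>The adversary's value is at most what the loop yields, and a loop never adds
    chips; if the value does not drop, the loop itself has fixed it.\<close>
  have fix_: "\<sigma> (Suc i) (?p i k) = ?p i k" if "i \<in> L k" for i k
    using that adversary_Suc_left_le[of \<sigma> d i k] \<sigma>[of "Suc i" "?p i k"] by (auto simp: L_def)
  have disj: "L k \<inter> L l = {}" if "k < l" "l \<le> r" for k l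
  proof (rule ccontr)
    assume "L k \<inter> L l \<noteq> {}"
    then obtain i where i: "i \<in> L k" "i \<in> L l" by auto
    then have "i < g" by (simp add: L_def)
    show False
      by (rule uniq[of "Suc i" "?p i l" "?p i k"])
        (use i \<open>i < g\<close> fix_ range[of i k] range[of i l] that adversary_strict_antimono[of k l \<sigma> d i] in auto)
  qed
  have "(r + 1) * n = (\<Sum>k\<le>r. n)" by simp
  also have "\<dots> \<le> (\<Sum>k\<le>r. card (L k))" using cardL by (intro sum_mono) auto
  also have "\<dots> = card (\<Union>k\<le>r. L k)"
  proof (rule card_UN_disjoint [symmetric])
    show "\<forall>k\<in>{..r}. finite (L k)" by (simp add: L_def)
    show "\<forall>k\<in>{..r}. \<forall>l\<in>{..r}. k \<noteq> l \<longrightarrow> L k \<inter> L l = {}"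
      using disj by (metis Int_commute atMost_iff linorder_neqE_nat)
  qed simp
  also have "\<dots> \<le> card {i \<in> {1..g}. \<exists>t. 0 \<le> t \<and> t \<le> d \<and> \<sigma> i t = t}"
  proof (rule card_inj_on_le[of Suc])
    show "Suc ` (\<Union>k\<le>r. L k) \<subseteq> {i \<in> {1..g}. \<exists>t. 0 \<le> t \<and> t \<le> d \<and> \<sigma> i t = t}"
    proof safe
      fix i k assume "i \<in> L k" "k \<le> r"
      then show "\<exists>t. 0 \<le> t \<and> t \<le> d \<and> \<sigma> (Suc i) t = t"
        using fix_[of i k] range[of i k] by (intro exI[of _ "?p i k"]) (auto simp: L_def)
    qed (auto simp: L_def)
  qed auto
  finally show ?thesis .
qed

text \<open>The lingering lattice path that fills a rectangular tableau column by column.\<close>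

definition tableau_path :: "nat \<Rightarrow> nat \<Rightarrow> int \<Rightarrow> nat \<Rightarrow> nat \<Rightarrow> int" where
  "tableau_path r n d i k =
     d - int k - int i + int (min n (i div (r + 1) + (if k < i mod (r + 1) then 1 else 0)))"

lemma tableau_path_0: "tableau_path r n d 0 k = d - int k"
  by (simp add: tableau_path_def)

lemma tableau_path_antimono:
  "k \<le> l \<Longrightarrow> tableau_path r n d i l \<le> tableau_path r n d i k - (int l - int k)"
  by (auto simp: tableau_path_def)

text \<open>Step \<open>i\<close> belongs to the box in row \<open>i mod (r + 1)\<close> and column
  \<open>i div (r + 1)\<close>; within the first \<open>n\<close> columns only the path of that row
  is spared the loss.\<close>

lemma tableau_path_Suc:
  assumes "k \<le> r"
  shows "tableau_path r n d (Suc i) k =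
    (if i < (r + 1) * n \<and> k = i mod (r + 1) then tableau_path r n d i k else tableau_path r n d i k - 1)"
proof -
  define q m where "q = i div (r + 1)" and "m = i mod (r + 1)"
  have i: "i = q * (r + 1) + m" "m < r + 1"
    unfolding q_def m_def by (rule div_mult_mod_eq [symmetric]) simp
  have lt: "i < (r + 1) * n \<longleftrightarrow> q < n"
    unfolding q_def by (metis div_less_iff_less_mult mult.commute zero_less_Suc Suc_eq_plus1)
  have cur: "tableau_path r n d i k = d - int k - int i + int (min n (q + (if k < m then 1 else 0)))"
    by (simp add: tableau_path_def q_def m_def)
  have nxt: "tableau_path r n d (Suc i) k =
      d - int k - int i - 1 + int (min n (q' + (if k < m' then 1 else 0)))"
    if "Suc i div (r + 1) = q'" "Suc i mod (r + 1) = m'" for q' m'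
    using that by (simp add: tableau_path_def)
  show ?thesis unfolding lt m_def [symmetric]
  proof (cases "m = r")
    case True
    \<comment> \<open>At the bottom of a column the remainder returns to 0. For \<open>k < r\<close>
      the indicator that vanishes is made up by the larger quotient.\<close>
    have "Suc i = Suc q * (r + 1)" using i True by simp
    then have "Suc i div (r + 1) = Suc q" "Suc i mod (r + 1) = 0"
      by (metis nonzero_mult_div_cancel_right Suc_eq_plus1 nat.distinct(1), metis mod_mult_self2_is_0)
    from nxt[OF this] show "tableau_path r n d (Suc i) k =
        (if q < n \<and> k = m then tableau_path r n d i k else tableau_path r n d i k - 1)"
      unfolding cur using True assms by auto
  next
    case False
    then have "Suc i = Suc m + q * (r + 1)" "Suc m < r + 1" using i by auto
    then have "Suc i div (r + 1) = q" "Suc i mod (r + 1) = Suc m"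
      by (metis div_mult_self1 div_less add_0 Suc_eq_plus1 nat.distinct(1) add.commute, metis mod_mult_self1 mod_less)
    from nxt[OF this] show "tableau_path r n d (Suc i) k =
        (if q < n \<and> k = m then tableau_path r n d i k else tableau_path r n d i k - 1)"
      unfolding cur using assms by auto
  qed
qed

lemma tableau_path_end:
  assumes "(r + 1) * n \<le> g" "int g - d + int r \<le> int n"
  shows "0 \<le> tableau_path r n d g r"
proof -
  have "n \<le> g div (r + 1)" using assms(1) by (simp add: less_eq_div_iff_mult_less_eq mult.commute)
  then show ?thesis using assms(2) by (simp add: tableau_path_def)
qed

section \<open>Divisors of piecewise linear functions\<close>

text \<open>The additive extension of a point function to divisors. Degrees, chip counts of a region
  and loop coordinates are all of this form, over the integers or the reals.\<close>

definition weight :: "('p \<Rightarrow> 'b::comm_ring_1) \<Rightarrow> ('p \<Rightarrow>\<^sub>0 int) \<Rightarrow> 'b" where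
  "weight h D = (\<Sum>p\<in>Poly_Mapping.keys D. of_int (Poly_Mapping.lookup D p) * h p)"

lemma weight_superset:
  assumes "finite S" "Poly_Mapping.keys D \<subseteq> S"
  shows "weight h D = (\<Sum>p\<in>S. of_int (Poly_Mapping.lookup D p) * h p)"
  unfolding weight_def using assms by (intro sum.mono_neutral_left) (auto simp: in_keys_iff)

lemma weight_add: "weight h (D + E) = weight h D + weight h E"
proof -
  let ?S = "Poly_Mapping.keys D \<union> Poly_Mapping.keys E"
  have "weight h (D + E) = (\<Sum>p\<in>?S. of_int (Poly_Mapping.lookup (D + E) p) * h p)"
    using keys_add[of D E] by (intro weight_superset) auto
  also have "\<dots> = (\<Sum>p\<in>?S. of_int (Poly_Mapping.lookup D p) * h p) + (\<Sum>p\<in>?S. of_int (Poly_Mapping.lookup E p) * h p)"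
    by (simp add: lookup_add ring_distribs sum.distrib)
  also have "\<dots> = weight h D + weight h E"
    using weight_superset[of ?S D h] weight_superset[of ?S E h] by simp
  finally show ?thesis .
qed

lemma weight_cmul: "weight h (frag_cmul c D) = of_int c * weight h D"
  using weight_superset[of "Poly_Mapping.keys D" "frag_cmul c D" h] keys_cmul[of c D]
  by (simp add: weight_def sum_distrib_left mult.assoc)

lemma weight_zero [simp]: "weight h 0 = 0"
  by (simp add: weight_def)

lemma weight_uminus: "weight h (- D) = - weight h D"
  using weight_cmul[of h "-1" D] by simp

lemma weight_diff: "weight h (D - E) = weight h D - weight h E"
  using weight_add[of h D "- E"] by (simp add: weight_uminus)

lemma weight_frag_of [simp]: "weight h (frag_of p) = h p"
  by (simp add: weight_def)

lemma weight_sum: "weight h (\<Sum>i\<in>I. D i) = (\<Sum>i\<in>I. weight h (D i))"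
  by (induction I rule: infinite_finite_induct) (simp_all add: weight_add)

lemma weight_cong: "(\<And>p. p \<in> Poly_Mapping.keys D \<Longrightarrow> h p = k p) \<Longrightarrow> weight h D = weight k D"
  by (simp add: weight_def)

lemma weight_fun_add: "weight (\<lambda>p. h p + k p) D = weight h D + weight k D"
  by (simp add: weight_def ring_distribs sum.distrib)

lemma weight_fun_diff: "weight (\<lambda>p. h p - k p) D = weight h D - weight k D"
  by (simp add: weight_def ring_distribs sum_subtractf)

lemma weight_fun_cmul: "weight (\<lambda>p. c * h p) D = c * weight h D"
  by (simp add: weight_def sum_distrib_left mult_ac)

lemma of_int_weight: "of_int (weight h D) = weight (\<lambda>p. of_int (h p)) D"
  by (simp add: weight_def)

lemma deg_eq_weight: "deg D = weight (\<lambda>_. 1) D"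
  by (simp add: deg_def weight_def)

lemma weight_const: "weight (\<lambda>_. c) D = of_int (deg D) * c"
  using weight_fun_cmul[of c "\<lambda>_. 1" D] by (simp add: deg_eq_weight of_int_weight mult.commute)

lemma weight_mono:
  fixes h k :: "'p \<Rightarrow> 'b::linordered_idom"
  assumes "effective D" "\<And>p. p \<in> Poly_Mapping.keys D \<Longrightarrow> h p \<le> k p"
  shows "weight h D \<le> weight k D"
  unfolding weight_def using assms by (intro sum_mono mult_left_mono) (auto simp: effective_def)

lemma deg_zero: "deg 0 = 0"
  by (simp add: deg_def)

lemma deg_add: "deg (D + E) = deg D + deg E"
  and deg_diff: "deg (D - E) = deg D - deg E"
  and deg_cmul: "deg (frag_cmul c D) = c * deg D"
  and deg_frag_of [simp]: "deg (frag_of p) = 1"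
  and deg_sum: "deg (\<Sum>i\<in>I. D' i) = (\<Sum>i\<in>I. deg (D' i))"
  by (simp_all add: deg_eq_weight weight_add weight_diff weight_cmul weight_sum)

lemma effective_deg_nonneg: "effective D \<Longrightarrow> 0 \<le> deg D"
  unfolding deg_def effective_def by (intro sum_nonneg) auto

lemma effective_add: "effective D \<Longrightarrow> effective E \<Longrightarrow> effective (D + E)"
  by (simp add: effective_def lookup_add)

lemma effective_cmul: "0 \<le> c \<Longrightarrow> effective D \<Longrightarrow> effective (frag_cmul c D)"
  by (simp add: effective_def)

lemma effective_frag_of: "effective (frag_of p)"
  by (simp add: effective_def)

lemma effective_zero: "effective 0"
  by (simp add: effective_def)

lemma effective_sum: "(\<And>i. i \<in> I \<Longrightarrow> effective (D i)) \<Longrightarrow> effective (\<Sum>i\<in>I. D i)"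
  by (induction I rule: infinite_finite_induct) (simp_all add: effective_zero effective_add)

lemma Div_zero: "0 \<in> Div G"
  and Div_add: "D \<in> Div G \<Longrightarrow> E \<in> Div G \<Longrightarrow> D + E \<in> Div G"
  and Div_diff: "D \<in> Div G \<Longrightarrow> E \<in> Div G \<Longrightarrow> D - E \<in> Div G"
  and Div_cmul: "D \<in> Div G \<Longrightarrow> frag_cmul c D \<in> Div G"
  and Div_frag_of: "p \<in> points G \<Longrightarrow> frag_of p \<in> Div G"
  unfolding Div_def using keys_add[of D E] keys_diff[of D E] keys_cmul[of c D] by auto

lemma Div_sum: "(\<And>i. i \<in> I \<Longrightarrow> D i \<in> Div G) \<Longrightarrow> (\<Sum>i\<in>I. D i) \<in> Div G"
  by (induction I rule: infinite_finite_induct) (simp_all add: Div_zero Div_add)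

section \<open>Slopes along an edge and summation by parts\<close>

definition slope_on :: "(real \<Rightarrow> real) \<Rightarrow> real \<Rightarrow> real \<Rightarrow> real \<Rightarrow> bool" where
  "slope_on f x y k \<longleftrightarrow> (\<forall>t\<in>{x..y}. f t = f x + k * (t - x))"

lemma slope_onD: "slope_on f x y k \<Longrightarrow> x \<le> t \<Longrightarrow> t \<le> y \<Longrightarrow> f t = f x + k * (t - x)"
  unfolding slope_on_def by (meson atLeastAtMost_iff)

lemma vector_derivative_at_left:
  assumes "x < t" "slope_on f x t k"
  shows "vector_derivative f (at_left t) = k"
proof (rule vector_derivative_within)
  have "(f s - f t) / (s - t) = k" if "x < s" "s < t" for s
  proof -
    have "f s - f t = k * (s - t)"
      using slope_onD[OF assms(2), of s] slope_onD[OF assms(2), of t] assms(1) that by (simp add: algebra_simps)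
    then show ?thesis using that by simp
  qed
  then have "\<forall>\<^sub>F s in at_left t. (f s - f t) / (s - t) = k"
    using assms(1) unfolding eventually_at_left_field by blast
  then show "(f has_vector_derivative k) (at_left t)"
    unfolding has_real_derivative_iff_has_vector_derivative [symmetric] has_field_derivative_iff
    by (rule tendsto_eventually)
qed simp

lemma vector_derivative_at_right:
  assumes "t < y" "slope_on f t y k"
  shows "vector_derivative f (at_right t) = k"
proof (rule vector_derivative_within)
  have "(f s - f t) / (s - t) = k" if "t < s" "s < y" for s
    using slope_onD[OF assms(2), of s] that by simp
  then have "\<forall>\<^sub>F s in at_right t. (f s - f t) / (s - t) = k"
    using assms(1) unfolding eventually_at_right_field by blast
  then show "(f has_vector_derivative k) (at_right t)"
    unfolding has_real_derivative_iff_has_vector_derivative [symmetric] has_field_derivative_iff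
    by (rule tendsto_eventually)
qed simp

lemma ex_free_interval_left:
  fixes T :: "real set"
  assumes "finite T" "a < t"
  obtains x where "a \<le> x" "x < t" "{x<..<t} \<inter> T = {}"
proof (rule that)
  let ?x = "Max (insert a {u \<in> T. u < t})"
  show "a \<le> ?x" using assms by (intro Max_ge) auto
  show "?x < t" using assms by (subst Max_less_iff) auto
  have "u \<le> ?x" if "u \<in> T" "u < t" for u using that assms by (intro Max_ge) auto
  then show "{?x<..<t} \<inter> T = {}" by force
qed

lemma ex_free_interval_right:
  fixes T :: "real set"
  assumes "finite T" "t < b"
  obtains y where "t < y" "y \<le> b" "{t<..<y} \<inter> T = {}"
proof (rule that)
  let ?y = "Min (insert b {u \<in> T. t < u})"
  show "?y \<le> b" using assms by (intro Min_le) auto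
  show "t < ?y" using assms by (subst Min_gr_iff) auto
  have "?y \<le> u" if "u \<in> T" "t < u" for u using that assms by (intro Min_le) auto
  then show "{t<..<?y} \<inter> T = {}" by force
qed

definition integer_slopes :: "(real \<Rightarrow> real) \<Rightarrow> real \<Rightarrow> real \<Rightarrow> real set \<Rightarrow> bool" where
  "integer_slopes f a b T \<longleftrightarrow> (\<forall>x y. a \<le> x \<and> x < y \<and> y \<le> b \<and> {x<..<y} \<inter> T = {} \<longrightarrow>
     (\<exists>k::int. slope_on f x y (of_int k)))"

lemma integer_slopes_subinterval:
  assumes "integer_slopes f a b T" "a \<le> c" "d \<le> b"
  shows "integer_slopes f c d (T \<inter> {c..d})"
  unfolding integer_slopes_def
proof (intro allI impI, elim conjE)
  fix x y assume *: "c \<le> x" "x < y" "y \<le> d" "{x<..<y} \<inter> (T \<inter> {c..d}) = {}"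
  then have "{x<..<y} \<inter> T = {}" by fastforce
  then show "\<exists>k::int. slope_on f x y (of_int k)"
    using assms * unfolding integer_slopes_def by auto
qed

definition incoming :: "(real \<Rightarrow> real) \<Rightarrow> real \<Rightarrow> real \<Rightarrow> real \<Rightarrow> real" where
  "incoming f a b t = (if a < t then vector_derivative f (at_left t) else 0) +
     (if t < b then - vector_derivative f (at_right t) else 0)"

lemma ord_at_incoming:
  "ord_at G \<psi> p = (\<Sum>e\<in>edges G. \<Sum>t\<in>{t \<in> {0..len G e}. edge_point G e t = p}.
     incoming (\<lambda>s. \<psi> (edge_point G e s)) 0 (len G e) t)"
  by (simp add: ord_at_def incoming_def)

text \<open>Summation by parts: the incoming slopes act as the negative second derivative of
  \<open>f\<close>, so pairing them with an affine function leaves its slope times the increment of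
  \<open>f\<close>. Splitting at a breakpoint works because \<open>incoming\<close> there is the sum
  of its two one-sided parts.\<close>

lemma sum_incoming_affine:
  assumes "finite T" "T \<subseteq> {a..b}" "a \<in> T" "b \<in> T" "a < b" "integer_slopes f a b T"
  shows "(\<Sum>t\<in>T. incoming f a b t * (\<alpha> + \<beta> * t)) = \<beta> * (f b - f a)"
  using assms
proof (induction "card T" arbitrary: T a b rule: less_induct)
  case less
  show ?case
  proof (cases "T \<inter> {a<..<b} = {}")
    case True
    then have T: "T = {a, b}" using less.prems by force
    obtain k :: int where k: "slope_on f a b (of_int k)"
      using less.prems(5,6) True unfolding integer_slopes_def by (metis Int_commute order_refl)
    have "incoming f a b a = - k" "incoming f a b b = k"
      using vector_derivative_at_left[OF less.prems(5) k] vector_derivative_at_right[OF less.prems(5) k] less.prems(5)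
      by (simp_all add: incoming_def)
    moreover have "f b - f a = k * (b - a)" using slope_onD[OF k, of b] less.prems(5) by simp
    ultimately show ?thesis unfolding \<open>f b - f a = k * (b - a)\<close> using T less.prems(5) by (simp add: algebra_simps)
  next
    case False
    then obtain c where c: "c \<in> T" "a < c" "c < b" by auto
    define L R where "L = T \<inter> {a..c}" and "R = T \<inter> {c..b}"
    have LR: "T = L \<union> R" "L \<inter> R = {c}" "c \<in> L" "c \<in> R" "finite L" "finite R"
      using less.prems c by (auto simp: L_def R_def)
    have "L \<subseteq> T" "b \<in> T - L" "R \<subseteq> T" "a \<in> T - R"
      using c less.prems(3,4) by (simp_all add: L_def R_def)
    then have "L \<subset> T" "R \<subset> T" by blast+
    then have card: "card L < card T" "card R < card T" using less.prems(1) by (auto intro: psubset_card_mono)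
    have "integer_slopes f a c L" "integer_slopes f c b R"
      unfolding L_def R_def using c less.prems(6) by (auto intro: integer_slopes_subinterval)
    note islopes = this
    have aL: "a \<in> L" and bR: "b \<in> R" and sub: "L \<subseteq> {a..c}" "R \<subseteq> {c..b}"
      using less.prems(3,4) c by (simp_all add: L_def R_def)
    have IH: "(\<Sum>t\<in>L. incoming f a c t * (\<alpha> + \<beta> * t)) = \<beta> * (f c - f a)"
      "(\<Sum>t\<in>R. incoming f c b t * (\<alpha> + \<beta> * t)) = \<beta> * (f b - f c)"
      by (rule less.hyps[OF card(1) LR(5) sub(1) aL LR(3) c(2) islopes(1)])
        (rule less.hyps[OF card(2) LR(6) sub(2) LR(4) bR c(3) islopes(2)])
    have "(\<Sum>t\<in>T. incoming f a b t * (\<alpha> + \<beta> * t)) =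
        (\<Sum>t\<in>L - {c}. incoming f a b t * (\<alpha> + \<beta> * t)) + (\<Sum>t\<in>R - {c}. incoming f a b t * (\<alpha> + \<beta> * t))
        + incoming f a b c * (\<alpha> + \<beta> * c)"
    proof -
      have "T = insert c ((L - {c}) \<union> (R - {c}))" using LR by auto
      moreover have "(L - {c}) \<inter> (R - {c}) = {}" using LR by auto
      ultimately show ?thesis using LR(5,6) by (simp add: sum.union_disjoint)
    qed
    also have "(\<Sum>t\<in>L - {c}. incoming f a b t * (\<alpha> + \<beta> * t)) = (\<Sum>t\<in>L - {c}. incoming f a c t * (\<alpha> + \<beta> * t))"
      using c by (intro sum.cong) (auto simp: incoming_def L_def)
    also have "(\<Sum>t\<in>R - {c}. incoming f a b t * (\<alpha> + \<beta> * t)) = (\<Sum>t\<in>R - {c}. incoming f c b t * (\<alpha> + \<beta> * t))"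
      using c by (intro sum.cong) (auto simp: incoming_def R_def)
    also have "incoming f a b c = incoming f a c c + incoming f c b c"
      using c by (simp add: incoming_def)
    finally show ?thesis
      using IH sum.remove[OF LR(5,3), of "\<lambda>t. incoming f a c t * (\<alpha> + \<beta> * t)"]
        sum.remove[OF LR(6,4), of "\<lambda>t. incoming f c b t * (\<alpha> + \<beta> * t)"]
      by (simp add: algebra_simps)
  qed
qed

lemma incoming_right_end_integer:
  assumes "finite T" "a < b" "integer_slopes f a b T"
  shows "\<exists>k::int. incoming f a b b = of_int k"
proof -
  obtain x where x: "a \<le> x" "x < b" "{x<..<b} \<inter> T = {}"
    by (rule ex_free_interval_left[OF assms(1,2)]) (rule that)
  then obtain k :: int where "slope_on f x b (of_int k)" using assms(3) unfolding integer_slopes_def by blast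
  then show ?thesis using vector_derivative_at_left[OF x(2)] assms(2) by (auto simp: incoming_def)
qed

lemma finite_edge_point_fibre: "finite {t \<in> {0..len G e}. edge_point G e t = p}"
proof (rule finite_subset)
  show "{t \<in> {0..len G e}. edge_point G e t = p} \<subseteq> {0, len G e, (case p of Interior _ u \<Rightarrow> u | Vertex _ \<Rightarrow> 0)}"
    by (auto simp: edge_point_def split: if_splits)
qed simp

lemma finite_edge_point_vimage:
  assumes "finite K"
  shows "finite {t \<in> {0..len G e}. edge_point G e t \<in> K}"
proof -
  have "{t \<in> {0..len G e}. edge_point G e t \<in> K} = (\<Union>p\<in>K. {t \<in> {0..len G e}. edge_point G e t = p})" by auto
  then show ?thesis using assms finite_edge_point_fibre[of G e] by (simp only: finite_UN_I)
qed

lemma weight_div: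
  assumes fin: "finite (verts G)" "finite (edges G)"
    and ends: "\<And>e. e \<in> edges G \<Longrightarrow> tail G e \<in> verts G \<and> head G e \<in> verts G"
    and len: "\<And>e. e \<in> edges G \<Longrightarrow> 0 < len G e"
    and pl: "piecewise_linear G \<psi>" and div: "is_div G \<psi> D"
  obtains T where "\<And>e. e \<in> edges G \<Longrightarrow> finite (T e) \<and> T e \<subseteq> {0..len G e} \<and> 0 \<in> T e \<and> len G e \<in> T e \<and>
      integer_slopes (\<lambda>s. \<psi> (edge_point G e s)) 0 (len G e) (T e)"
    "\<And>h :: _ \<Rightarrow> real. weight h D = (\<Sum>e\<in>edges G. \<Sum>t\<in>T e.
      incoming (\<lambda>s. \<psi> (edge_point G e s)) 0 (len G e) t * h (edge_point G e t))"
proof -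
  obtain S where S: "S \<subseteq> points G" "finite S"
    and aff: "\<forall>e\<in>edges G. \<forall>a b. 0 \<le> a \<and> a < b \<and> b \<le> len G e \<and> edge_point G e ` {a<..<b} \<inter> S = {} \<longrightarrow>
           (\<exists>k::int. \<forall>t\<in>{a..b}. \<psi> (edge_point G e t) = \<psi> (edge_point G e a) + of_int k * (t - a))"
    using pl unfolding piecewise_linear_def by (elim conjE exE) (rule that)
  \<comment> \<open>Besides the breakpoints, \<open>K\<close> holds the vertices, so that both ends
    of each edge belong to \<open>T e\<close>, and the support of \<open>D\<close>, so that no
    coefficient is lost.\<close>
  define K where "K = S \<union> Poly_Mapping.keys D \<union> Vertex ` verts G"
  have K: "finite K" "K \<subseteq> points G" "Poly_Mapping.keys D \<subseteq> K" "S \<subseteq> K"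
    using S div fin by (auto simp: K_def is_div_def Div_def points_def)
  define T where "T e = {t \<in> {0..len G e}. edge_point G e t \<in> K}" for e
  show thesis
  proof (rule that[of T])
    fix e assume e: "e \<in> edges G"
    have "0 \<in> T e" "len G e \<in> T e"
      using ends[OF e] len[OF e] by (auto simp: T_def edge_point_def K_def)
    moreover have "integer_slopes (\<lambda>s. \<psi> (edge_point G e s)) 0 (len G e) (T e)"
      unfolding integer_slopes_def slope_on_def
    proof (intro allI impI aff[rule_format, OF e])
      fix x y assume *: "0 \<le> x \<and> x < y \<and> y \<le> len G e \<and> {x<..<y} \<inter> T e = {}"
      have "edge_point G e t \<notin> S" if "x < t" "t < y" for t
      proof
        assume "edge_point G e t \<in> S"
        then have "t \<in> T e" using * that K(4) by (auto simp: T_def)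
        then show False using * that by auto
      qed
      then show "0 \<le> x \<and> x < y \<and> y \<le> len G e \<and> edge_point G e ` {x<..<y} \<inter> S = {}" using * by auto
    qed
    ultimately show "finite (T e) \<and> T e \<subseteq> {0..len G e} \<and> 0 \<in> T e \<and> len G e \<in> T e \<and>
      integer_slopes (\<lambda>s. \<psi> (edge_point G e s)) 0 (len G e) (T e)"
      using finite_edge_point_vimage[OF K(1)] by (auto simp: T_def)
  next
    fix h :: "_ \<Rightarrow> real"
    define inc where "inc e = incoming (\<lambda>s. \<psi> (edge_point G e s)) 0 (len G e)" for e
    define A where "A e p = {t \<in> {0..len G e}. edge_point G e t = p}" for e p
    have "weight h D = (\<Sum>p\<in>K. of_int (Poly_Mapping.lookup D p) * h p)"
      by (rule weight_superset[OF K(1,3)])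
    also have "\<dots> = (\<Sum>p\<in>K. ord_at G \<psi> p * h p)"
      using div K(2) by (intro sum.cong) (auto simp: is_div_def)
    also have "\<dots> = (\<Sum>p\<in>K. \<Sum>e\<in>edges G. \<Sum>t\<in>A e p. inc e t * h (edge_point G e t))"
      by (auto simp: ord_at_incoming inc_def A_def sum_distrib_right intro!: sum.cong)
    also have "\<dots> = (\<Sum>e\<in>edges G. \<Sum>p\<in>K. \<Sum>t\<in>A e p. inc e t * h (edge_point G e t))"
      by (rule sum.swap)
    also have "\<dots> = (\<Sum>e\<in>edges G. \<Sum>t\<in>T e. inc e t * h (edge_point G e t))"
    proof (rule sum.cong)
      fix e
      have "(\<Sum>t\<in>(\<Union>p\<in>K. A e p). inc e t * h (edge_point G e t)) = (\<Sum>p\<in>K. \<Sum>t\<in>A e p. inc e t * h (edge_point G e t))"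
        using K(1) finite_edge_point_fibre[of G e] by (intro sum.UNION_disjoint) (auto simp: A_def)
      moreover have "(\<Union>p\<in>K. A e p) = T e" by (auto simp: A_def T_def)
      ultimately show "(\<Sum>p\<in>K. \<Sum>t\<in>A e p. inc e t * h (edge_point G e t)) = (\<Sum>t\<in>T e. inc e t * h (edge_point G e t))"
        by simp
    qed simp
    finally show "weight h D = (\<Sum>e\<in>edges G. \<Sum>t\<in>T e. incoming (\<lambda>s. \<psi> (edge_point G e s)) 0 (len G e) t * h (edge_point G e t))"
      by (simp add: inc_def)
  qed
qed

section \<open>The topology glued from the edges\<close>

lemma topspace_graph_topology:
  assumes ep: "\<And>e t. e \<in> edges G \<Longrightarrow> t \<in> {0..len G e} \<Longrightarrow> edge_point G e t \<in> points G"
  shows "topspace (graph_topology G) = points G"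
proof
  show "topspace (graph_topology G) \<subseteq> points G"
    unfolding topspace_def openin_graph_topology by blast
  have "{t \<in> {0..len G e}. edge_point G e t \<in> points G} = {0..len G e}" if "e \<in> edges G" for e
    using ep[OF that] by auto
  then show "points G \<subseteq> topspace (graph_topology G)"
    by (intro openin_subset) (simp add: openin_graph_topology)
qed

lemma edge_point_in_points:
  assumes "\<And>e. e \<in> edges G \<Longrightarrow> tail G e \<in> verts G \<and> head G e \<in> verts G" "e \<in> edges G" "t \<in> {0..len G e}"
  shows "edge_point G e t \<in> points G"
  using assms by (auto simp: edge_point_def points_def)

lemma continuous_map_graph_topology:
  assumes "\<And>e t. e \<in> edges G \<Longrightarrow> t \<in> {0..len G e} \<Longrightarrow> edge_point G e t \<in> points G"
    and "\<And>e. e \<in> edges G \<Longrightarrow> continuous_map (top_of_set {0..len G e}) Y (\<lambda>t. f (edge_point G e t))"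
    and "\<And>p. p \<in> points G \<Longrightarrow> f p \<in> topspace Y"
  shows "continuous_map (graph_topology G) Y f"
proof -
  have "openin (graph_topology G) {x \<in> points G. f x \<in> U}" if "openin Y U" for U
    unfolding openin_graph_topology
  proof (intro conjI ballI)
    fix e assume e: "e \<in> edges G"
    have "openin (top_of_set {0..len G e}) {t \<in> topspace (top_of_set {0..len G e}). f (edge_point G e t) \<in> U}"
      using assms(2)[OF e] that by (rule openin_continuous_map_preimage)
    moreover have "{t \<in> topspace (top_of_set {0..len G e}). f (edge_point G e t) \<in> U} =
        {t \<in> {0..len G e}. edge_point G e t \<in> {x \<in> points G. f x \<in> U}}"
      using assms(1)[OF e] by auto
    ultimately show "openin (top_of_set {0..len G e}) {t \<in> {0..len G e}. edge_point G e t \<in> {x \<in> points G. f x \<in> U}}"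
      by simp
  qed auto
  then show ?thesis
    using assms(3) topspace_graph_topology[of G, OF assms(1)] unfolding continuous_map_def by (simp add: Pi_iff)
qed

lemma continuous_map_edge_point:
  assumes "\<And>e t. e \<in> edges G \<Longrightarrow> t \<in> {0..len G e} \<Longrightarrow> edge_point G e t \<in> points G" "e \<in> edges G"
  shows "continuous_map (top_of_set {0..len G e}) (graph_topology G) (edge_point G e)"
  unfolding continuous_map_def using assms topspace_graph_topology[of G, OF assms(1)]
  by (auto simp: openin_graph_topology)

lemma compact_space_graph_topology:
  assumes fin: "finite (verts G)" "finite (edges G)"
    and ends: "\<And>e. e \<in> edges G \<Longrightarrow> tail G e \<in> verts G \<and> head G e \<in> verts G"
  shows "compact_space (graph_topology G)"
proof -
  note ep = edge_point_in_points[OF ends]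
  have "compactin (graph_topology G) (\<Union>e\<in>edges G. edge_point G e ` {0..len G e})"
  proof (rule compactin_Union)
    fix S assume "S \<in> (\<lambda>e. edge_point G e ` {0..len G e}) ` edges G"
    then obtain e where e: "e \<in> edges G" "S = edge_point G e ` {0..len G e}" by blast
    have "compactin (top_of_set {0..len G e}) {0..len G e}" by (simp add: compactin_subtopology)
    then show "compactin (graph_topology G) S"
      unfolding e(2) by (rule image_compactin) (rule continuous_map_edge_point[OF ep e(1)])
  qed (use fin in auto)
  \<comment> \<open>Vertices are covered separately, since an isolated vertex lies in no edge image;
    for \<open>g = 0\<close> it is the whole chain.\<close>
  moreover have "compactin (graph_topology G) (Vertex ` verts G)"
    using fin topspace_graph_topology[of G, OF ep] by (intro finite_imp_compactin) (auto simp: points_def)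
  moreover have "points G = (\<Union>e\<in>edges G. edge_point G e ` {0..len G e}) \<union> Vertex ` verts G"
  proof
    show "(\<Union>e\<in>edges G. edge_point G e ` {0..len G e}) \<union> Vertex ` verts G \<subseteq> points G"
    proof (intro Un_least UN_least image_subsetI)
      show "edge_point G e t \<in> points G" if "e \<in> edges G" "t \<in> {0..len G e}" for e t
        using ep that by blast
    qed (simp add: points_def)
    have "Interior e t \<in> edge_point G e ` {0..len G e}" if "0 < t" "t < len G e" for e t
      using that by (intro image_eqI[of _ _ t]) (auto simp: edge_point_def)
    then show "points G \<subseteq> (\<Union>e\<in>edges G. edge_point G e ` {0..len G e}) \<union> Vertex ` verts G"
      by (auto simp: points_def)
  qed
  ultimately show ?thesis
    using topspace_graph_topology[of G, OF ep] by (simp add: compact_space_def compactin_Un)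
qed

section \<open>The Abel--Jacobi map of a chain of loops\<close>

text \<open>The \<open>i\<close>th coordinate of the Abel--Jacobi map, modulo the length of loop \<open>i\<close>: going around the
  loop counterclockwise from \<open>v\<^bsub>i-1\<^esub>\<close> along the bottom edge. The other loops are
  contracted to \<open>v\<^bsub>i-1\<^esub>\<close> and \<open>v\<^sub>i\<close>.\<close>

primrec loop_pos :: "(nat \<Rightarrow> real) \<Rightarrow> nat \<Rightarrow> (nat, chain_edge) point \<Rightarrow> real" where
  "loop_pos \<m> i (Vertex j) = (if j < i then 0 else \<m> i)"
| "loop_pos \<m> i (Interior e t) =
     (if loop_index e < i then 0 else if loop_index e = i
      then (case e of Top _ \<Rightarrow> - t | Bottom _ \<Rightarrow> t) else \<m> i)"

lemma weight_indicator: "weight (\<lambda>q. of_bool (q = p)) D = of_int (Poly_Mapping.lookup D p)"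
proof -
  have "weight (\<lambda>q. of_bool (q = p)) D = (\<Sum>q\<in>insert p (Poly_Mapping.keys D). of_int (Poly_Mapping.lookup D q) * of_bool (q = p))"
    by (rule weight_superset) auto
  also have "\<dots> = (\<Sum>q\<in>insert p (Poly_Mapping.keys D). if q = p then of_int (Poly_Mapping.lookup D p) else 0)"
    by (intro sum.cong) auto
  finally show ?thesis by simp
qed

locale loop_chain =
  fixes g :: nat and \<l> \<m> :: "nat \<Rightarrow> real"
  assumes top_pos: "i \<in> {1..g} \<Longrightarrow> 0 < \<l> i"
    and bottom_pos: "i \<in> {1..g} \<Longrightarrow> 0 < \<m> i"
begin

abbreviation \<Gamma> where "\<Gamma> \<equiv> chain_of_loops g \<l> \<m>"

abbreviation jac :: "nat \<Rightarrow> ((nat, chain_edge) point \<Rightarrow>\<^sub>0 int) \<Rightarrow> real" where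
  "jac i \<equiv> weight (loop_pos \<m> i)"

definition loop_eq :: "nat \<Rightarrow> real \<Rightarrow> real \<Rightarrow> bool" where
  "loop_eq i x y \<longleftrightarrow> (\<exists>n::int. x - y = of_int n * (\<l> i + \<m> i))"

lemma loop_eq_refl [simp]: "loop_eq i x x"
  unfolding loop_eq_def by (intro exI[of _ 0]) simp

lemma loop_eq_sym: "loop_eq i x y \<Longrightarrow> loop_eq i y x"
  unfolding loop_eq_def by (elim exE, rule_tac x="-n" in exI) simp

lemma loop_eq_trans: "loop_eq i x y \<Longrightarrow> loop_eq i y z \<Longrightarrow> loop_eq i x z"
  unfolding loop_eq_def by (elim exE, rule_tac x="n + na" in exI) (simp add: algebra_simps)

lemma loop_eq_shift: "loop_eq i (x - z) (y - z) \<longleftrightarrow> loop_eq i x y"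
  unfolding loop_eq_def by simp

lemma loop_eq_diff_0: "loop_eq i (x - y) 0 \<longleftrightarrow> loop_eq i x y"
  unfolding loop_eq_def by simp

lemma verts_chain [simp]: "verts \<Gamma> = {0..g}"
  and edges_chain: "edges \<Gamma> = Top ` {1..g} \<union> Bottom ` {1..g}"
  and tail_chain [simp]: "tail \<Gamma> e = loop_index e - 1"
  and head_chain [simp]: "head \<Gamma> e = loop_index e"
  and len_Top [simp]: "len \<Gamma> (Top i) = \<l> i"
  and len_Bottom [simp]: "len \<Gamma> (Bottom i) = \<m> i"
  by (simp_all add: chain_of_loops_def)

lemma in_edges_chain [simp]: "e \<in> edges \<Gamma> \<longleftrightarrow> loop_index e \<in> {1..g}"
  by (cases e) (auto simp: edges_chain)

lemma finite_edges_chain [simp]: "finite (edges \<Gamma>)"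
  by (simp add: edges_chain)

lemma finite_verts_chain: "finite (verts \<Gamma>)"
  by simp

lemma ends_chain: "e \<in> edges \<Gamma> \<Longrightarrow> tail \<Gamma> e \<in> verts \<Gamma> \<and> head \<Gamma> e \<in> verts \<Gamma>"
  by auto

lemma len_chain_pos: "e \<in> edges \<Gamma> \<Longrightarrow> 0 < len \<Gamma> e"
  using top_pos bottom_pos by (cases e) auto

lemma sum_edges_chain: "(\<Sum>e\<in>edges \<Gamma>. X e) = (\<Sum>i\<in>{1..g}. X (Top i) + X (Bottom i))"
proof -
  have "(\<Sum>e\<in>edges \<Gamma>. X e) = (\<Sum>e\<in>Top ` {1..g}. X e) + (\<Sum>e\<in>Bottom ` {1..g}. X e)"
    unfolding edges_chain by (intro sum.union_disjoint) auto
  then show ?thesis by (simp add: sum.reindex inj_on_def sum.distrib)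
qed

lemmas edge_point_chain = edge_point_in_points[OF ends_chain]

lemma Vertex_in_points [simp]: "Vertex j \<in> points \<Gamma> \<longleftrightarrow> j \<le> g"
  by (auto simp: points_def)

lemma Interior_in_points: "Interior e t \<in> points \<Gamma> \<longleftrightarrow> e \<in> edges \<Gamma> \<and> 0 < t \<and> t < len \<Gamma> e"
  by (auto simp: points_def)

lemma loop_pos_Bottom:
  assumes "1 \<le> j" "1 \<le> i" "0 \<le> t" "t \<le> \<m> j"
  shows "loop_pos \<m> i (edge_point \<Gamma> (Bottom j) t) = (if j < i then 0 else if j = i then t else \<m> i)"
  using assms by (auto simp: edge_point_def)

text \<open>The linear coordinate \<open>- t\<close> reaches \<open>- \<l> i\<close> at the right
  end of the top edge, whereas the vertex has the value \<open>\<m> i\<close>; the correction is one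
  full turn.\<close>

lemma loop_pos_Top:
  assumes "1 \<le> j" "1 \<le> i" "0 \<le> t" "t \<le> \<l> j"
  shows "loop_pos \<m> i (edge_point \<Gamma> (Top j) t) =
    (if j < i then 0 else if j = i then - t + (if t = \<l> i \<and> t \<noteq> 0 then \<l> i + \<m> i else 0) else \<m> i)"
  using assms by (auto simp: edge_point_def)

text \<open>Pair \<open>D\<close> with the coordinate function and sum by parts. Edges of other
  loops carry a constant and contribute nothing; the linear parts on the two edges of loop
  \<open>i\<close> contribute opposite increments of \<open>\<psi>\<close>. What remains is the jump
  by a full turn at the end of the top edge, weighted by an integer slope.\<close>

lemma jac_div:
  assumes pl: "piecewise_linear \<Gamma> \<psi>" and div: "is_div \<Gamma> \<psi> D"
  shows "deg D = 0" and "i \<in> {1..g} \<Longrightarrow> loop_eq i (jac i D) 0"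
proof -
  define \<phi> where "\<phi> e = (\<lambda>s. \<psi> (edge_point \<Gamma> e s))" for e
  define inc where "inc e = incoming (\<phi> e) 0 (len \<Gamma> e)" for e
  obtain T where T0: "\<And>e. e \<in> edges \<Gamma> \<Longrightarrow> finite (T e) \<and> T e \<subseteq> {0..len \<Gamma> e} \<and> 0 \<in> T e \<and> len \<Gamma> e \<in> T e \<and>
      integer_slopes (\<lambda>s. \<psi> (edge_point \<Gamma> e s)) 0 (len \<Gamma> e) (T e)"
    and w0: "\<And>h :: _ \<Rightarrow> real. weight h D = (\<Sum>e\<in>edges \<Gamma>. \<Sum>t\<in>T e.
      incoming (\<lambda>s. \<psi> (edge_point \<Gamma> e s)) 0 (len \<Gamma> e) t * h (edge_point \<Gamma> e t))"
    by (rule weight_div[OF finite_verts_chain finite_edges_chain ends_chain len_chain_pos pl div]) (assumption, assumption, rule that)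
  note T = T0 [folded \<phi>_def] and w = w0 [folded \<phi>_def, folded inc_def]
  have affine: "(\<Sum>t\<in>T e. inc e t * (\<alpha> + \<beta> * t)) = \<beta> * (\<phi> e (len \<Gamma> e) - \<phi> e 0)" if "e \<in> edges \<Gamma>" for e \<alpha> \<beta>
    using T[OF that] len_chain_pos[OF that] unfolding inc_def by (intro sum_incoming_affine) auto
  have const: "(\<Sum>t\<in>T e. inc e t * c) = 0" if "e \<in> edges \<Gamma>" for e c
    using affine[OF that, of c 0] by simp
  have "real_of_int (deg D) = 0"
    using w[of "\<lambda>_. 1"] const[of _ 1] by (simp add: deg_eq_weight of_int_weight)
  then show "deg D = 0" by simp
  assume i: "i \<in> {1..g}"
  define X where "X e = (\<Sum>t\<in>T e. inc e t * loop_pos \<m> i (edge_point \<Gamma> e t))" for e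
  define \<Delta> where "\<Delta> = \<psi> (Vertex i) - \<psi> (Vertex (i - 1))"
  have \<phi>_ends: "\<phi> e (len \<Gamma> e) - \<phi> e 0 = \<Delta>" if "loop_index e = i" for e
    using len_chain_pos[of e] that i by (auto simp: \<phi>_def \<Delta>_def edge_point_def)
  have "X e = 0" if e: "e \<in> edges \<Gamma>" "loop_index e \<noteq> i" for e
  proof -
    have "loop_pos \<m> i (edge_point \<Gamma> e t) = (if loop_index e < i then 0 else \<m> i)" if "t \<in> T e" for t
      using T[OF e(1)] that e i by (cases e) (auto simp: loop_pos_Bottom loop_pos_Top)
    then have "X e = (\<Sum>t\<in>T e. inc e t * (if loop_index e < i then 0 else \<m> i))" unfolding X_def by simp
    then show ?thesis using const[OF e(1)] by simp
  qed
  then have X0: "X (Top j) + X (Bottom j) = (if j = i then X (Top i) + X (Bottom i) else 0)" if "j \<in> {1..g}" for j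
    using that by auto
  have "jac i D = (\<Sum>j\<in>{1..g}. X (Top j) + X (Bottom j))"
    unfolding w X_def [symmetric] by (rule sum_edges_chain)
  also have "\<dots> = (\<Sum>j\<in>{1..g}. if j = i then X (Top i) + X (Bottom i) else 0)"
    by (intro sum.cong X0) auto
  also have "\<dots> = X (Top i) + X (Bottom i)"
    using i by simp
  also have "X (Bottom i) = \<Delta>"
  proof -
    have e: "Bottom i \<in> edges \<Gamma>" using i by simp
    have "loop_pos \<m> i (edge_point \<Gamma> (Bottom i) t) = 0 + 1 * t" if "t \<in> T (Bottom i)" for t
      using T[OF e] that i by (subst loop_pos_Bottom) auto
    then have "X (Bottom i) = (\<Sum>t\<in>T (Bottom i). inc (Bottom i) t * (0 + 1 * t))"
      unfolding X_def by (intro sum.cong) simp_all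
    also have "\<dots> = \<Delta>" using affine[OF e, of 0 1] \<phi>_ends[of "Bottom i"] by simp
    finally show ?thesis .
  qed
  also have "X (Top i) = - \<Delta> + inc (Top i) (\<l> i) * (\<l> i + \<m> i)"
  proof -
    have e: "Top i \<in> edges \<Gamma>" using i by simp
    have l: "0 < \<l> i" using top_pos i by auto
    have "loop_pos \<m> i (edge_point \<Gamma> (Top i) t) = (0 + (-1) * t) + (if t = \<l> i then \<l> i + \<m> i else 0)"
      if "t \<in> T (Top i)" for t
      using T[OF e] that i l by (subst loop_pos_Top) auto
    then have "inc (Top i) t * loop_pos \<m> i (edge_point \<Gamma> (Top i) t) = inc (Top i) t * (0 + (-1) * t) +
        (if t = \<l> i then inc (Top i) (\<l> i) * (\<l> i + \<m> i) else 0)" if "t \<in> T (Top i)" for t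
      using that by (simp add: ring_distribs)
    then have "X (Top i) = (\<Sum>t\<in>T (Top i). inc (Top i) t * (0 + (-1) * t) +
        (if t = \<l> i then inc (Top i) (\<l> i) * (\<l> i + \<m> i) else 0))"
      unfolding X_def by (intro sum.cong refl)
    also have "\<dots> = - \<Delta> + inc (Top i) (\<l> i) * (\<l> i + \<m> i)"
      unfolding sum.distrib affine[OF e] using T[OF e] \<phi>_ends[of "Top i"] by simp
    finally show ?thesis .
  qed
  finally have jac: "jac i D = inc (Top i) (\<l> i) * (\<l> i + \<m> i)" by simp
  obtain k :: int where "inc (Top i) (\<l> i) = of_int k"
    using incoming_right_end_integer[of "T (Top i)" 0 "\<l> i" "\<phi> (Top i)"] T[of "Top i"] i top_pos[OF i]
    by (auto simp: inc_def)
  then show "loop_eq i (jac i D) 0" using jac by (auto simp: loop_eq_def)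
qed

end

section \<open>Construction of a function with a given divisor\<close>

fun on_edge :: "'e \<Rightarrow> (real \<Rightarrow> bool) \<Rightarrow> ('v, 'e) point \<Rightarrow> bool" where
  "on_edge e P (Vertex j) \<longleftrightarrow> False"
| "on_edge e P (Interior e' u) \<longleftrightarrow> e' = e \<and> P u"

text \<open>Subtracting this function of \<open>t\<close> lowers the slope by one from the parameter
  \<open>u\<close> on, which is the kink that a chip at \<open>u\<close> requires.\<close>

fun ramp :: "'e \<Rightarrow> real \<Rightarrow> ('v, 'e) point \<Rightarrow> real" where
  "ramp e t (Vertex j) = 0"
| "ramp e t (Interior e' u) = (if e' = e then max 0 (t - u) else 0)"

primrec left_of :: "nat \<Rightarrow> (nat, chain_edge) point \<Rightarrow> bool" where
  "left_of i (Vertex j) \<longleftrightarrow> j < i"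
| "left_of i (Interior e t) \<longleftrightarrow> loop_index e < i"

context loop_chain begin

text \<open>The slopes at the left ends of the edges are forced: those of loop \<open>i\<close> add up to minus the
  degree of \<open>D\<close> up to \<open>v\<^bsub>i-1\<^esub>\<close>, and \<open>\<psi>\<close> must have the same increment along both edges.\<close>

lemma ex_div:
  assumes D: "D \<in> Div \<Gamma>" and deg: "deg D = 0"
    and jac: "\<And>i. i \<in> {1..g} \<Longrightarrow> loop_eq i (jac i D) 0"
  shows "\<exists>\<psi>. piecewise_linear \<Gamma> \<psi> \<and> is_div \<Gamma> \<psi> D"
proof -
  have keys: "Poly_Mapping.keys D \<subseteq> points \<Gamma>" using D by (simp add: Div_def)
  obtain n :: "nat \<Rightarrow> int" where n: "\<And>i. i \<in> {1..g} \<Longrightarrow> jac i D = of_int (n i) * (\<l> i + \<m> i)"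
    using jac unfolding loop_eq_def by (metis diff_zero)
  define N :: "chain_edge \<Rightarrow> int" where "N e = weight (\<lambda>q. of_bool (on_edge e (\<lambda>_. True) q)) D" for e
  define S :: "nat \<Rightarrow> int" where "S i = - weight (\<lambda>q. of_bool (left_of i q)) D" for i
  define s :: "chain_edge \<Rightarrow> int" where
    "s e = (case e of Top i \<Rightarrow> n i + N (Top i) | Bottom i \<Rightarrow> S i - (n i + N (Top i)))" for e
  define inc :: "nat \<Rightarrow> real" where "inc i = real_of_int (s (Top i)) * \<l> i - weight (ramp (Top i) (\<l> i)) D" for i
  define c where "c i = (\<Sum>j\<in>{1..i}. inc j)" for i
  define F :: "chain_edge \<Rightarrow> real \<Rightarrow> real" where "F e t = c (loop_index e - 1) + real_of_int (s e) * t - weight (ramp e t) D" for e t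
  define \<psi> :: "(nat, chain_edge) point \<Rightarrow> real" where "\<psi> p = (case p of Vertex i \<Rightarrow> c i | Interior e t \<Rightarrow> F e t)" for p
  have inc: "real_of_int (s e) * len \<Gamma> e - weight (ramp e (len \<Gamma> e)) D = inc i" if i: "i \<in> {1..g}" "loop_index e = i" for i e
  proof (cases e)
    case (Bottom i')
    \<comment> \<open>On every part of the graph the function on the left equals
      \<open>\<m> i\<close>. Summed over \<open>D\<close>, of degree 0, this converts the multiple
      of the loop length in \<open>jac i D\<close> into equal increments along both edges.\<close>
    have "weight (\<lambda>q. loop_pos \<m> i q + (\<l> i + \<m> i) * of_bool (on_edge (Top i) (\<lambda>_. True) q)
          + \<m> i * of_bool (left_of i q) - ramp (Top i) (\<l> i) q + ramp (Bottom i) (\<m> i) q) D = weight (\<lambda>_. \<m> i) D"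
    proof (rule weight_cong)
      fix q assume q: "q \<in> Poly_Mapping.keys D"
      show "loop_pos \<m> i q + (\<l> i + \<m> i) * of_bool (on_edge (Top i) (\<lambda>_. True) q)
          + \<m> i * of_bool (left_of i q) - ramp (Top i) (\<l> i) q + ramp (Bottom i) (\<m> i) q = \<m> i"
      proof (cases q)
        case (Interior e' u)
        then have "0 < u" "u < len \<Gamma> e'" using q keys by (auto simp: Interior_in_points)
        then show ?thesis using Interior by (cases e') auto
      qed simp
    qed
    then have "jac i D + (\<l> i + \<m> i) * N (Top i) - \<m> i * S i
        - weight (ramp (Top i) (\<l> i)) D + weight (ramp (Bottom i) (\<m> i)) D = 0"
      by (simp add: weight_fun_add weight_fun_diff weight_fun_cmul weight_const deg N_def S_def of_int_weight)
    then show ?thesis using n[OF i(1)] i(2) Bottom by (simp add: inc_def s_def algebra_simps)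
  qed (use i in \<open>simp add: inc_def\<close>)
  have ramp0: "weight (ramp e 0) D = 0" for e
  proof -
    have "weight (ramp e 0) D = weight (\<lambda>_. 0) D"
    proof (rule weight_cong)
      show "ramp e 0 q = 0" if "q \<in> Poly_Mapping.keys D" for q
        using that keys by (cases q) (auto simp: Interior_in_points)
    qed
    then show ?thesis by (simp add: weight_const)
  qed
  have \<psi>F: "\<psi> (edge_point \<Gamma> e t) = F e t" if e: "e \<in> edges \<Gamma>" and t: "t \<in> {0..len \<Gamma> e}" for e t
  proof -
    define i where "i = loop_index e"
    have i: "i \<in> {1..g}" "loop_index e = i" using e by (simp_all add: i_def)
    then have "c i = c (i - 1) + inc i" unfolding c_def by (cases i) auto
    then show ?thesis
      using inc[OF i] i(2) ramp0 len_chain_pos[OF e] by (simp add: \<psi>_def edge_point_def F_def)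
  qed
  have slope: "slope_on (F e) x y (real_of_int (s e) - weight (\<lambda>q. of_bool (on_edge e (\<lambda>u. u \<le> x) q)) D)"
    if free: "\<And>u. Interior e u \<in> Poly_Mapping.keys D \<Longrightarrow> u \<le> x \<or> y \<le> u" for e x y
    unfolding slope_on_def
  proof
    fix t assume t: "t \<in> {x..y}"
    have "weight (\<lambda>q. ramp e t q - ramp e x q) D = weight (\<lambda>q. (t - x) * of_bool (on_edge e (\<lambda>u. u \<le> x) q)) D"
    proof (rule weight_cong)
      show "ramp e t q - ramp e x q = (t - x) * of_bool (on_edge e (\<lambda>u. u \<le> x) q)" if "q \<in> Poly_Mapping.keys D" for q
        using that t free by (cases q) force+
    qed
    then have "weight (ramp e t) D = weight (ramp e x) D + (t - x) * weight (\<lambda>q. of_bool (on_edge e (\<lambda>u. u \<le> x) q)) D"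
      by (simp add: weight_fun_diff weight_fun_cmul)
    then show "F e t = F e x + (real_of_int (s e) - weight (\<lambda>q. of_bool (on_edge e (\<lambda>u. u \<le> x) q)) D) * (t - x)"
      by (simp add: F_def algebra_simps)
  qed
  have slope': "slope_on (\<lambda>t. \<psi> (edge_point \<Gamma> e t)) x y (real_of_int (s e) - weight (\<lambda>q. of_bool (on_edge e (\<lambda>u. u \<le> x) q)) D)"
    if e: "e \<in> edges \<Gamma>" and xy: "0 \<le> x" "x < y" "y \<le> len \<Gamma> e"
      and free: "\<And>u. Interior e u \<in> Poly_Mapping.keys D \<Longrightarrow> u \<le> x \<or> y \<le> u" for e x y
    unfolding slope_on_def
  proof
    fix t assume t: "t \<in> {x..y}"
    have "\<psi> (edge_point \<Gamma> e t) = F e t" "\<psi> (edge_point \<Gamma> e x) = F e x"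
      using \<psi>F[OF e] t xy by simp_all
    then show "\<psi> (edge_point \<Gamma> e t) = \<psi> (edge_point \<Gamma> e x) +
        (real_of_int (s e) - weight (\<lambda>q. of_bool (on_edge e (\<lambda>u. u \<le> x) q)) D) * (t - x)"
      using slope_onD[OF slope[OF free], where t = t] t by simp
  qed
  have incoming: "incoming (\<lambda>t. \<psi> (edge_point \<Gamma> e t)) 0 (len \<Gamma> e) t =
      (if 0 < t then real_of_int (s e) - weight (\<lambda>q. of_bool (on_edge e (\<lambda>u. u < t) q)) D else 0) -
      (if t < len \<Gamma> e then real_of_int (s e) - weight (\<lambda>q. of_bool (on_edge e (\<lambda>u. u \<le> t) q)) D else 0)"
    if e: "e \<in> edges \<Gamma>" and t: "t \<in> {0..len \<Gamma> e}" for e t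
  proof -
    define B where "B = {u. Interior e u \<in> Poly_Mapping.keys D}"
    have "finite B" unfolding B_def by (rule finite_inverse_image) (auto simp: inj_def)
    have l: "vector_derivative (\<lambda>t. \<psi> (edge_point \<Gamma> e t)) (at_left t) =
        real_of_int (s e) - weight (\<lambda>q. of_bool (on_edge e (\<lambda>u. u < t) q)) D" if t0: "0 < t"
    proof -
      obtain x where x: "0 \<le> x" "x < t" "{x<..<t} \<inter> B = {}"
        by (rule ex_free_interval_left[OF \<open>finite B\<close> t0]) (rule that)
      have *: "u \<le> x \<or> t \<le> u" if "Interior e u \<in> Poly_Mapping.keys D" for u
        using x(3) that by (force simp: B_def)
      have "weight (\<lambda>q. of_bool (on_edge e (\<lambda>u. u < t) q)) D = (weight (\<lambda>q. of_bool (on_edge e (\<lambda>u. u \<le> x) q)) D :: real)"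
      proof (rule weight_cong)
        show "of_bool (on_edge e (\<lambda>u. u < t) q) = (of_bool (on_edge e (\<lambda>u. u \<le> x) q) :: real)"
          if "q \<in> Poly_Mapping.keys D" for q
        proof (cases q)
          case (Interior e' u)
          then show ?thesis using that *[of u] x(2) by auto
        qed simp
      qed
      then show ?thesis
        using vector_derivative_at_left[OF x(2) slope'[OF e x(1,2) _ *]] t by simp
    qed
    have r: "vector_derivative (\<lambda>t. \<psi> (edge_point \<Gamma> e t)) (at_right t) =
        real_of_int (s e) - weight (\<lambda>q. of_bool (on_edge e (\<lambda>u. u \<le> t) q)) D" if tl: "t < len \<Gamma> e"
    proof -
      obtain y where y: "t < y" "y \<le> len \<Gamma> e" "{t<..<y} \<inter> B = {}"
        by (rule ex_free_interval_right[OF \<open>finite B\<close> tl]) (rule that)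
      have *: "u \<le> t \<or> y \<le> u" if "Interior e u \<in> Poly_Mapping.keys D" for u
        using y(3) that by (force simp: B_def)
      show ?thesis
        using vector_derivative_at_right[OF y(1) slope'[OF e _ y(1,2) *]] t by simp
    qed
    show ?thesis using l r by (simp add: incoming_def)
  qed
  have "piecewise_linear \<Gamma> \<psi>"
    unfolding piecewise_linear_def
  proof (intro conjI exI[of _ "Poly_Mapping.keys D"] ballI allI impI)
    show "continuous_map (graph_topology \<Gamma>) euclideanreal \<psi>"
    proof (rule continuous_map_graph_topology[OF edge_point_chain])
      fix e assume e: "e \<in> edges \<Gamma>"
      have "continuous_on {0..len \<Gamma> e} (\<lambda>t. ramp e t q)" for q
      proof (cases q)
        case (Interior e' u)
        then show ?thesis by (cases "e' = e") (auto intro!: continuous_intros)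
      qed simp
      then have "continuous_on {0..len \<Gamma> e} (F e)"
        unfolding F_def weight_def by (auto intro!: continuous_intros)
      then have "continuous_on {0..len \<Gamma> e} (\<lambda>t. \<psi> (edge_point \<Gamma> e t))"
        by (rule continuous_on_eq) (simp add: \<psi>F[OF e])
      then show "continuous_map (top_of_set {0..len \<Gamma> e}) euclideanreal (\<lambda>t. \<psi> (edge_point \<Gamma> e t))"
        by simp
    qed auto
  next
    fix e a b assume e: "e \<in> edges \<Gamma>"
      and ab: "0 \<le> a \<and> a < b \<and> b \<le> len \<Gamma> e \<and> edge_point \<Gamma> e ` {a<..<b} \<inter> Poly_Mapping.keys D = {}"
    have "u \<le> a \<or> b \<le> u" if u: "Interior e u \<in> Poly_Mapping.keys D" for u
    proof (rule ccontr)
      assume "\<not> ?thesis"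
      then have "edge_point \<Gamma> e u = Interior e u" "u \<in> {a<..<b}" using ab by (auto simp: edge_point_def)
      then have "Interior e u \<in> edge_point \<Gamma> e ` {a<..<b} \<inter> Poly_Mapping.keys D" using u by (metis IntI image_eqI)
      then show False using ab by simp
    qed
    then have "slope_on (\<lambda>t. \<psi> (edge_point \<Gamma> e t)) a b (real_of_int (s e) - weight (\<lambda>q. of_bool (on_edge e (\<lambda>u. u \<le> a) q)) D)"
      using ab e by (intro slope') auto
    also have "real_of_int (s e) - weight (\<lambda>q. of_bool (on_edge e (\<lambda>u. u \<le> a) q)) D =
        real_of_int (s e - weight (\<lambda>q. of_bool (on_edge e (\<lambda>u. u \<le> a) q)) D)"
      by (simp add: of_int_weight)
    finally show "\<exists>k::int. \<forall>t\<in>{a..b}. \<psi> (edge_point \<Gamma> e t) = \<psi> (edge_point \<Gamma> e a) + of_int k * (t - a)"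
      unfolding slope_on_def by (rule exI)
  qed (use keys in auto)
  moreover have "of_int (Poly_Mapping.lookup D p) = ord_at \<Gamma> \<psi> p" if p: "p \<in> points \<Gamma>" for p
  proof (cases p)
    case (Interior e u)
    then have e: "e \<in> edges \<Gamma>" and u: "0 < u" "u < len \<Gamma> e" using p by (auto simp: Interior_in_points)
    define X where "X e' = (\<Sum>t\<in>{t \<in> {0..len \<Gamma> e'}. edge_point \<Gamma> e' t = p}.
       incoming (\<lambda>s. \<psi> (edge_point \<Gamma> e' s)) 0 (len \<Gamma> e') t)" for e'
    have "{t \<in> {0..len \<Gamma> e'}. edge_point \<Gamma> e' t = p} = (if e' = e then {u} else {})" for e'
      using u Interior by (auto simp: edge_point_def split: if_splits)
    then have X: "X e' = (if e' = e then incoming (\<lambda>s. \<psi> (edge_point \<Gamma> e s)) 0 (len \<Gamma> e) u else 0)" for e'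
      by (simp add: X_def)
    have "ord_at \<Gamma> \<psi> p = (\<Sum>e'\<in>edges \<Gamma>. X e')" unfolding ord_at_incoming X_def ..
    also have "\<dots> = incoming (\<lambda>s. \<psi> (edge_point \<Gamma> e s)) 0 (len \<Gamma> e) u"
      unfolding X using e by (subst sum.delta) auto
    also have "\<dots> = weight (\<lambda>q. of_bool (on_edge e (\<lambda>v. v \<le> u) q) - of_bool (on_edge e (\<lambda>v. v < u) q)) D"
      using u incoming[OF e, of u] by (simp add: weight_fun_diff)
    also have "\<dots> = weight (\<lambda>q. of_bool (q = p)) D"
    proof (rule weight_cong)
      show "of_bool (on_edge e (\<lambda>v. v \<le> u) q) - of_bool (on_edge e (\<lambda>v. v < u) q) = (of_bool (q = p) :: real)" for q
        using Interior by (cases q) auto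
    qed
    finally show ?thesis by (simp add: weight_indicator)
  next
    case (Vertex i)
    then have i: "i \<le> g" using p by simp
    define X where "X e = (\<Sum>t\<in>{t \<in> {0..len \<Gamma> e}. edge_point \<Gamma> e t = p}.
       incoming (\<lambda>s. \<psi> (edge_point \<Gamma> e s)) 0 (len \<Gamma> e) t)" for e
    have X: "X e = real_of_int ((if loop_index e = Suc i then - s e else 0) + (if loop_index e = i then s e - N e else 0))"
      if e: "e \<in> edges \<Gamma>" for e
    proof -
      have l: "0 < len \<Gamma> e" using len_chain_pos[OF e] .
      have "weight (\<lambda>q. of_bool (on_edge e (\<lambda>u. u \<le> 0) q)) D = (weight (\<lambda>_. 0) D :: real)"
      proof (rule weight_cong)
        show "of_bool (on_edge e (\<lambda>u. u \<le> 0) q) = (0 :: real)" if "q \<in> Poly_Mapping.keys D" for q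
          using that keys by (cases q) (auto simp: Interior_in_points)
      qed
      then have start: "incoming (\<lambda>s. \<psi> (edge_point \<Gamma> e s)) 0 (len \<Gamma> e) 0 = - s e"
        using l incoming[OF e, of 0] by (simp add: weight_const)
      have "weight (\<lambda>q. of_bool (on_edge e (\<lambda>u. u < len \<Gamma> e) q)) D = (weight (\<lambda>q. of_bool (on_edge e (\<lambda>_. True) q)) D :: real)"
      proof (rule weight_cong)
        show "of_bool (on_edge e (\<lambda>u. u < len \<Gamma> e) q) = (of_bool (on_edge e (\<lambda>_. True) q) :: real)" if "q \<in> Poly_Mapping.keys D" for q
          using that keys by (cases q) (auto simp: Interior_in_points)
      qed
      then have "end": "incoming (\<lambda>s. \<psi> (edge_point \<Gamma> e s)) 0 (len \<Gamma> e) (len \<Gamma> e) = s e - N e"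
        using l incoming[OF e, of "len \<Gamma> e"] by (simp add: N_def of_int_weight)
      have "{t \<in> {0..len \<Gamma> e}. edge_point \<Gamma> e t = p} =
          (if loop_index e = Suc i then {0} else if loop_index e = i then {len \<Gamma> e} else {})"
        using l e Vertex by (auto simp: edge_point_def split: if_splits)
      then show ?thesis using start "end" by (simp add: X_def)
    qed
    \<comment> \<open>From loop \<open>i\<close> to the next, \<open>S\<close> changes by the chips
      inside loop \<open>i\<close> and at its right end, so the slopes meeting at that vertex add up
      to its coefficient.\<close>
    have SN: "S (Suc i) = S i - Poly_Mapping.lookup D (Vertex i) - N (Top i) - N (Bottom i)"
    proof -
      have "(weight (\<lambda>q. of_bool (left_of (Suc i) q)) D :: int) =
        weight (\<lambda>q. of_bool (left_of i q) + of_bool (q = Vertex i) + of_bool (on_edge (Top i) (\<lambda>_. True) q) +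
          of_bool (on_edge (Bottom i) (\<lambda>_. True) q)) D"
      proof (rule weight_cong)
        show "of_bool (left_of (Suc i) q) = of_bool (left_of i q) + of_bool (q = Vertex i) +
          of_bool (on_edge (Top i) (\<lambda>_. True) q) + (of_bool (on_edge (Bottom i) (\<lambda>_. True) q) :: int)" for q
        proof (cases q)
          case (Interior e u)
          then show ?thesis by (cases e) auto
        qed auto
      qed
      then show ?thesis by (simp add: S_def N_def weight_fun_add weight_indicator)
    qed
    \<comment> \<open>Together with \<open>S (Suc g) = 0\<close>, a consequence of degree 0, this
      extends the formula to the end vertices, where the loop on one side is missing.\<close>
    have S0: "S 0 = 0" "N (Top 0) = 0" "N (Bottom 0) = 0"
    proof -
      have "weight (\<lambda>q. of_bool (left_of 0 q)) D = (weight (\<lambda>_. 0) D :: int)"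
        by (rule weight_cong) (metis left_of.simps not_less0 of_bool_eq(1) point.exhaust)
      moreover have "weight (\<lambda>q. of_bool (on_edge e (\<lambda>_. True) q)) D = (weight (\<lambda>_. 0) D :: int)" if "loop_index e = 0" for e
      proof (rule weight_cong)
        show "of_bool (on_edge e (\<lambda>_. True) q) = (0::int)" if "q \<in> Poly_Mapping.keys D" for q
          using that keys \<open>loop_index e = 0\<close> by (cases q) (auto simp: Interior_in_points)
      qed
      ultimately show "S 0 = 0" "N (Top 0) = 0" "N (Bottom 0) = 0"
        by (simp_all add: S_def N_def weight_const)
    qed
    have Sg: "S (Suc g) = 0"
    proof -
      have "weight (\<lambda>q. of_bool (left_of (Suc g) q)) D = (weight (\<lambda>_. 1) D :: int)"
      proof (rule weight_cong)
        show "of_bool (left_of (Suc g) q) = (1::int)" if "q \<in> Poly_Mapping.keys D" for q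
          using that keys by (cases q) (auto simp: Interior_in_points)
      qed
      then show ?thesis using deg by (simp add: S_def weight_const)
    qed
    have "ord_at \<Gamma> \<psi> p = (\<Sum>e\<in>edges \<Gamma>. X e)" unfolding ord_at_incoming X_def ..
    also have "\<dots> = (\<Sum>j\<in>{1..g}. X (Top j) + X (Bottom j))" by (rule sum_edges_chain)
    also have "\<dots> = (\<Sum>j\<in>{1..g}. real_of_int ((if j = Suc i then - S (Suc i) else 0) +
        (if j = i then S i - N (Top i) - N (Bottom i) else 0)))"
      using X by (intro sum.cong) (auto simp: s_def)
    also have "\<dots> = real_of_int ((if Suc i \<le> g then - S (Suc i) else 0) + (if 1 \<le> i then S i - N (Top i) - N (Bottom i) else 0))"
      using i unfolding of_int_sum [symmetric] by (simp add: sum.distrib)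
    also have "\<dots> = of_int (Poly_Mapping.lookup D p)"
    proof -
      have "(if 1 \<le> i then S i - N (Top i) - N (Bottom i) else 0) = S i - N (Top i) - N (Bottom i)"
        using S0 by (cases i) auto
      moreover have "(if Suc i \<le> g then - S (Suc i) else 0) = - S (Suc i)"
        using Sg i by (cases "i = g") auto
      ultimately show ?thesis using SN Vertex by simp
    qed
    finally show ?thesis ..
  qed
  ultimately show ?thesis using D unfolding is_div_def by blast
qed

text \<open>The Abel-Jacobi theorem for the chain. From here on, equivalence is a computation with
  degrees and loop coordinates.\<close>

theorem lin_equiv_iff:
  "(D, E) \<in> lin_equiv \<Gamma> \<longleftrightarrow> D \<in> Div \<Gamma> \<and> E \<in> Div \<Gamma> \<and> deg D = deg E \<and> (\<forall>i\<in>{1..g}. loop_eq i (jac i D) (jac i E))"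
proof
  assume "(D, E) \<in> lin_equiv \<Gamma>"
  then obtain \<psi> where DE: "D \<in> Div \<Gamma>" "E \<in> Div \<Gamma>" "piecewise_linear \<Gamma> \<psi>" "is_div \<Gamma> \<psi> (D - E)"
    by (auto simp: lin_equiv_def)
  then show "D \<in> Div \<Gamma> \<and> E \<in> Div \<Gamma> \<and> deg D = deg E \<and> (\<forall>i\<in>{1..g}. loop_eq i (jac i D) (jac i E))"
    using jac_div[OF DE(3,4)] by (simp add: deg_diff weight_diff loop_eq_diff_0)
next
  assume *: "D \<in> Div \<Gamma> \<and> E \<in> Div \<Gamma> \<and> deg D = deg E \<and> (\<forall>i\<in>{1..g}. loop_eq i (jac i D) (jac i E))"
  then have "\<exists>\<psi>. piecewise_linear \<Gamma> \<psi> \<and> is_div \<Gamma> \<psi> (D - E)"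
    by (intro ex_div) (simp_all add: Div_diff deg_diff weight_diff loop_eq_diff_0)
  then show "(D, E) \<in> lin_equiv \<Gamma>" using * by (auto simp: lin_equiv_def)
qed

end

section \<open>Rank and lattice paths\<close>

context loop_chain begin

text \<open>Each chip at \<open>v_i\<close> or beyond has coordinate \<open>\<m> i\<close>. If
  \<open>t\<close> such chips already produce \<open>x\<close>, none has to stay; otherwise one is
  left on the loop, and its position absorbs the difference.\<close>

definition linger :: "nat \<Rightarrow> real \<Rightarrow> int \<Rightarrow> int" where
  "linger i x t = (if loop_eq i x (\<m> i * of_int t) then t else t - 1)"

lemma linger_cases: "linger i x t = t \<or> linger i x t = t - 1"
  by (simp add: linger_def)

lemma linger_ge: "t - 1 \<le> linger i x t"
  by (simp add: linger_def)

lemma linger_eq_iff: "linger i x t = t \<longleftrightarrow> loop_eq i x (\<m> i * of_int t)"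
  by (simp add: linger_def)

lemma linger_cong: "loop_eq i x y \<Longrightarrow> linger i x t = linger i y t"
  unfolding linger_def by (metis loop_eq_sym loop_eq_trans)

text \<open>The number of chips of a divisor of degree \<open>d\<close> with coordinates \<open>\<xi>\<close> that remain at \<open>v\<^sub>i\<close> or
  to its right when all chips travel to the right and each loop keeps at most one.\<close>

primrec chips :: "int \<Rightarrow> (nat \<Rightarrow> real) \<Rightarrow> nat \<Rightarrow> int" where
  "chips d \<xi> 0 = d"
| "chips d \<xi> (Suc i) = linger (Suc i) (\<xi> (Suc i)) (chips d \<xi> i)"

abbreviation chips_of :: "((nat, chain_edge) point \<Rightarrow>\<^sub>0 int) \<Rightarrow> nat \<Rightarrow> int" where
  "chips_of D \<equiv> chips (deg D) (\<lambda>i. jac i D)"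

lemma chips_cong:
  "(\<And>j. j \<in> {1..i} \<Longrightarrow> loop_eq j (\<xi> j) (\<xi>' j)) \<Longrightarrow> chips d \<xi> i = chips d \<xi>' i"
  by (induction i) (auto intro: linger_cong)

text \<open>This is the effect of removing a chip at \<open>v_i\<close> or further right: the
  thresholds of all loops up to \<open>i\<close> move along with the path.\<close>

lemma chips_shift:
  "(\<And>j. j \<in> {1..i} \<Longrightarrow> \<xi>' j = \<xi> j - \<m> j) \<Longrightarrow> chips (d - 1) \<xi>' i = chips d \<xi> i - 1"
proof (induction i)
  case (Suc i)
  have "linger j (x - \<m> j) (t - 1) = linger j x t - 1" for j x t
    using loop_eq_shift[of j x "\<m> j" "\<m> j * of_int t"] by (simp add: linger_def algebra_simps)
  then show ?case using Suc by simp
qed simp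

lemma sum_telescope_down:
  fixes c :: "nat \<Rightarrow> int"
  assumes "i \<le> k"
  shows "(\<Sum>j\<in>{Suc i..k}. c (j - 1) - c j) = c i - c k"
  using assms
proof (induction k)
  case (Suc k)
  then show ?case by (cases "i = Suc k") (auto simp: sum.nat_ivl_Suc')
qed simp

text \<open>A single chip moving around loop \<open>i\<close> takes every coordinate there, while
  for the other loops it only matters on which side it lies.\<close>

lemma ex_loop_point:
  assumes i: "i \<in> {1..g}"
  shows "\<exists>p\<in>points \<Gamma>. loop_eq i (loop_pos \<m> i p) x \<and>
    (\<forall>j\<ge>1. j \<noteq> i \<longrightarrow> loop_pos \<m> j p = (if i < j then 0 else \<m> j))"
proof -
  define L where "L = \<l> i + \<m> i"
  \<comment> \<open>The representative in one period: values up to \<open>\<m> i\<close> lie on the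
    bottom edge, the others on the top edge at parameter \<open>L - y\<close>, where the coordinate
    is \<open>y - L\<close>.\<close>
  define y where "y = x - of_int \<lfloor>x / L\<rfloor> * L"
  have pos: "0 < \<l> i" "0 < \<m> i" using top_pos bottom_pos i by auto
  then have L: "0 < L" by (simp add: L_def)
  have "y = L * frac (x / L)" using L by (simp add: y_def frac_def field_simps)
  then have y: "0 \<le> y" "y < L" using L frac_ge_0[of "x / L"] frac_lt_1[of "x / L"] by simp_all
  have yx: "loop_eq i y x" unfolding loop_eq_def
    by (intro exI[of _ "- \<lfloor>x / L\<rfloor>"]) (simp add: y_def L_def)
  show ?thesis
  proof (cases "y \<le> \<m> i")
    case True
    show ?thesis
    proof (intro bexI[of _ "edge_point \<Gamma> (Bottom i) y"] conjI allI impI)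
      show "edge_point \<Gamma> (Bottom i) y \<in> points \<Gamma>" using i y True by (intro edge_point_chain) auto
    qed (use i y True yx in \<open>auto simp: loop_pos_Bottom\<close>)
  next
    case False
    have "loop_eq i (y - L) x"
      using yx unfolding loop_eq_def by (elim exE, rule_tac x="n - 1" in exI) (simp add: L_def algebra_simps)
    show ?thesis
    proof (intro bexI[of _ "edge_point \<Gamma> (Top i) (L - y)"] conjI allI impI)
      show "edge_point \<Gamma> (Top i) (L - y) \<in> points \<Gamma>" using i y False L_def by (intro edge_point_chain) auto
      show "loop_eq i (loop_pos \<m> i (edge_point \<Gamma> (Top i) (L - y))) x"
        using i y False \<open>loop_eq i (y - L) x\<close> by (subst loop_pos_Top) (auto simp: L_def)
      show "loop_pos \<m> j (edge_point \<Gamma> (Top i) (L - y)) = (if i < j then 0 else \<m> j)" if "1 \<le> j" "j \<noteq> i" for j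
        using i y False that by (subst loop_pos_Top) (auto simp: L_def)
    qed
  qed
qed

section \<open>Chip counts of effective divisors\<close>

definition degree_upto :: "nat \<Rightarrow> ((nat, chain_edge) point \<Rightarrow>\<^sub>0 int) \<Rightarrow> int" where
  "degree_upto i E = weight (\<lambda>q. of_bool (left_of (Suc i) q)) E"

lemma left_of_mono: "i \<le> j \<Longrightarrow> left_of i q \<Longrightarrow> left_of j q"
  by (cases q) auto

lemma degree_upto_nonneg: "effective E \<Longrightarrow> 0 \<le> degree_upto i E"
  using weight_mono[of E "\<lambda>_. 0" "\<lambda>q. of_bool (left_of (Suc i) q) :: int"] by (simp add: degree_upto_def weight_const)

lemma degree_upto_Suc_mono: "effective E \<Longrightarrow> degree_upto i E \<le> degree_upto (Suc i) E"
  unfolding degree_upto_def by (rule weight_mono) (auto simp: left_of_mono[of "Suc i" "Suc (Suc i)"])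

lemma degree_upto_le_deg: "effective E \<Longrightarrow> degree_upto i E \<le> deg E"
  unfolding degree_upto_def deg_eq_weight by (rule weight_mono) auto

lemma degree_upto_g: "E \<in> Div \<Gamma> \<Longrightarrow> degree_upto g E = deg E"
  unfolding degree_upto_def deg_eq_weight
proof (rule weight_cong)
  fix q assume "E \<in> Div \<Gamma>" "q \<in> Poly_Mapping.keys E"
  then have "q \<in> points \<Gamma>" by (auto simp: Div_def)
  then show "of_bool (left_of (Suc g) q) = (1::int)" by (cases q) (auto simp: Interior_in_points)
qed

text \<open>Without cancellation, equal counts mean that no chip lies inside the loop or at its
  right end. Chips to the left have coordinate 0, chips to the right
  \<open>\<m> (Suc i)\<close>.\<close>

lemma jac_if_degree_upto_eq:
  assumes E: "effective E" and eq: "degree_upto (Suc i) E = degree_upto i E"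
  shows "jac (Suc i) E = \<m> (Suc i) * of_int (deg E - degree_upto i E)"
proof -
  have "(\<Sum>q\<in>Poly_Mapping.keys E. Poly_Mapping.lookup E q *
      (of_bool (left_of (Suc (Suc i)) q) - of_bool (left_of (Suc i) q))) = 0"
    using eq by (simp add: degree_upto_def weight_def ring_distribs sum_subtractf)
  then have 0: "\<forall>q\<in>Poly_Mapping.keys E. Poly_Mapping.lookup E q *
      (of_bool (left_of (Suc (Suc i)) q) - of_bool (left_of (Suc i) q)) = 0"
    using E left_of_mono[of "Suc i" "Suc (Suc i)"]
    by (subst (asm) sum_nonneg_eq_0_iff) (auto simp: effective_def intro!: mult_nonneg_nonneg)
  have "jac (Suc i) E = weight (\<lambda>q. \<m> (Suc i) * (1 - of_bool (left_of (Suc i) q))) E"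
  proof (rule weight_cong)
    fix q assume q: "q \<in> Poly_Mapping.keys E"
    then have "Poly_Mapping.lookup E q * (of_bool (left_of (Suc (Suc i)) q) - of_bool (left_of (Suc i) q)) = 0"
      using 0 by blast
    then have "left_of (Suc (Suc i)) q \<longleftrightarrow> left_of (Suc i) q" using q by (auto simp: in_keys_iff of_bool_def split: if_splits)
    then show "loop_pos \<m> (Suc i) q = \<m> (Suc i) * (1 - of_bool (left_of (Suc i) q))"
      by (cases q) (auto simp: less_Suc_eq)
  qed
  also have "\<dots> = \<m> (Suc i) * of_int (deg E - degree_upto i E)"
    unfolding weight_fun_cmul weight_fun_diff by (simp add: weight_const degree_upto_def of_int_weight)
  finally show ?thesis .
qed

text \<open>The travelling chips never fall behind those that \<open>E\<close> has to the right of
  \<open>v_i\<close>. A loss is matched by a chip of \<open>E\<close> on the loop or by slack; with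
  neither, the coordinate of \<open>E\<close> is just the one at which all chips pass.\<close>

lemma chips_of_effective:
  assumes "effective E"
  shows "deg E - degree_upto i E \<le> chips_of E i"
proof (induction i)
  case 0
  show ?case using degree_upto_nonneg[OF assms] by simp
next
  case (Suc i)
  show ?case
  proof (cases "degree_upto (Suc i) E = degree_upto i E")
    case False
    then show ?thesis
      using Suc degree_upto_Suc_mono[OF assms, of i] linger_ge[of "chips_of E i" "Suc i" "jac (Suc i) E"] by simp
  next
    case True
    show ?thesis
    proof (cases "chips_of E i = deg E - degree_upto i E")
      case True': True
      then have "linger (Suc i) (jac (Suc i) E) (chips_of E i) = chips_of E i"
        unfolding linger_eq_iff by (simp add: jac_if_degree_upto_eq[OF assms True])
      then show ?thesis using True True' by simp
    next
      case False
      then show ?thesis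
        using True Suc linger_ge[of "chips_of E i" "Suc i" "jac (Suc i) E"] by simp
    qed
  qed
qed

text \<open>Forwards, the path depends only on the class and dominates the count of an effective
  representative, which is 0 at the right end. Backwards, the path builds the representative: each
  lost chip stays on its loop, and the remaining ones end at \<open>v_g\<close>.\<close>

theorem equiv_effective_iff:
  assumes D: "D \<in> Div \<Gamma>"
  shows "equiv_effective \<Gamma> D \<longleftrightarrow> 0 \<le> chips_of D g"
proof
  assume "equiv_effective \<Gamma> D"
  then obtain E where E: "(D, E) \<in> lin_equiv \<Gamma>" "effective E" by (auto simp: equiv_effective_def)
  then have *: "E \<in> Div \<Gamma>" "deg D = deg E" "\<And>i. i \<in> {1..g} \<Longrightarrow> loop_eq i (jac i D) (jac i E)"
    by (auto simp: lin_equiv_iff)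
  have "chips_of D g = chips_of E g" unfolding *(2) by (rule chips_cong) (use *(3) in auto)
  then show "0 \<le> chips_of D g" using chips_of_effective[OF E(2), of g] degree_upto_g[OF *(1)] by simp
next
  assume nonneg: "0 \<le> chips_of D g"
  define c where "c = chips_of D"
  have step: "c i = linger i (jac i D) (c (i - 1))" if "i \<in> {1..g}" for i
    using that by (cases i) (auto simp: c_def)
  \<comment> \<open>The \<open>c i\<close> chips at \<open>v_i\<close> or beyond contribute
    \<open>\<m> i\<close> each; a chip kept on the loop has to supply the rest.\<close>
  have "\<forall>i\<in>{1..g}. \<exists>p\<in>points \<Gamma>. loop_eq i (loop_pos \<m> i p) (jac i D - \<m> i * of_int (c i)) \<and>
    (\<forall>j\<ge>1. j \<noteq> i \<longrightarrow> loop_pos \<m> j p = (if i < j then 0 else \<m> j))"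
    using ex_loop_point by blast
  then obtain p where p: "\<And>i. i \<in> {1..g} \<Longrightarrow> p i \<in> points \<Gamma>"
    "\<And>i. i \<in> {1..g} \<Longrightarrow> loop_eq i (loop_pos \<m> i (p i)) (jac i D - \<m> i * of_int (c i))"
    "\<And>i j. i \<in> {1..g} \<Longrightarrow> 1 \<le> j \<Longrightarrow> j \<noteq> i \<Longrightarrow> loop_pos \<m> j (p i) = (if i < j then 0 else \<m> j)"
    by (metis (no_types, lifting))
  define E where "E = frag_cmul (c g) (frag_of (Vertex g)) + (\<Sum>j\<in>{1..g}. frag_cmul (c (j - 1) - c j) (frag_of (p j)))"
  have c1: "c (j - 1) - c j = 0 \<or> c (j - 1) - c j = 1" if "j \<in> {1..g}" for j
    using step[OF that] linger_cases[of j "jac j D" "c (j - 1)"] by auto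
  have "effective E" unfolding E_def
  proof (intro effective_add effective_sum effective_cmul effective_frag_of)
    show "0 \<le> c (j - 1) - c j" if "j \<in> {1..g}" for j using c1[OF that] by linarith
  qed (use nonneg in \<open>simp add: c_def\<close>)
  moreover have "(D, E) \<in> lin_equiv \<Gamma>"
    unfolding lin_equiv_iff
  proof (intro conjI ballI D)
    show "E \<in> Div \<Gamma>" unfolding E_def using p(1) by (intro Div_add Div_sum Div_cmul Div_frag_of) auto
    show "deg D = deg E"
      using sum_telescope_down[of 0 g c] by (simp add: E_def deg_add deg_sum deg_cmul c_def)
  next
    fix i assume i: "i \<in> {1..g}"
    define \<delta> where "\<delta> j = real_of_int (c (j - 1) - c j)" for j
    have "jac i E = of_int (c g) * \<m> i + (\<Sum>j\<in>{1..g}. \<delta> j * loop_pos \<m> i (p j))"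
      using i by (simp add: E_def weight_add weight_sum weight_cmul \<delta>_def)
    also have "(\<Sum>j\<in>{1..g}. \<delta> j * loop_pos \<m> i (p j)) =
        (\<Sum>j\<in>{1..<i}. \<delta> j * loop_pos \<m> i (p j)) + \<delta> i * loop_pos \<m> i (p i) + (\<Sum>j\<in>{Suc i..g}. \<delta> j * loop_pos \<m> i (p j))"
    proof -
      have "{1..g} = {1..<i} \<union> insert i {Suc i..g}" using i by auto
      moreover have "{1..<i} \<inter> {Suc i..g} = {}" by auto
      ultimately show ?thesis by (simp add: sum.union_disjoint)
    qed
    also have "(\<Sum>j\<in>{1..<i}. \<delta> j * loop_pos \<m> i (p j)) = 0"
      using i p(3) by (intro sum.neutral) auto
    also have "(\<Sum>j\<in>{Suc i..g}. \<delta> j * loop_pos \<m> i (p j)) = (\<Sum>j\<in>{Suc i..g}. \<delta> j) * \<m> i"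
      unfolding sum_distrib_right using i p(3) by (intro sum.cong) auto
    also have "(\<Sum>j\<in>{Suc i..g}. \<delta> j) = of_int (c i - c g)"
      unfolding \<delta>_def of_int_sum [symmetric] using i by (subst sum_telescope_down) auto
    finally have jac: "jac i E = \<m> i * of_int (c i) + \<delta> i * loop_pos \<m> i (p i)" by (simp add: algebra_simps)
    show "loop_eq i (jac i D) (jac i E)"
    proof (cases "\<delta> i = 0")
      case True
      then have "linger i (jac i D) (c (i - 1)) = c (i - 1)" "c (i - 1) = c i"
        using step[OF i] by (simp_all add: \<delta>_def)
      then show ?thesis unfolding linger_eq_iff by (simp add: jac True)
    next
      case False
      then have "\<delta> i = 1" using c1[OF i] by (auto simp: \<delta>_def)
      then show ?thesis using p(2)[OF i] loop_eq_shift[of i "jac i D" "\<m> i * of_int (c i)" "jac i E - 0"]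
        by (simp add: jac) (metis add_diff_cancel_left' loop_eq_shift loop_eq_sym)
    qed
  qed
  ultimately show "equiv_effective \<Gamma> D" by (auto simp: equiv_effective_def)
qed

lemma equiv_effective_deg_nonneg: "equiv_effective \<Gamma> D \<Longrightarrow> 0 \<le> deg D"
  by (auto simp: equiv_effective_def lin_equiv_iff dest: effective_deg_nonneg)

lemma equiv_effective_add:
  assumes "equiv_effective \<Gamma> D" "E \<in> Div \<Gamma>" "effective E"
  shows "equiv_effective \<Gamma> (D + E)"
proof -
  obtain F where F: "(D, F) \<in> lin_equiv \<Gamma>" "effective F" using assms by (auto simp: equiv_effective_def)
  have "loop_eq i (x + z) (y + z)" if "loop_eq i x y" for i x y z
    using that by (simp add: loop_eq_def)
  then have "(D + E, F + E) \<in> lin_equiv \<Gamma>"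
    using F(1) assms(2) by (auto simp: lin_equiv_iff Div_add deg_add weight_add)
  then show ?thesis using F assms effective_add by (auto simp: equiv_effective_def)
qed

lemma effective_deg_0: "effective E \<Longrightarrow> deg E = 0 \<Longrightarrow> E = 0"
  unfolding deg_def effective_def
  by (subst (asm) sum_nonneg_eq_0_iff) (auto simp: in_keys_iff intro!: poly_mapping_eqI)

text \<open>Removability of \<open>r\<close> chips passes to smaller \<open>r\<close>, by returning
  chips at \<open>v_0\<close>, and is bounded by the degree, so the greatest \<open>r\<close>
  behaves as a maximum. For \<open>r = 0\<close> it is effectivity of the class, which accounts for
  the value -1.\<close>

theorem rank_ge_iff:
  assumes D: "D \<in> Div \<Gamma>"
  shows "int r \<le> rank \<Gamma> D \<longleftrightarrow>
    (\<forall>E\<in>Div \<Gamma>. effective E \<and> deg E = int r \<longrightarrow> equiv_effective \<Gamma> (D - E))"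
proof -
  define P where "P r \<longleftrightarrow> (\<forall>E\<in>Div \<Gamma>. effective E \<and> deg E = int r \<longrightarrow> equiv_effective \<Gamma> (D - E))" for r :: nat
  have v: "frag_of (Vertex 0) \<in> Div \<Gamma>" by (intro Div_frag_of) simp
  have down: "P r" if "P (Suc r)" for r
    unfolding P_def
  proof (intro ballI impI)
    fix E assume E: "E \<in> Div \<Gamma>" "effective E \<and> deg E = int r"
    let ?v = "frag_of (Vertex 0) :: (nat, chain_edge) point \<Rightarrow>\<^sub>0 int"
    have "equiv_effective \<Gamma> (D - (E + ?v))"
      using that E v by (auto simp: P_def Div_add effective_add effective_frag_of deg_add)
    then have "equiv_effective \<Gamma> (D - (E + ?v) + ?v)" by (rule equiv_effective_add[OF _ v effective_frag_of])
    then show "equiv_effective \<Gamma> (D - E)" by (simp add: algebra_simps)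
  qed
  have P_mono: "P r" if "P s" "r \<le> s" for r s
    using that(2,1) by (induction rule: inc_induct) (auto intro: down)
  have P0: "P 0 \<longleftrightarrow> equiv_effective \<Gamma> D"
    using effective_deg_0 deg_zero Div_zero effective_zero unfolding P_def by (metis diff_zero of_nat_0)
  have bound: "r \<le> nat (deg D)" if "P r" for r
  proof -
    have "equiv_effective \<Gamma> (D - frag_cmul (int r) (frag_of (Vertex 0)))"
      using that v unfolding P_def by (auto simp: Div_cmul deg_cmul effective_cmul effective_frag_of)
    then show ?thesis using equiv_effective_deg_nonneg by (fastforce simp: deg_diff deg_cmul)
  qed
  have "int r \<le> rank \<Gamma> D \<longleftrightarrow> P r"
  proof (cases "equiv_effective \<Gamma> D")
    case True
    then have R: "rank \<Gamma> D = int (GREATEST r. P r)" by (simp add: rank_def P_def)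
    have PR: "P (GREATEST r. P r)" using GreatestI_nat[of P 0] P0 True bound by blast
    have "r \<le> (GREATEST r. P r)" if "P r" by (rule Greatest_le_nat[of P, OF that bound])
    then show ?thesis unfolding R of_nat_le_iff using P_mono[OF PR] by blast
  next
    case False
    then show ?thesis using P_mono[of r 0] P0 by (auto simp: rank_def)
  qed
  then show ?thesis by (simp add: P_def)
qed

text \<open>If two chip numbers pass, \<open>\<m> i * (t - s)\<close> is \<open>n\<close> full
  turns, hence \<open>\<l> i / \<m> i = (t - s - n) / n\<close>, a ratio of positive integers with
  sum \<open>t - s\<close>.\<close>

lemma generic_linger_unique:
  assumes gen: "generic_lengths g \<l> \<m>" and i: "i \<in> {1..g}" and t: "0 \<le> s" "s < t" "t \<le> 2 * int g - 2"
    and "linger i x s = s" "linger i x t = t"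
  shows False
proof -
  have pos: "0 < \<l> i" "0 < \<m> i" using top_pos bottom_pos i by auto
  have "loop_eq i (\<m> i * of_int t) (\<m> i * of_int s)"
    using assms(6,7) unfolding linger_eq_iff by (metis loop_eq_sym loop_eq_trans)
  then obtain n :: int where n: "\<m> i * of_int t - \<m> i * of_int s = of_int n * (\<l> i + \<m> i)"
    unfolding loop_eq_def by blast
  then have eq: "\<m> i * of_int (t - s - n) = of_int n * \<l> i" by (simp add: algebra_simps)
  have "0 < \<m> i * of_int (t - s)" using pos t by simp
  then have "0 < of_int n * (\<l> i + \<m> i)" using n by (simp add: algebra_simps)
  then have "0 < n" using pos by (simp add: zero_less_mult_iff)
  moreover have "0 < t - s - n"
  proof -
    have "0 < \<m> i * of_int (t - s - n)" unfolding eq using pos \<open>0 < n\<close> by simp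
    then have "0 < real_of_int (t - s - n)" using pos by (simp only: zero_less_mult_iff) linarith
    then show ?thesis by linarith
  qed
  moreover have "\<l> i / \<m> i = of_int (t - s - n) / of_int n" using eq pos \<open>0 < n\<close> by (simp add: field_simps)
  moreover have "(t - s - n) + n \<le> 2 * int g - 2" using t by simp
  ultimately show False using gen i unfolding generic_lengths_def by blast
qed

text \<open>The moves of the adversary are realized by effective divisors supported on the vertices.\<close>

lemma adversary_nonneg:
  assumes D: "D \<in> Div \<Gamma>" and rank: "int r \<le> rank \<Gamma> D"
  shows "0 \<le> adversary (\<lambda>i. linger i (jac i D)) (deg D) g r"
proof -
  let ?\<sigma> = "\<lambda>i. linger i (jac i D)"
  \<comment> \<open>The support condition keeps the removed chips at or to the left of
    \<open>v_i\<close>, where they do not affect the coordinate of the next loop.\<close>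
  define Q where "Q i k E \<longleftrightarrow> E \<in> Div \<Gamma> \<and> effective E \<and> deg E = int k \<and> Poly_Mapping.keys E \<subseteq> Vertex ` {0..i}
    \<and> chips_of (D - E) i = adversary ?\<sigma> (deg D) i k" for i k E
  have ext: "chips_of (D - E) (Suc i) = adversary ?\<sigma> (deg D) (Suc i) k \<Longrightarrow> Q (Suc i) k E"
    if "Q i k E" for i k E
    using that by (auto simp: Q_def)
  have next_: "chips_of (D - E) (Suc i) = ?\<sigma> (Suc i) (adversary ?\<sigma> (deg D) i k)" if E: "Q i k E" for i k E
  proof -
    have "jac (Suc i) E = weight (\<lambda>_. 0) E"
      by (rule weight_cong) (use E in \<open>auto simp: Q_def\<close>)
    then show ?thesis using E by (simp add: Q_def weight_diff weight_const)
  qed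
  have "\<exists>E. Q i k E" if "i \<le> g" for i k
    using that
  proof (induction i arbitrary: k)
    case 0
    show ?case
      by (rule exI[of _ "frag_cmul (int k) (frag_of (Vertex 0))"])
        (auto simp: Q_def deg_cmul deg_diff effective_cmul effective_frag_of intro!: Div_cmul Div_frag_of)
  next
    case (Suc i)
    show ?case
    proof (induction k)
      case 0
      obtain E where E: "Q i 0 E" using Suc by auto
      then show ?case using ext[OF E] next_[OF E] by (intro exI[of _ E]) simp
    next
      case (Suc k)
      show ?case
      \<comment> \<open>Either branch of the minimum is a strategy: finish the removals before the
        loop, or take the last chip at its right end.\<close>
      proof (cases "?\<sigma> (Suc i) (adversary ?\<sigma> (deg D) i (Suc k)) \<le> adversary ?\<sigma> (deg D) (Suc i) k - 1")
        case True
        obtain E where E: "Q i (Suc k) E" using Suc.prems \<open>Suc i \<le> g\<close> \<open>\<And>k. i \<le> g \<Longrightarrow> \<exists>E. Q i k E\<close> by auto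
        then show ?thesis using ext[OF E] next_[OF E] True by (intro exI[of _ E]) simp
      next
        case False
        obtain E where E: "Q (Suc i) k E" using Suc by blast
        let ?v = "frag_of (Vertex (Suc i)) :: (nat, chain_edge) point \<Rightarrow>\<^sub>0 int"
        have v: "?v \<in> Div \<Gamma>" using \<open>Suc i \<le> g\<close> by (intro Div_frag_of) simp
        have "chips_of (D - (E + ?v)) (Suc i) = chips (deg (D - E) - 1) (\<lambda>i. jac i (D - (E + ?v))) (Suc i)"
          by (simp add: deg_diff deg_add algebra_simps)
        also have "\<dots> = chips_of (D - E) (Suc i) - 1"
          by (rule chips_shift) (auto simp: weight_diff weight_add)
        also have "\<dots> = adversary ?\<sigma> (deg D) (Suc i) (Suc k)" using E False by (simp add: Q_def)
        finally have "Q (Suc i) (Suc k) (E + ?v)"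
          using E v keys_add[of E ?v] by (auto simp: Q_def Div_add effective_add effective_frag_of deg_add)
        then show ?thesis by blast
      qed
    qed
  qed
  then obtain E where E: "Q g r E" by blast
  then have "equiv_effective \<Gamma> (D - E)" using rank by (auto simp: rank_ge_iff[OF D] Q_def)
  then show ?thesis using E D by (simp add: equiv_effective_iff Div_diff Q_def)
qed

theorem card_special_coordinates_ge:
  assumes D: "D \<in> Div \<Gamma>" and rank: "int r \<le> rank \<Gamma> D" and gen: "generic_lengths g \<l> \<m>"
    and d: "deg D \<le> 2 * int g - 2" and n: "int n \<le> int g - deg D + int r"
  shows "(r + 1) * n \<le> card {i \<in> {1..g}. \<exists>t\<in>{0..deg D}. loop_eq i (jac i D) (\<m> i * of_int t)}"
proof -
  have "(r + 1) * n \<le> card {i \<in> {1..g}. \<exists>t. 0 \<le> t \<and> t \<le> deg D \<and> linger i (jac i D) t = t}"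
    by (rule card_lingering_ge[OF linger_cases _ adversary_nonneg[OF D rank] n])
      (use generic_linger_unique[OF gen] d in force)
  also have "{i \<in> {1..g}. \<exists>t. 0 \<le> t \<and> t \<le> deg D \<and> linger i (jac i D) t = t} =
      {i \<in> {1..g}. \<exists>t\<in>{0..deg D}. loop_eq i (jac i D) (\<m> i * of_int t)}"
    by (auto simp: linger_eq_iff)
  finally show ?thesis .
qed

text \<open>Against an arbitrary \<open>E\<close>, the path to compare with at loop \<open>i\<close>
  is the one numbered by the chips of \<open>E\<close> met so far; the chips still travelling never
  fall below it.\<close>

theorem rank_ge_if_tableau:
  assumes D: "D \<in> Div \<Gamma>" and n: "(r + 1) * n \<le> g" "int g - deg D + int r \<le> int n"
    and tab: "\<And>i. i < (r + 1) * n \<Longrightarrow>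
      loop_eq (Suc i) (jac (Suc i) D) (\<m> (Suc i) * of_int (tableau_path r n (deg D) i (i mod (r + 1))))"
  shows "int r \<le> rank \<Gamma> D"
  unfolding rank_ge_iff[OF D]
proof (intro ballI impI)
  fix E assume E: "E \<in> Div \<Gamma>" "effective E \<and> deg E = int r"
  then have eff: "effective E" and degE: "deg E = int r" by auto
  let ?p = "tableau_path r n (deg D)"
  define a where "a i = nat (degree_upto i E)" for i
  have a: "int (a i) = degree_upto i E" "a i \<le> r" for i
    using degree_upto_nonneg[OF eff, of i] degree_upto_le_deg[OF eff, of i] degE by (auto simp: a_def)
  \<comment> \<open>\<open>D - E\<close> is charged for all of \<open>E\<close> from the start; the
    chips of \<open>E\<close> beyond \<open>v_i\<close> are credited back.\<close>
  define t where "t i = chips_of (D - E) i + int r - int (a i)" for i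
  have "?p i (a i) \<le> t i" for i
  proof (induction i)
    case 0
    show ?case using degE by (simp add: t_def tableau_path_0 deg_diff)
  next
    case (Suc i)
    define b where "b = a (Suc i) - a i"
    have b: "a (Suc i) = a i + b" using degree_upto_Suc_mono[OF eff, of i] a(1)[of i] a(1)[of "Suc i"] by (auto simp: b_def)
    have t_ge: "t i - 1 - int b \<le> t (Suc i)"
      using linger_ge[of "chips_of (D - E) i" "Suc i" "jac (Suc i) (D - E)"] b by (simp add: t_def)
    have ps: "?p (Suc i) (a (Suc i)) = (if i < (r + 1) * n \<and> a (Suc i) = i mod (r + 1) then ?p i (a (Suc i)) else ?p i (a (Suc i)) - 1)"
      by (rule tableau_path_Suc[OF a(2)])
    have ps': "?p (Suc i) (a i) = (if i < (r + 1) * n \<and> a i = i mod (r + 1) then ?p i (a i) else ?p i (a i) - 1)"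
      by (rule tableau_path_Suc[OF a(2)])
    show ?case
    proof (cases "b = 0")
      case False
      \<comment> \<open>At most one of the paths \<open>a i\<close> and \<open>a (Suc i)\<close>
        keeps its value here, so the change is read off along the other: a loop with chips of
        \<open>E\<close> costs the path one more than their number.\<close>
      have "?p (Suc i) (a (Suc i)) \<le> ?p i (a i) - int b - 1"
      proof (cases "i < (r + 1) * n \<and> a (Suc i) = i mod (r + 1)")
        case True
        then have "?p (Suc i) (a i) = ?p i (a i) - 1" using ps' b False by auto
        then show ?thesis using tableau_path_antimono[of "a i" "a (Suc i)" r n "deg D" "Suc i"] b by simp
      next
        case False
        then show ?thesis using ps tableau_path_antimono[of "a i" "a (Suc i)" r n "deg D" i] b by auto
      qed
      then show ?thesis using t_ge Suc by linarith
    next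
      case True
      then have aeq: "a (Suc i) = a i" using b by simp
      show ?thesis
      proof (cases "i < (r + 1) * n \<and> a i = i mod (r + 1) \<and> t i = ?p i (a i)")
        case False
        then show ?thesis using t_ge Suc ps' aeq True by (auto split: if_splits)
      next
        case lingers: True
        \<comment> \<open>In the tight case the prescribed coordinate of \<open>D\<close>, less that
          of \<open>E\<close>, is exactly the one at which all current chips pass.\<close>
        have "degree_upto (Suc i) E = degree_upto i E" using a(1)[of i] a(1)[of "Suc i"] aeq by simp
        then have "jac (Suc i) E = \<m> (Suc i) * of_int (int r - int (a i))"
          using jac_if_degree_upto_eq[OF eff] degE a(1)[of i] by simp
        moreover have "chips_of (D - E) i = ?p i (a i) - (int r - int (a i))"
          using lingers unfolding t_def by linarith
        ultimately have "\<m> (Suc i) * of_int (chips_of (D - E) i) = \<m> (Suc i) * of_int (?p i (a i)) - jac (Suc i) E"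
          by (simp only: of_int_diff right_diff_distrib)
        moreover have "loop_eq (Suc i) (jac (Suc i) D) (\<m> (Suc i) * of_int (?p i (a i)))"
          using tab[of i] lingers by metis
        ultimately have "loop_eq (Suc i) (jac (Suc i) (D - E)) (\<m> (Suc i) * of_int (chips_of (D - E) i))"
          by (simp only: loop_eq_shift weight_diff)
        then have "chips_of (D - E) (Suc i) = chips_of (D - E) i" by (simp add: linger_def)
        then have "t (Suc i) = t i" unfolding t_def aeq by (simp only:)
        moreover have "?p (Suc i) (a (Suc i)) = ?p i (a i)" unfolding aeq using ps' lingers by metis
        ultimately show ?thesis using lingers by linarith
      qed
    qed
  qed
  then have "?p g (a g) \<le> t g" .
  moreover have "a g = r" using degree_upto_g[OF E(1)] degE by (simp add: a_def)
  ultimately have "0 \<le> chips_of (D - E) g" using tableau_path_end[OF n] by (simp add: t_def)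
  then show "equiv_effective \<Gamma> (D - E)" using D E by (simp add: equiv_effective_iff Div_diff)
qed

end

section \<open>The Picard torus\<close>

context loop_chain begin

definition circle_map :: "nat \<Rightarrow> real \<Rightarrow> complex" where
  "circle_map i x = cis (2 * pi * x / (\<l> i + \<m> i))"

lemma circle_map_eq_iff:
  assumes "i \<in> {1..g}"
  shows "circle_map i x = circle_map i y \<longleftrightarrow> loop_eq i x y"
proof -
  have L: "0 < \<l> i + \<m> i" using top_pos[OF assms] bottom_pos[OF assms] by simp
  have "circle_map i x = circle_map i y \<longleftrightarrow>
      (\<exists>n::int. 2 * pi * x / (\<l> i + \<m> i) = 2 * pi * y / (\<l> i + \<m> i) + 2 * pi * n)"
    unfolding circle_map_def complex_eq_iff cis.sel using sin_cos_eq_iff by (simp add: conj_commute)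
  also have "\<dots> \<longleftrightarrow> (\<exists>n::int. x - y = of_int n * (\<l> i + \<m> i))"
  proof (intro ex_cong1)
    fix n :: int
    have "2 * pi * x / (\<l> i + \<m> i) = 2 * pi * y / (\<l> i + \<m> i) + 2 * pi * n \<longleftrightarrow>
        2 * pi * (x - y) = 2 * pi * (n * (\<l> i + \<m> i))"
      using L by (simp add: field_simps)
    then show "2 * pi * x / (\<l> i + \<m> i) = 2 * pi * y / (\<l> i + \<m> i) + 2 * pi * n \<longleftrightarrow> x - y = of_int n * (\<l> i + \<m> i)"
      by (simp only: mult_cancel_left) simp
  qed
  finally show ?thesis by (simp add: loop_eq_def)
qed

lemma circle_map_add: "circle_map i (x + y) = circle_map i x * circle_map i y"
  by (simp add: circle_map_def cis_mult ring_distribs add_divide_distrib)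

lemma circle_map_sum: "circle_map i (\<Sum>j\<in>J. x j) = (\<Prod>j\<in>J. circle_map i (x j))"
  by (induction J rule: infinite_finite_induct) (simp_all add: circle_map_add, simp_all add: circle_map_def)

definition abel_jacobi :: "((nat, chain_edge) point \<Rightarrow>\<^sub>0 int) \<Rightarrow> nat \<Rightarrow> complex" where
  "abel_jacobi D i = (if i \<in> {1..g} then circle_map i (jac i D) else 0)"

lemma lin_equiv_iff_abel_jacobi:
  "(D, E) \<in> lin_equiv \<Gamma> \<longleftrightarrow> D \<in> Div \<Gamma> \<and> E \<in> Div \<Gamma> \<and> deg D = deg E \<and> abel_jacobi D = abel_jacobi E"
proof -
  have "(\<forall>i\<in>{1..g}. loop_eq i (jac i D) (jac i E)) \<longleftrightarrow> abel_jacobi D = abel_jacobi E"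
    unfolding abel_jacobi_def fun_eq_iff by (simp add: circle_map_eq_iff Ball_def) blast
  then show ?thesis by (simp only: lin_equiv_iff)
qed

lemma lin_equiv_Image:
  "D \<in> Div \<Gamma> \<Longrightarrow> lin_equiv \<Gamma> `` {D} = {E \<in> Div \<Gamma>. deg E = deg D \<and> abel_jacobi E = abel_jacobi D}"
  by (auto simp: lin_equiv_iff_abel_jacobi)

definition class_map :: "((nat, chain_edge) point \<Rightarrow>\<^sub>0 int) set \<Rightarrow> nat \<Rightarrow> complex" where
  "class_map c = the_elem (abel_jacobi ` c)"

lemma class_map_lin_equiv:
  assumes "D \<in> Div \<Gamma>"
  shows "class_map (lin_equiv \<Gamma> `` {D}) = abel_jacobi D"
proof -
  have "abel_jacobi ` (lin_equiv \<Gamma> `` {D}) = {abel_jacobi D}"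
    using assms unfolding lin_equiv_Image[OF assms] by auto
  then show ?thesis by (simp add: class_map_def)
qed

lemma Pic_eq: "Pic \<Gamma> d = {lin_equiv \<Gamma> `` {D} | D. D \<in> Div \<Gamma> \<and> deg D = d}"
  unfolding Pic_def quotient_def by blast

definition sum_divisor :: "int \<Rightarrow> (nat \<Rightarrow> (nat, chain_edge) point) \<Rightarrow> (nat, chain_edge) point \<Rightarrow>\<^sub>0 int" where
  "sum_divisor d w = (\<Sum>i\<in>{1..g}. frag_of (w i)) + frag_cmul (d - int g) (frag_of (Vertex 0))"

lemma sum_divisor:
  assumes "\<And>i. i \<in> {1..g} \<Longrightarrow> w i \<in> points \<Gamma>"
  shows "sum_divisor d w \<in> Div \<Gamma>" "deg (sum_divisor d w) = d"
  using assms unfolding sum_divisor_def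
  by (auto simp: deg_add deg_sum deg_cmul intro!: Div_add Div_sum Div_cmul Div_frag_of)

lemma jac_sum_divisor:
  "i \<in> {1..g} \<Longrightarrow> jac i (sum_divisor d w) = (\<Sum>j\<in>{1..g}. loop_pos \<m> i (w j))"
  by (simp add: sum_divisor_def weight_add weight_sum weight_cmul)

text \<open>Jacobi inversion with one chip per loop: chips on other loops contribute fixed amounts,
  so each coordinate is adjusted by its own chip.\<close>

lemma ex_sum_divisor:
  "\<exists>w. (\<forall>i\<in>{1..g}. w i \<in> points \<Gamma>) \<and> (\<forall>i\<in>{1..g}. loop_eq i (jac i (sum_divisor d w)) (\<xi> i))"
proof -
  \<comment> \<open>The \<open>g - i\<close> points on later loops contribute \<open>\<m> i\<close>
    each, those on earlier loops and the base point 0.\<close>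
  have "\<forall>i\<in>{1..g}. \<exists>p\<in>points \<Gamma>. loop_eq i (loop_pos \<m> i p) (\<xi> i - \<m> i * real (g - i)) \<and>
    (\<forall>j\<ge>1. j \<noteq> i \<longrightarrow> loop_pos \<m> j p = (if i < j then 0 else \<m> j))"
    using ex_loop_point by blast
  then obtain w where w: "\<And>i. i \<in> {1..g} \<Longrightarrow> w i \<in> points \<Gamma>"
    "\<And>i. i \<in> {1..g} \<Longrightarrow> loop_eq i (loop_pos \<m> i (w i)) (\<xi> i - \<m> i * real (g - i))"
    "\<And>i j. i \<in> {1..g} \<Longrightarrow> 1 \<le> j \<Longrightarrow> j \<noteq> i \<Longrightarrow> loop_pos \<m> j (w i) = (if i < j then 0 else \<m> j)"
    by (metis (no_types, lifting))
  have "loop_eq i (jac i (sum_divisor d w)) (\<xi> i)" if i: "i \<in> {1..g}" for i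
  proof -
    have "{1..g} = {1..<i} \<union> insert i {Suc i..g}" "{1..<i} \<inter> {Suc i..g} = {}" using i by auto
    then have "jac i (sum_divisor d w) =
        (\<Sum>j\<in>{1..<i}. loop_pos \<m> i (w j)) + loop_pos \<m> i (w i) + (\<Sum>j\<in>{Suc i..g}. loop_pos \<m> i (w j))"
      using i by (simp add: jac_sum_divisor sum.union_disjoint)
    also have "(\<Sum>j\<in>{1..<i}. loop_pos \<m> i (w j)) = 0" using i w(3) by (intro sum.neutral) auto
    also have "(\<Sum>j\<in>{Suc i..g}. loop_pos \<m> i (w j)) = (\<Sum>j\<in>{Suc i..g}. \<m> i)" using i w(3) by (intro sum.cong) auto
    finally have "jac i (sum_divisor d w) - \<m> i * real (g - i) = loop_pos \<m> i (w i)" by simp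
    then show ?thesis using w(2)[OF i] loop_eq_shift by metis
  qed
  then show ?thesis using w(1) by blast
qed

lemma ex_divisor_with_coordinates:
  "\<exists>D\<in>Div \<Gamma>. deg D = d \<and> (\<forall>i\<in>{1..g}. loop_eq i (jac i D) (\<xi> i))"
  using ex_sum_divisor[of d \<xi>] sum_divisor by blast

text \<open>The coordinate jumps only at the right end of the top edge, by a full turn, which
  \<open>circle_map\<close> does not see.\<close>

lemma continuous_map_circle_loop_pos:
  assumes i: "i \<in> {1..g}"
  shows "continuous_map (graph_topology \<Gamma>) euclidean (\<lambda>p. circle_map i (loop_pos \<m> i p))"
proof (rule continuous_map_graph_topology[OF edge_point_chain])
  fix e assume e: "e \<in> edges \<Gamma>"
  define h where "h t = (if loop_index e < i then 0 else if loop_index e = i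
      then (case e of Top _ \<Rightarrow> - t | Bottom _ \<Rightarrow> t) else \<m> i)" for t
  have h: "continuous_on {0..len \<Gamma> e} h"
    unfolding h_def
    by (cases e; cases "loop_index e < i"; cases "loop_index e = i") (simp_all add: continuous_on_minus)
  have "circle_map i (h t) = circle_map i (loop_pos \<m> i (edge_point \<Gamma> e t))" if t: "t \<in> {0..len \<Gamma> e}" for t
  proof (cases e)
    case (Bottom j)
    then show ?thesis using e i t unfolding Bottom by (subst loop_pos_Bottom) (auto simp: h_def Bottom)
  next
    case (Top j)
    have "loop_pos \<m> i (edge_point \<Gamma> e t) = h t + (if j = i \<and> t = \<l> i \<and> t \<noteq> 0 then \<l> i + \<m> i else 0)"
      using e i t unfolding Top by (subst loop_pos_Top) (auto simp: h_def Top)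
    moreover have "loop_eq i (h t) (h t + (\<l> i + \<m> i))"
      unfolding loop_eq_def by (intro exI[of _ "-1"]) simp
    moreover have "h t + (if P then x else 0) = h t \<or> h t + (if P then x else 0) = h t + x" for P x by simp
    ultimately show ?thesis unfolding circle_map_eq_iff[OF i] using loop_eq_refl by metis
  qed
  moreover have "continuous_on {0..len \<Gamma> e} (\<lambda>t. circle_map i (h t))"
    unfolding circle_map_def using h top_pos[OF i] bottom_pos[OF i] by (intro continuous_on_cis continuous_intros) auto
  ultimately have "continuous_on {0..len \<Gamma> e} (\<lambda>t. circle_map i (loop_pos \<m> i (edge_point \<Gamma> e t)))"
    by (metis (no_types, lifting) continuous_on_eq)
  then show "continuous_map (top_of_set {0..len \<Gamma> e}) euclidean (\<lambda>t. circle_map i (loop_pos \<m> i (edge_point \<Gamma> e t)))"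
    by simp
qed auto

lemma topspace_chain: "topspace (graph_topology \<Gamma>) = points \<Gamma>"
  by (rule topspace_graph_topology[OF edge_point_chain])

lemma continuous_map_abel_jacobi:
  "continuous_map (product_topology (\<lambda>_. graph_topology \<Gamma>) {1..g}) euclidean (\<lambda>w. abel_jacobi (sum_divisor d w))"
proof -
  let ?X = "product_topology (\<lambda>_. graph_topology \<Gamma>) {1..g}"
  have "continuous_map ?X euclidean (\<lambda>w. abel_jacobi (sum_divisor d w) i)" for i
  proof (cases "i \<in> {1..g}")
    case True
    have "continuous_map ?X euclidean (\<lambda>w. circle_map i (loop_pos \<m> i (w j)))" if "j \<in> {1..g}" for j
      using continuous_map_compose[OF continuous_map_product_projection[OF that] continuous_map_circle_loop_pos[OF True]]
      by (simp add: o_def)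
    then have "continuous_map ?X euclidean (\<lambda>w. \<Prod>j\<in>{1..g}. circle_map i (loop_pos \<m> i (w j)))"
      unfolding continuous_map_atin limitin_canonical_iff by (auto intro!: tendsto_prod)
    then show ?thesis using True by (simp add: abel_jacobi_def jac_sum_divisor circle_map_sum)
  next
    case False
    then show ?thesis by (simp only: abel_jacobi_def if_False) simp
  qed
  then have "continuous_map ?X (product_topology (\<lambda>_. euclidean) UNIV) (\<lambda>w. abel_jacobi (sum_divisor d w))"
    by (simp add: continuous_map_componentwise_UNIV)
  then show ?thesis by (simp add: euclidean_product_topology)
qed

lemma topspace_Pic_topology: "topspace (Pic_topology \<Gamma> g (Vertex 0) d) = Pic \<Gamma> d"
  unfolding Pic_topology_def
proof (rule topspace_quotient_topology, rule funcsetI)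
  fix w assume "w \<in> topspace (product_topology (\<lambda>_. graph_topology \<Gamma>) {1..g})"
  then have "w i \<in> points \<Gamma>" if "i \<in> {1..g}" for i
    using that by (auto simp: topspace_chain PiE_iff)
  then show "lin_equiv \<Gamma> `` {(\<Sum>i\<in>{1..g}. frag_of (w i)) + frag_cmul (d - int g) (frag_of (Vertex 0))} \<in> Pic \<Gamma> d"
    using sum_divisor[of w d] unfolding Pic_eq sum_divisor_def by blast
qed

text \<open>Continuity descends along the quotient map, and a continuous injection of a compact
  space into a Hausdorff space is a homeomorphism onto its image.\<close>

lemma homeomorphic_map_class_map:
  "homeomorphic_map (Pic_topology \<Gamma> g (Vertex 0) d) (top_of_set (class_map ` Pic \<Gamma> d)) class_map"
proof -
  define X where "X = product_topology (\<lambda>_::nat. graph_topology \<Gamma>) {1..g}"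
  define q where "q w = lin_equiv \<Gamma> `` {sum_divisor d w}" for w
  have P: "Pic_topology \<Gamma> g (Vertex 0) d = quotient_topology X (Pic \<Gamma> d) q"
    unfolding Pic_topology_def X_def q_def sum_divisor_def ..
  have tX: "w i \<in> points \<Gamma>" if "w \<in> topspace X" "i \<in> {1..g}" for w i
    using that by (auto simp: X_def topspace_chain PiE_iff)
  have "q ` topspace X = Pic \<Gamma> d"
  proof
    show "q ` topspace X \<subseteq> Pic \<Gamma> d"
      using sum_divisor tX unfolding Pic_eq q_def by blast
    show "Pic \<Gamma> d \<subseteq> q ` topspace X"
    proof
      fix c assume "c \<in> Pic \<Gamma> d"
      then obtain D where D: "D \<in> Div \<Gamma>" "deg D = d" "c = lin_equiv \<Gamma> `` {D}" by (auto simp: Pic_eq)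
      obtain w where w: "\<forall>i\<in>{1..g}. w i \<in> points \<Gamma>" "\<forall>i\<in>{1..g}. loop_eq i (jac i (sum_divisor d w)) (jac i D)"
        using ex_sum_divisor[of d "\<lambda>i. jac i D"] by blast
      \<comment> \<open>Points of the product topology are extensional, so the tuple is restricted;
        the divisor does not change.\<close>
      define w' where "w' = restrict w {1..g}"
      have "w' \<in> topspace X" using w(1) by (auto simp: X_def topspace_chain w'_def)
      moreover have "sum_divisor d w' = sum_divisor d w" by (simp add: sum_divisor_def w'_def)
      moreover have "abel_jacobi (sum_divisor d w) = abel_jacobi D"
        using w(2) by (auto simp: abel_jacobi_def circle_map_eq_iff)
      moreover have "sum_divisor d w \<in> Div \<Gamma>" "deg (sum_divisor d w) = d" using sum_divisor w(1) by blast+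
      ultimately have "q w' = c" using D by (simp add: q_def lin_equiv_Image)
      then show "c \<in> q ` topspace X" using \<open>w' \<in> topspace X\<close> by blast
    qed
  qed
  then have quot: "quotient_map X (Pic_topology \<Gamma> g (Vertex 0) d) q"
    unfolding P by (rule quotient_map_quotient_topology)
  note top = topspace_Pic_topology[of d]
  show ?thesis
  proof (rule continuous_imp_homeomorphic_map)
    have "continuous_map X euclidean (\<lambda>w. abel_jacobi (sum_divisor d w))"
      unfolding X_def by (rule continuous_map_abel_jacobi)
    then have "continuous_map X euclidean (class_map \<circ> q)"
    proof (rule continuous_map_eq)
      show "abel_jacobi (sum_divisor d w) = (class_map \<circ> q) w" if "w \<in> topspace X" for w
        using sum_divisor(1)[of w d] tX[OF that] by (simp add: q_def class_map_lin_equiv)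
    qed
    then have "continuous_map (Pic_topology \<Gamma> g (Vertex 0) d) euclidean class_map"
      by (rule continuous_compose_quotient_map[OF quot])
    then show "continuous_map (Pic_topology \<Gamma> g (Vertex 0) d) (top_of_set (class_map ` Pic \<Gamma> d)) class_map"
      by (intro continuous_map_into_subtopology) (auto simp: top)
    have "compact_space X"
      unfolding X_def compact_space_product_topology
      using compact_space_graph_topology[OF finite_verts_chain finite_edges_chain ends_chain] by blast
    then have "compactin (Pic_topology \<Gamma> g (Vertex 0) d) (q ` topspace X)"
      using quotient_imp_continuous_map[OF quot] by (intro image_compactin) (auto simp: compact_space_def)
    then show "compact_space (Pic_topology \<Gamma> g (Vertex 0) d)"
      using quotient_imp_surjective_map[OF quot] by (simp add: compact_space_def)
    show "Hausdorff_space (top_of_set (class_map ` Pic \<Gamma> d))"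
      by (simp add: Hausdorff_space_subtopology)
    show "class_map ` topspace (Pic_topology \<Gamma> g (Vertex 0) d) = topspace (top_of_set (class_map ` Pic \<Gamma> d))"
      by (simp add: top)
    show "inj_on class_map (topspace (Pic_topology \<Gamma> g (Vertex 0) d))"
      unfolding top
    proof (rule inj_onI)
      fix c c' assume c: "c \<in> Pic \<Gamma> d" "c' \<in> Pic \<Gamma> d" and eq: "class_map c = class_map c'"
      obtain D D' where D: "D \<in> Div \<Gamma>" "deg D = d" "c = lin_equiv \<Gamma> `` {D}"
        and D': "D' \<in> Div \<Gamma>" "deg D' = d" "c' = lin_equiv \<Gamma> `` {D'}"
        using c unfolding Pic_eq by blast
      have "abel_jacobi D = abel_jacobi D'"
        using eq unfolding D(3) D'(3) class_map_lin_equiv[OF D(1)] class_map_lin_equiv[OF D'(1)] .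
      then show "c = c'" using D D' by (simp add: lin_equiv_Image)
    qed
  qed
qed

lemma W_homeomorphic_space:
  "subtopology (Pic_topology \<Gamma> g (Vertex 0) d) (W \<Gamma> r d) homeomorphic_space
     top_of_set {abel_jacobi D | D. D \<in> Div \<Gamma> \<and> deg D = d \<and> r \<le> rank \<Gamma> D}"
proof -
  let ?P = "Pic_topology \<Gamma> g (Vertex 0) d"
  have WP: "W \<Gamma> r d \<subseteq> Pic \<Gamma> d" by (auto simp: W_def Pic_eq)
  have "topspace ?P = Pic \<Gamma> d"
    by (rule topspace_Pic_topology)
  then have hom: "homeomorphic_map (subtopology ?P (W \<Gamma> r d))
      (subtopology (top_of_set (class_map ` Pic \<Gamma> d)) (class_map ` W \<Gamma> r d)) class_map"
    using WP by (intro homeomorphic_map_subtopologies[OF homeomorphic_map_class_map]) auto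
  have sub: "subtopology (top_of_set (class_map ` Pic \<Gamma> d)) (class_map ` W \<Gamma> r d) = top_of_set (class_map ` W \<Gamma> r d)"
    using WP by (simp add: subtopology_subtopology Int_absorb1 image_mono)
  have img: "class_map ` W \<Gamma> r d = {abel_jacobi D | D. D \<in> Div \<Gamma> \<and> deg D = d \<and> r \<le> rank \<Gamma> D}"
  proof -
    define S where "S = {D \<in> Div \<Gamma>. deg D = d \<and> r \<le> rank \<Gamma> D}"
    have "W \<Gamma> r d = (\<lambda>D. lin_equiv \<Gamma> `` {D}) ` S" unfolding W_def S_def by blast
    then have "class_map ` W \<Gamma> r d = (\<lambda>D. class_map (lin_equiv \<Gamma> `` {D})) ` S" by (simp only: image_image)
    also have "\<dots> = abel_jacobi ` S" by (intro image_cong refl class_map_lin_equiv) (simp add: S_def)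
    finally show ?thesis unfolding S_def by blast
  qed
  show ?thesis using homeomorphic_map_imp_homeomorphic_space[OF hom[unfolded sub]] unfolding img .
qed

section \<open>Dimension of the rank locus\<close>

lemma rank_locus_dim_le:
  assumes gen: "generic_lengths g \<l> \<m>" and n: "(r + 1) * n \<le> g" "0 < n \<Longrightarrow> int n \<le> int g - d + int r"
  shows "top_of_set {abel_jacobi D | D. D \<in> Div \<Gamma> \<and> deg D = d \<and> int r \<le> rank \<Gamma> D} dim_le int (g - (r + 1) * n)"
proof -
  \<comment> \<open>The values of a coordinate at which some chip number from 0 to \<open>d\<close>
    passes. At least \<open>(r + 1) * n\<close> coordinates fall into \<open>F\<close>, so fewer
    than \<open>Suc (g - (r + 1) * n)\<close> lie outside.\<close>
  define F where "F = (\<lambda>(i, t). circle_map i (\<m> i * of_int t)) ` ({1..g} \<times> {0..d})"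
  have "{abel_jacobi D | D. D \<in> Div \<Gamma> \<and> deg D = d \<and> int r \<le> rank \<Gamma> D} \<subseteq>
      torus_points {1..g} F (Suc (g - (r + 1) * n))"
  proof safe
    fix D assume D: "D \<in> Div \<Gamma>" "int r \<le> rank \<Gamma> D" "d = deg D"
    have "(r + 1) * n \<le> card {i \<in> {1..g}. abel_jacobi D i \<in> F}"
    proof (cases "n = 0")
      case False
      have "r + 1 \<le> (r + 1) * n" using False mult_le_mono2[of 1 n "r + 1"] by simp
      then have "r + 1 \<le> g" using n(1) by (rule order_trans)
      then have d: "deg D \<le> 2 * int g - 2" using n(2) False D(3) by simp
      have "(r + 1) * n \<le> card {i \<in> {1..g}. \<exists>t\<in>{0..deg D}. loop_eq i (jac i D) (\<m> i * of_int t)}"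
        using n(2) False D(3) by (intro card_special_coordinates_ge D gen d) auto
      also have "\<dots> \<le> card {i \<in> {1..g}. abel_jacobi D i \<in> F}"
      proof (intro card_mono subsetI)
        fix i assume "i \<in> {i \<in> {1..g}. \<exists>t\<in>{0..deg D}. loop_eq i (jac i D) (\<m> i * of_int t)}"
        then obtain t where i: "i \<in> {1..g}" and t: "t \<in> {0..d}" "loop_eq i (jac i D) (\<m> i * of_int t)"
          using D(3) by blast
        then have "abel_jacobi D i = circle_map i (\<m> i * of_int t)" by (simp add: abel_jacobi_def circle_map_eq_iff)
        then show "i \<in> {i \<in> {1..g}. abel_jacobi D i \<in> F}" using i t(1) by (force simp: F_def)
      qed simp
      finally show ?thesis .
    qed simp
    then show "abel_jacobi D \<in> torus_points {1..g} F (Suc (g - (r + 1) * n))"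
      using n(1) by (auto simp: torus_points_def abel_jacobi_def circle_map_def)
  qed
  moreover have "top_of_set (torus_points {1..g} F (Suc (g - (r + 1) * n))) dim_le int (Suc (g - (r + 1) * n)) - 1"
    by (rule torus_points_dim_le) (auto simp: F_def)
  ultimately show ?thesis using dimension_le_subtopologies by fastforce
qed

text \<open>The tableau fixes the first \<open>(r + 1) * n\<close> coordinates; letting the others
  run over half circles embeds a cube into the locus.\<close>

lemma not_rank_locus_dim_le:
  assumes n: "(r + 1) * n \<le> g" "int g - d + int r \<le> int n"
  shows "\<not> top_of_set {abel_jacobi D | D. D \<in> Div \<Gamma> \<and> deg D = d \<and> int r \<le> rank \<Gamma> D} dim_le int (g - (r + 1) * n) - 1"
proof
  define Z where "Z = {abel_jacobi D | D. D \<in> Div \<Gamma> \<and> deg D = d \<and> int r \<le> rank \<Gamma> D}"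
  define N where "N = (r + 1) * n"
  define k where "k = g - N"
  \<comment> \<open>Loops are counted from 1, steps of the path and coordinates of the cube from 0.
    The angle \<open>pi * y\<close> covers only half a circle, on which the cosine is
    injective.\<close>
  define \<theta> :: "(nat \<Rightarrow> real) \<Rightarrow> nat \<Rightarrow> complex" where
    "\<theta> y i = (if i \<in> {1..g} then if i \<le> N
        then circle_map i (\<m> i * of_int (tableau_path r n d (i - 1) ((i - 1) mod (r + 1)))) else cis (pi * y (i - N - 1)) else 0)" for y i
  assume "top_of_set Z dim_le int (g - (r + 1) * n) - 1"
  moreover have "\<theta> ` cube k \<subseteq> Z"
  proof safe
    fix y assume y: "y \<in> cube k"
    define \<xi> where "\<xi> i = (if i \<le> N then \<m> i * of_int (tableau_path r n d (i - 1) ((i - 1) mod (r + 1)))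
      else (\<l> i + \<m> i) * y (i - N - 1) / 2)" for i
    obtain D where D: "D \<in> Div \<Gamma>" "deg D = d" "\<forall>i\<in>{1..g}. loop_eq i (jac i D) (\<xi> i)"
      using ex_divisor_with_coordinates by blast
    have "int r \<le> rank \<Gamma> D"
    proof (rule rank_ge_if_tableau[OF D(1) n(1)])
      show "loop_eq (Suc i) (jac (Suc i) D) (\<m> (Suc i) * of_int (tableau_path r n (deg D) i (i mod (r + 1))))"
        if "i < (r + 1) * n" for i
        using D(3)[rule_format, of "Suc i"] that n(1) D(2) by (simp add: \<xi>_def N_def)
    qed (use n D in simp)
    moreover have "\<theta> y = abel_jacobi D"
    proof
      fix i
      have "\<theta> y i = circle_map i (\<xi> i)" if i: "i \<in> {1..g}"
      proof -
        have "0 < \<l> i + \<m> i" using top_pos[OF i] bottom_pos[OF i] by simp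
        then show ?thesis using i by (simp add: \<theta>_def \<xi>_def circle_map_def)
      qed
      then show "\<theta> y i = abel_jacobi D i"
        using D(3) circle_map_eq_iff[of i "jac i D" "\<xi> i"] by (auto simp: abel_jacobi_def \<theta>_def)
    qed
    ultimately show "\<theta> y \<in> Z" using D by (auto simp: Z_def)
  qed
  ultimately have le: "top_of_set (\<theta> ` cube k) dim_le int k - 1"
    unfolding k_def N_def by (rule dimension_le_subtopologies)
  have "continuous_on (cube k) (\<lambda>y. cis (pi * y j))" for j
    by (auto intro!: continuous_on_cis continuous_intros continuous_on_product_coordinates[THEN continuous_on_subset])
  then have "continuous_on (cube k) (\<lambda>y. \<theta> y i)" for i
    unfolding \<theta>_def by (cases "i \<in> {1..g}"; cases "i \<le> N") (simp_all only: if_True if_False continuous_on_const)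
  then have cont: "continuous_on (cube k) \<theta>" by (rule continuous_on_coordinatewise_then_product)
  have inj: "inj_on \<theta> (cube k)"
  proof (rule inj_onI)
    fix y z assume yz: "y \<in> cube k" "z \<in> cube k" "\<theta> y = \<theta> z"
    show "y = z"
    proof
      fix j
      show "y j = z j"
      proof (cases "j < k")
        case True
        have yz01: "0 \<le> y j" "y j \<le> 1" "0 \<le> z j" "z j \<le> 1"
          using yz(1,2) True by (auto simp: cube_def)
        have "\<theta> y (Suc (j + N)) = cis (pi * y j)" "\<theta> z (Suc (j + N)) = cis (pi * z j)"
          using True by (auto simp: \<theta>_def k_def)
        then have "cis (pi * y j) = cis (pi * z j)" using yz(3) by simp
        then have "cos (pi * y j) = cos (pi * z j)" by (simp add: complex_eq_iff)
        moreover have "pi * y j \<le> pi" "pi * z j \<le> pi" using yz01 by (simp_all add: mult_left_le)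
        moreover have "0 \<le> pi * y j" "0 \<le> pi * z j" using yz01 by simp_all
        ultimately have "pi * y j = pi * z j" using cos_inj_pi by blast
        then show ?thesis by simp
      next
        case False
        then show ?thesis using yz(1,2) by (auto simp: cube_def)
      qed
    qed
  qed
  have "homeomorphic_map (top_of_set (cube k)) (top_of_set (\<theta> ` cube k)) \<theta>"
  proof (rule continuous_imp_homeomorphic_map)
    show "continuous_map (top_of_set (cube k)) (top_of_set (\<theta> ` cube k)) \<theta>"
      using cont by (intro continuous_map_into_subtopology) auto
    show "compact_space (top_of_set (cube k))"
      using compact_cube by (intro compact_space_subtopology) simp
  qed (use inj in \<open>simp_all add: Hausdorff_space_subtopology\<close>)
  then have "top_of_set (cube k) homeomorphic_space top_of_set (\<theta> ` cube k)"
    by (rule homeomorphic_map_imp_homeomorphic_space)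
  then show False using le not_dim_le_cube[of k] homeomorphic_space_dimension_le by blast
qed

end

theorem theorem1p3:
  fixes g r :: nat and d \<rho> :: int and \<l> \<m> :: "nat \<Rightarrow> real"
    and \<Gamma> :: "(nat, chain_edge) metric_graph"
  assumes "\<And>i. i \<in> {1..g} \<Longrightarrow> 0 < \<l> i"
    and "\<And>i. i \<in> {1..g} \<Longrightarrow> 0 < \<m> i"
    and "generic_lengths g \<l> \<m>"
    and "\<Gamma> = chain_of_loops g \<l> \<m>"
    and "\<rho> = int g - (int r + 1) * (int g - d + int r)"
    and "0 \<le> \<rho>"
  shows "has_dimension (subtopology (Pic_topology \<Gamma> g (Vertex 0) d) (W \<Gamma> (int r) d)) (min \<rho> (int g))"
proof -
  interpret loop_chain g \<l> \<m> by unfold_locales (use assms(1,2) in auto)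
  define n where "n = nat (int g - d + int r)"
  have dim: "int ((r + 1) * n) \<le> int g \<and> min \<rho> (int g) = int g - int ((r + 1) * n)"
  proof (cases "0 \<le> int g - d + int r")
    case True
    then have "int ((r + 1) * n) = int g - \<rho>" using assms(5) by (simp add: n_def algebra_simps)
    then show ?thesis using assms(6) by linarith
  next
    case False
    \<comment> \<open>Here \<open>\<rho>\<close> is at least \<open>g\<close>, in agreement with
      \<open>n = 0\<close>.\<close>
    then have "(int r + 1) * (int g - d + int r) \<le> 0" by (intro mult_nonneg_nonpos) auto
    then have "int g \<le> \<rho>" using assms(5) by linarith
    then show ?thesis using False by (simp add: n_def)
  qed
  then have n: "(r + 1) * n \<le> g" "min \<rho> (int g) = int (g - (r + 1) * n)" by linarith+
  let ?Z = "{abel_jacobi D | D. D \<in> Div \<Gamma> \<and> deg D = d \<and> int r \<le> rank \<Gamma> D}"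
  have "top_of_set ?Z dim_le min \<rho> (int g)"
    unfolding n(2) assms(4) by (rule rank_locus_dim_le[OF assms(3) n(1)]) (simp add: n_def)
  moreover have "\<not> top_of_set ?Z dim_le min \<rho> (int g) - 1"
    unfolding n(2) assms(4) by (rule not_rank_locus_dim_le[OF n(1)]) (simp add: n_def)
  ultimately show ?thesis
    using W_homeomorphic_space[of d "int r"] unfolding has_dimension_def assms(4)
    by (simp add: homeomorphic_space_dimension_le)
qed

end
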